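(* Let $q\neq 0$ be a real parameter, let $\mathcal H_{\mathbb R}$ be a real Hilbert space, and define a unital linear functional $\varphi$ on $\mathcal{TP}(\mathcal H_{\mathbb R})$ by $$\varphi[W((0))]=1,\qquad \varphi[W(\alpha\otimes F)]=0\quad\text{for all } n\ge 1,\ \alpha\in\mathbb C[S_0(n)],\ F\in\mathcal H_{\mathbb R}^{\odot n}.$$ Then: (a) For $\alpha\in S_0(n)$, $\beta\in S_0(k)$, $F\in \mathcal H_{\mathbb R}^{\odot n}$, $G\in\mathcal H_{\mathbb R}^{\odot k}$, $$\varphi\left[W(\beta\otimes_s G)^*\,W(\alpha\otimes_s F)\right]=\langle \alpha\otimes_s F,\ \beta\otimes_s G\rangle_q .$$ In particular, for $q\in\mathcal Z\setminus\{0\}$, $\varphi$ is well defined on the quotient $\mathcal{TP}_q(\mathcal H_{\mathbb R})$. (b) $\varphi$ is tracial. (c) $\varphi$ is positive for $q\in\mathcal Z\setminus\{0\}$ (i.e. $\varphi[A^*A]\ge 0$ for all $A$). (d) For $q\in\mathcal Z\setminus\{0\}$, $\{A\in \mathcal{TP}(\mathcal H_{\mathbb R}):\varphi[A^*A]=0\}=\mathrm{Span}\{W(\zeta):\zeta\in\mathcal N_{vs,q}\}$, and $\varphi$ is faithful on $\mathcal{TP}_q(\mathcal H_{\mathbb R})$. (e) For $\alpha\in S_0(2n)$ and $F\in\mathcal H_{\mathbb R}^{\odot 2n}$, $$\varphi[T(\alpha\otimes F)]=\sum_{\pi\in\mathcal P_2(2n)}q^{\,n-\mathrm{cyc}_0(\pi\alpha)}\,C_\pi(F)=\sum_{\pi\in\mathcal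 P_2(2n)}q^{|\pi\alpha|-n}\,C_\pi(F),$$ and $\varphi[T(\alpha\otimes F)]=0$ if $\alpha\in S_0(2n+1)$, $F\in\mathcal H_{\mathbb R}^{\odot (2n+1)}$.
   Context: Permutations. $[n]=\{1,\dots,n\}$, $[0,n]=\{0,\dots,n\}$; $S(n)$, $S_0(n)$ are the permutation groups of $[n]$, $[0,n]$, with $S(n)\subset S_0(n)$ the permutations fixing $0$; products are composed right to left; for $m>n$, $S_0(n)\subset S_0(m)$ by fixing $n+1,\dots,m$. $\mathrm{cyc}_0(\alpha)$ is the number of cycles of $\alpha\in S_0(n)$ (fixed points are cycles) not containing $0$; $|\alpha|=n-\mathrm{cyc}_0(\alpha)$. $\chi_q$ is the linear extension of $\chi_q(\alpha)=q^{|\alpha|}$. $\mathcal Z=\{0\}\cup\{\pm1/N:N\in\mathbb N\}$. For $\alpha\in S_0(n)$, $\beta\in S_0(k)$, $\alpha\cup\beta=\beta'\alpha\in S_0(n+k)$, where $\beta'$ fixes $[n]$ and is obtained from $\beta$ by replacing each $j\in[k]$ by $n+j$ ($0$ unchanged); thus the cycles containing $0$ are merged into $(0,\alpha(0),\dots,\alpha^{-1}(0),\beta(0)+n,\dots,\beta^{-1}(0)+n)$ and the other cycles are kept (those of $\beta$ shifted by $n$). Contractions. $\mathcal P_{1,2}(n)$ is the set of partitions $\pi$ of $[n]$ into blocks of size 1 and 2, identified with the involution swapping the elements of each pair; $|\pi|$ is the number of pairs, $\mathrm{supp}(\pi)$ the union of the pairs; $\mathcal P_2(n)$ is the set of pair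 partitions. For $S\subset[n]$, $\alpha|_{S^c}$ is the permutation of $[0,n]\setminus S$ obtained by erasing $S$ from the cycles: $x\mapsto\alpha^m(x)$, $m=\min\{j>0:\alpha^j(x)\notin S\}$. For $\ell=|\pi|$, $$C_\pi(\alpha)=q^{\mathrm{cyc}_0((\pi\alpha)|_{\mathrm{supp}(\pi)^c})-\mathrm{cyc}_0(\pi\alpha)+\ell}\;P\big((\pi\alpha)|_{\mathrm{supp}(\pi)^c}\big)\in\mathbb C[S_0(n-2\ell)],$$ where $P$ relabels $[0,n]\setminus\mathrm{supp}(\pi)$ by $[0,n-2\ell]$ in the order-preserving way; extend linearly. On tensors, $C_\pi(h_1\otimes\dots\otimes h_n)=\prod_{\{i,j\}\text{ pair of }\pi}\langle h_i,h_j\rangle\ h_{u_1}\otimes\dots\otimes h_{u_{n-2\ell}}$, with $u_1<\dots<u_{n-2\ell}$ the singletons of $\pi$ (a scalar if there are none). $C_\pi(\alpha\otimes F)=C_\pi(\alpha)\otimes C_\pi(F)$. Algebra. $\mathcal H_{\mathbb R}^{\odot n}$ is the algebraic tensor power; $\mathcal H$ is the complexification of $\mathcal H_{\mathbb R}$. For $\sigma\in S(n)$, $U_\sigma(h_1\otimes\dots\otimes h_n)=h_{\sigma^{-1}(1)}\otimes\dots\otimes h_{\sigma^{-1}(n)}$, and $\alpha\otimes_sF=\frac1{n!}\sum_{\sigma\in S(n)}\sigma\alpha\sigma^{-1}\otimes U_\sigma F$. As a complex vector space $\mathcal{TP}(\mathcal H_{\mathbb R})=\bigoplus_{n\ge0}\mathbb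 C[S_0(n)]\otimes_s\mathcal H_{\mathbb R}^{\odot n}$ (the span of all $\alpha\otimes_sF$, equivalently the quotient identifying $\alpha\otimes F$ with $\sigma\alpha\sigma^{-1}\otimes U_\sigma F$; $W(\alpha\otimes F)$ means $W(\alpha\otimes_s F)$); the element corresponding to $\xi$ is written $W(\xi)$. $(0)$ denotes the identity of $S_0(0)$. For $\eta \in \mathbb C[S_0(n)]$, $T(\eta\otimes F)=\sum_{\pi\in\mathcal P_{1,2}(n)}W(C_\pi(\eta\otimes F))$ (well defined on the symmetrized space; the $T$'s also span). The $*$-algebra structure is given by $T(\alpha\otimes_sF)T(\beta\otimes_sG)=T((\alpha\cup\beta)\otimes_s(F\otimes G))$ and the antilinear extension of $T(\alpha\otimes_sF)^*=T(\alpha^{-1}\otimes_sF)$; the unit is $W((0))=T((0))$. Inner product. $\langle\cdot,\cdot\rangle_q$ is the sesquilinear form (linear in the first argument) with $\langle\alpha\otimes F,\beta\otimes G\rangle_q=\delta_{n=k}\sum_{\sigma\in S(n)}\chi_q(\alpha\sigma\beta^{-1}\sigma^{-1})\langle F,U_\sigma G\rangle$; the value is unchanged if $\otimes$ is replaced by $\otimes_s$. For $q\in\mathcal Z$ it is positive semi-definite; $\mathcal N_{vs,q}$ is its kernel $\{\xi:\langle\xi,\xi\rangle_q=0\}$ (here inside $\mathcal{TP}(\mathcal H_{\mathbb R})$), and $\mathcal{TP}_q(\mathcal H_{\mathbb R})$ is the quotient of $\mathcal{TP}(\mathcal H_{\mathbb R})$ by it (the kernel is an ideal, so this is a $*$-algebra).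 *)

theory Defs
  imports
    "HOL-Analysis.Analysis"
    "HOL-Library.Poly_Mapping"
    "HOL-Library.Nonpos_Ints"
    "HOL-Combinatorics.Orbits"
begin

section \<open>Permutations\<close>

definition Sym :: "nat \<Rightarrow> (nat \<Rightarrow> nat) set" where
  "Sym n = {\<sigma>. \<sigma> permutes {1..n}}"

definition Sym0 :: "nat \<Rightarrow> (nat \<Rightarrow> nat) set" where
  "Sym0 n = {\<alpha>. \<alpha> permutes {0..n}}"

text \<open>Number of cycles of \<open>\<alpha>\<close> on the invariant set \<open>X\<close> that do not contain \<open>0\<close>.\<close>

definition cyc0 :: "nat set \<Rightarrow> (nat \<Rightarrow> nat) \<Rightarrow> nat" where
  "cyc0 X \<alpha> = card {c \<in> orbit \<alpha> ` X. 0 \<notin> c}"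

definition perm_len :: "nat \<Rightarrow> (nat \<Rightarrow> nat) \<Rightarrow> nat" where
  "perm_len n \<alpha> = n - cyc0 {0..n} \<alpha>"

definition chi :: "real \<Rightarrow> nat \<Rightarrow> (nat \<Rightarrow> nat) \<Rightarrow> real" where
  "chi q n \<alpha> = q ^ perm_len n \<alpha>"

definition Zset :: "real set" where
  "Zset = {0} \<union> {1 / real N | N. N \<ge> 1} \<union> {- (1 / real N) | N. N \<ge> 1}"

text \<open>\<open>shift n \<beta>\<close> is the permutation \<open>\<beta>'\<close> of \<open>[0,n+k]\<close> obtained from \<open>\<beta> \<in> Sym0 k\<close> by
  renaming each \<open>j \<ge> 1\<close> to \<open>n + j\<close>; note that \<open>x - n = 0\<close> for \<open>x = 0\<close>.\<close>

definition shift :: "nat \<Rightarrow> (nat \<Rightarrow> nat) \<Rightarrow> nat \<Rightarrow> nat" where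
  "shift n \<beta> x =
     (if x = 0 \<or> n < x then (if \<beta> (x - n) = 0 then 0 else n + \<beta> (x - n)) else x)"

definition cup :: "nat \<Rightarrow> (nat \<Rightarrow> nat) \<Rightarrow> (nat \<Rightarrow> nat) \<Rightarrow> nat \<Rightarrow> nat" where
  "cup n \<alpha> \<beta> = shift n \<beta> \<circ> \<alpha>"

text \<open>Partitions of \<open>[n]\<close> into blocks of size 1 and 2, as involutions.\<close>

definition P12 :: "nat \<Rightarrow> (nat \<Rightarrow> nat) set" where
  "P12 n = {\<pi> \<in> Sym n. \<pi> \<circ> \<pi> = id}"

definition P2 :: "nat \<Rightarrow> (nat \<Rightarrow> nat) set" where
  "P2 n = {\<pi> \<in> P12 n. \<forall>i\<in>{1..n}. \<pi> i \<noteq> i}"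

definition npairs :: "(nat \<Rightarrow> nat) \<Rightarrow> nat" where
  "npairs \<pi> = card {i. i < \<pi> i}"

definition psupp :: "(nat \<Rightarrow> nat) \<Rightarrow> nat set" where
  "psupp \<pi> = {i. \<pi> i \<noteq> i}"

definition erase :: "nat set \<Rightarrow> (nat \<Rightarrow> nat) \<Rightarrow> nat \<Rightarrow> nat" where
  "erase S \<alpha> x = (if x \<in> S then x else (\<alpha> ^^ (LEAST j. 0 < j \<and> (\<alpha> ^^ j) x \<notin> S)) x)"

text \<open>Conjugation of a permutation of the finite set \<open>X\<close> by the order isomorphism from \<open>X\<close> onto
  \<open>{0..<card X}\<close>.\<close>

definition relabel :: "nat set \<Rightarrow> (nat \<Rightarrow> nat) \<Rightarrow> nat \<Rightarrow> nat" where
  "relabel X \<beta> k =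
     (if k < card X then card {y \<in> X. y < \<beta> (sorted_list_of_set X ! k)} else k)"


section \<open>Formal linear combinations and the group algebras\<close>

definition fscale :: "'k::field \<Rightarrow> ('s \<Rightarrow>\<^sub>0 'k) \<Rightarrow> ('s \<Rightarrow>\<^sub>0 'k)" where
  "fscale c x = Poly_Mapping.map ((*) c) x"

lemma lookup_fscale [simp]: "Poly_Mapping.lookup (fscale c x) s = c * Poly_Mapping.lookup x s"
  by (simp add: fscale_def map.rep_eq when_def)

interpretation free: vector_space "fscale :: 'k::field \<Rightarrow> ('s \<Rightarrow>\<^sub>0 'k) \<Rightarrow> ('s \<Rightarrow>\<^sub>0 'k)"
  by unfold_locales (auto intro!: poly_mapping_eqI simp: lookup_add algebra_simps)

type_synonym grpalg = "(nat \<Rightarrow> nat) \<Rightarrow>\<^sub>0 complex"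

definition CSym0 :: "nat \<Rightarrow> grpalg set" where
  "CSym0 n = {\<eta>. Poly_Mapping.keys \<eta> \<subseteq> Sym0 n}"

abbreviation ga :: "(nat \<Rightarrow> nat) \<Rightarrow> grpalg" where
  "ga \<alpha> \<equiv> Poly_Mapping.single \<alpha> 1"

definition contr_perm :: "real \<Rightarrow> nat \<Rightarrow> (nat \<Rightarrow> nat) \<Rightarrow> (nat \<Rightarrow> nat) \<Rightarrow> grpalg" where
  "contr_perm q n \<pi> \<alpha> =
     (let X = {0..n} - psupp \<pi>; \<gamma> = erase (psupp \<pi>) (\<pi> \<circ> \<alpha>)
      in fscale (of_real (q powi (int (cyc0 X \<gamma>) - int (cyc0 {0..n} (\<pi> \<circ> \<alpha>)) + int (npairs \<pi>))))
           (ga (relabel X \<gamma>)))"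

definition contr_ga :: "real \<Rightarrow> nat \<Rightarrow> (nat \<Rightarrow> nat) \<Rightarrow> grpalg \<Rightarrow> grpalg" where
  "contr_ga q n \<pi> \<eta> =
     (\<Sum>\<alpha>\<in>Poly_Mapping.keys \<eta>. fscale (Poly_Mapping.lookup \<eta> \<alpha>) (contr_perm q n \<pi> \<alpha>))"


section \<open>The algebraic tensor algebra of a real vector space\<close>

text \<open>The list \<open>[h\<^sub>1, \<dots>, h\<^sub>n]\<close> stands for \<open>h\<^sub>1 \<otimes> \<dots> \<otimes> h\<^sub>n\<close>.\<close>

definition mlin_rel :: "('h::real_vector list \<Rightarrow>\<^sub>0 real) set" where
  "mlin_rel =
     {Poly_Mapping.single (xs @ (a *\<^sub>R u + b *\<^sub>R v) # ys) 1
        - fscale a (Poly_Mapping.single (xs @ u # ys) 1)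
        - fscale b (Poly_Mapping.single (xs @ v # ys) 1) | xs u v ys a b. True}"

definition tens_rel :: "('h::real_vector list \<Rightarrow>\<^sub>0 real) \<Rightarrow> ('h list \<Rightarrow>\<^sub>0 real) \<Rightarrow> bool" where
  "tens_rel x y \<longleftrightarrow> x - y \<in> free.span mlin_rel"

lemma equivp_span_rel: "equivp (\<lambda>x y. x - y \<in> free.span R)"
proof (rule equivpI)
  show "reflp (\<lambda>x y. x - y \<in> free.span R)"
    by (simp add: reflp_def free.span_zero)
  show "symp (\<lambda>x y. x - y \<in> free.span R)"
  proof (rule sympI)
    fix x y assume "x - y \<in> free.span R"
    then have "- (x - y) \<in> free.span R" by (rule free.span_neg)
    then show "y - x \<in> free.span R" by simp
  qed
  show "transp (\<lambda>x y. x - y \<in> free.span R)"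
  proof (rule transpI)
    fix x y z assume "x - y \<in> free.span R" "y - z \<in> free.span R"
    then have "(x - y) + (y - z) \<in> free.span R" by (rule free.span_add)
    then show "x - z \<in> free.span R" by simp
  qed
qed

quotient_type (overloaded) 'h tensor = "'h::real_vector list \<Rightarrow>\<^sub>0 real" / tens_rel
  unfolding tens_rel_def[abs_def] by (rule equivp_span_rel)

lemma span_rel_add:
  assumes "x - x' \<in> free.span R" "y - y' \<in> free.span R"
  shows "x + y - (x' + y') \<in> free.span R"
proof -
  have eq: "x + y - (x' + y') = (x - x') + (y - y')" by (simp add: algebra_simps)
  show ?thesis unfolding eq by (rule free.span_add[OF assms])
qed

lemma span_rel_diff:
  assumes "x - x' \<in> free.span R" "y - y' \<in> free.span R"
  shows "x - y - (x' - y') \<in> free.span R"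
proof -
  have eq: "x - y - (x' - y') = (x - x') - (y - y')" by (simp add: algebra_simps)
  show ?thesis unfolding eq by (rule free.span_diff[OF assms])
qed

lemma span_rel_uminus:
  assumes "x - x' \<in> free.span R"
  shows "- x - - x' \<in> free.span R"
  using free.span_neg[OF assms] by simp

lemma span_rel_scale:
  assumes "x - x' \<in> free.span R"
  shows "fscale c x - fscale c x' \<in> free.span R"
  using free.span_scale[OF assms, of c] by (simp add: free.scale_right_diff_distrib)

instantiation tensor :: (real_vector) real_vector
begin

lift_definition zero_tensor :: "'a tensor" is 0 .

lift_definition plus_tensor :: "'a tensor \<Rightarrow> 'a tensor \<Rightarrow> 'a tensor" is "(+)"
  unfolding tens_rel_def by (rule span_rel_add)

lift_definition minus_tensor :: "'a tensor \<Rightarrow> 'a tensor \<Rightarrow> 'a tensor" is "(-)"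
  unfolding tens_rel_def by (rule span_rel_diff)

lift_definition uminus_tensor :: "'a tensor \<Rightarrow> 'a tensor" is uminus
  unfolding tens_rel_def by (rule span_rel_uminus)

lift_definition scaleR_tensor :: "real \<Rightarrow> 'a tensor \<Rightarrow> 'a tensor" is fscale
  unfolding tens_rel_def by (rule span_rel_scale)

instance
  by standard
    (transfer, simp add: tens_rel_def free.span_zero algebra_simps free.scale_left_distrib
       free.scale_right_distrib)+

end

lift_definition tens :: "'h::real_vector list \<Rightarrow> 'h tensor" is "\<lambda>hs. Poly_Mapping.single hs 1" .

definition tpow :: "nat \<Rightarrow> 'h::real_vector tensor set" where
  "tpow n = span (tens ` {hs. length hs = n})"

definition multilinear :: "('h::real_vector list \<Rightarrow> 'v::real_vector) \<Rightarrow> bool" where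
  "multilinear g \<longleftrightarrow>
     (\<forall>xs u v ys a b. g (xs @ (a *\<^sub>R u + b *\<^sub>R v) # ys)
        = a *\<^sub>R g (xs @ u # ys) + b *\<^sub>R g (xs @ v # ys))"

text \<open>The linear extension of a multilinear map.\<close>

definition tens_lift :: "('h::real_vector list \<Rightarrow> 'v::real_vector) \<Rightarrow> 'h tensor \<Rightarrow> 'v" where
  "tens_lift g = (THE L. linear L \<and> (\<forall>hs. L (tens hs) = g hs))"

lemma tens_scale_sum: "abs_tensor (\<Sum>s\<in>A. fscale (c s) (f s)) = (\<Sum>s\<in>A. c s *\<^sub>R abs_tensor (f s))"
  by (induction A rule: infinite_finite_induct)
     (simp_all add: zero_tensor.abs_eq[symmetric] plus_tensor.abs_eq[symmetric] scaleR_tensor.abs_eq[symmetric])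

lemma free_expansion:
  "x = (\<Sum>s\<in>Poly_Mapping.keys x. fscale (Poly_Mapping.lookup x s) (Poly_Mapping.single s 1))"
proof (rule poly_mapping_eqI)
  fix t
  have "Poly_Mapping.lookup (\<Sum>s\<in>Poly_Mapping.keys x. fscale (Poly_Mapping.lookup x s) (Poly_Mapping.single s 1)) t
      = (\<Sum>s\<in>Poly_Mapping.keys x. if s = t then Poly_Mapping.lookup x s else 0)"
    unfolding lookup_sum by (intro sum.cong refl) (simp add: lookup_single)
  also have "\<dots> = Poly_Mapping.lookup x t"
    by (simp add: sum.delta in_keys_iff)
  finally show "Poly_Mapping.lookup x t = Poly_Mapping.lookup
     (\<Sum>s\<in>Poly_Mapping.keys x. fscale (Poly_Mapping.lookup x s) (Poly_Mapping.single s 1)) t"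
    by simp
qed

text \<open>Linear extension of \<open>g\<close> along the scalar multiplication \<open>sc\<close> of the target.\<close>

definition lin_ext :: "('k::field \<Rightarrow> 'v \<Rightarrow> 'v::ab_group_add) \<Rightarrow> ('s \<Rightarrow> 'v) \<Rightarrow> ('s \<Rightarrow>\<^sub>0 'k) \<Rightarrow> 'v" where
  "lin_ext sc g x = (\<Sum>s\<in>Poly_Mapping.keys x. sc (Poly_Mapping.lookup x s) (g s))"

context vector_space
begin

lemma lin_ext_superset:
  assumes "finite A" "Poly_Mapping.keys x \<subseteq> A"
  shows "lin_ext scale g x = (\<Sum>s\<in>A. scale (Poly_Mapping.lookup x s) (g s))"
  unfolding lin_ext_def using assms
  by (intro sum.mono_neutral_left) (auto simp: in_keys_iff)

lemma lin_ext_single [simp]: "lin_ext scale g (Poly_Mapping.single s 1) = g s"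
  by (simp add: lin_ext_def)

lemma linear_lin_ext: "Vector_Spaces.linear fscale scale (lin_ext scale g)"
proof (unfold Vector_Spaces.linear_iff, intro conjI allI)
  show "lin_ext scale g (x + y) = lin_ext scale g x + lin_ext scale g y" for x y
  proof -
    let ?A = "Poly_Mapping.keys x \<union> Poly_Mapping.keys y"
    have "Poly_Mapping.keys (x + y) \<subseteq> ?A" by (rule keys_add)
    then show ?thesis
      by (simp add: lin_ext_superset[of ?A] lookup_add scale_left_distrib sum.distrib)
  qed
  show "lin_ext scale g (fscale c x) = scale c (lin_ext scale g x)" for c x
  proof -
    have "Poly_Mapping.keys (fscale c x) \<subseteq> Poly_Mapping.keys x"
      by (auto simp: in_keys_iff)
    then show ?thesis
      by (simp add: lin_ext_superset[of "Poly_Mapping.keys x"] scale_sum_right)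
  qed
qed (fact free.vector_space_axioms, fact vector_space_axioms)

lemma lin_ext_span_cong:
  assumes "\<And>r. r \<in> R \<Longrightarrow> lin_ext scale g r = 0" "x - y \<in> free.span R"
  shows "lin_ext scale g x = lin_ext scale g y"
proof -
  interpret L: Vector_Spaces.linear fscale scale "lin_ext scale g" by (rule linear_lin_ext)
  have "lin_ext scale g (x - y) = 0"
    using assms(2,1) by (rule L.eq_0_on_span[rotated])
  then show ?thesis by (simp add: L.diff)
qed

end

lemma tens_lift_ex1:
  assumes "multilinear g"
  shows "\<exists>!L. linear L \<and> (\<forall>hs. L (tens hs) = g hs)"
proof (rule ex1I)
  interpret L: Vector_Spaces.linear fscale scaleR "lin_ext scaleR g"
    by (rule real_vector.linear_lin_ext)
  define M where "M F = lin_ext scaleR g (rep_tensor F)" for F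
  have "lin_ext scaleR g r = 0" if "r \<in> mlin_rel" for r
    using that assms by (auto simp: mlin_rel_def multilinear_def L.diff L.scale)
  note zero = this
  have M_abs: "M (abs_tensor x) = lin_ext scaleR g x" for x
  proof -
    have "tens_rel (rep_tensor (abs_tensor x)) x"
      by (simp add: tensor.abs_eq_iff[symmetric] Quotient3_abs_rep[OF Quotient3_tensor])
    then show ?thesis
      using zero unfolding M_def tens_rel_def
      by (intro real_vector.lin_ext_span_cong) auto
  qed
  have "linear M"
  proof (rule linearI)
    show "M (F + G) = M F + M G" for F G
      by (induction F rule: tensor.abs_induct, induction G rule: tensor.abs_induct) (simp add: plus_tensor.abs_eq M_abs L.add)
    show "M (c *\<^sub>R F) = c *\<^sub>R M F" for c F
      by (induction F rule: tensor.abs_induct) (simp add: scaleR_tensor.abs_eq M_abs L.scale)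
  qed
  moreover have "M (tens hs) = g hs" for hs
    by (simp add: tens.abs_eq M_abs)
  ultimately show "linear M \<and> (\<forall>hs. M (tens hs) = g hs)" by simp
  fix L assume L: "linear L \<and> (\<forall>hs. L (tens hs) = g hs)"
  show "L = M"
  proof
    fix F show "L F = M F"
    proof (induction F rule: tensor.abs_induct)
      case (1 x)
      have "abs_tensor x = (\<Sum>hs\<in>Poly_Mapping.keys x. Poly_Mapping.lookup x hs *\<^sub>R tens hs)"
        by (subst free_expansion) (simp only: tens_scale_sum tens.abs_eq)
      then show ?case
        using L \<open>linear M\<close> \<open>\<And>hs. M (tens hs) = g hs\<close>
        by (simp add: linear_sum linear_scale)
    qed
  qed
qed

lemma tens_lift:
  assumes "multilinear g"
  shows "linear (tens_lift g)" "tens_lift g (tens hs) = g hs"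
  using theI'[OF tens_lift_ex1[OF assms]] unfolding tens_lift_def by auto

lemma tens_multilinear:
  "tens (xs @ (a *\<^sub>R u + b *\<^sub>R v) # ys) = a *\<^sub>R tens (xs @ u # ys) + b *\<^sub>R tens (xs @ v # ys)"
proof -
  have "tens_rel (Poly_Mapping.single (xs @ (a *\<^sub>R u + b *\<^sub>R v) # ys) 1)
     (fscale a (Poly_Mapping.single (xs @ u # ys) 1) + fscale b (Poly_Mapping.single (xs @ v # ys) 1))"
    unfolding tens_rel_def diff_diff_eq[symmetric] mlin_rel_def
    by (rule free.span_base) blast
  then show ?thesis
    by (simp add: tens.abs_eq scaleR_tensor.abs_eq plus_tensor.abs_eq tensor.abs_eq_iff)
qed

definition tens_scal :: "'h::real_vector tensor \<Rightarrow> real" where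
  "tens_scal = tens_lift (\<lambda>hs. if hs = [] then 1 else 0)"

definition tens_prod :: "'h::real_vector tensor \<Rightarrow> 'h tensor \<Rightarrow> 'h tensor" where
  "tens_prod F G = tens_lift (\<lambda>hs. tens_lift (\<lambda>gs. tens (hs @ gs)) G) F"

definition tens_inner :: "'h::real_inner tensor \<Rightarrow> 'h tensor \<Rightarrow> real" where
  "tens_inner F G =
     tens_lift (\<lambda>hs. tens_lift (\<lambda>gs.
       if length hs = length gs then \<Prod>i<length hs. hs ! i \<bullet> gs ! i else 0) G) F"

text \<open>Positions in \<open>h\<^sub>1 \<otimes> \<dots> \<otimes> h\<^sub>n\<close> are counted from \<open>1\<close>, list positions from \<open>0\<close>. The maps
  below act on the degree \<open>n\<close> component and annihilate the others.\<close>

definition Uperm :: "nat \<Rightarrow> (nat \<Rightarrow> nat) \<Rightarrow> 'h::real_vector tensor \<Rightarrow> 'h tensor" where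
  "Uperm n \<sigma> = tens_lift (\<lambda>hs.
     if length hs = n then tens (map (\<lambda>i. hs ! (inv \<sigma> i - 1)) [1..<Suc n]) else 0)"

lemma multilinear_Uperm:
  assumes "\<sigma> \<in> Sym n"
  shows "multilinear (\<lambda>hs :: 'h::real_vector list.
     if length hs = n then tens (map (\<lambda>i. hs ! (inv \<sigma> i - 1)) [1..<Suc n]) else 0)"
  unfolding multilinear_def
proof (intro allI)
  fix xs ys :: "'h list" and u v :: 'h and a b :: real
  let ?g = "\<lambda>hs :: 'h list.
     if length hs = n then tens (map (\<lambda>i. hs ! (inv \<sigma> i - 1)) [1..<Suc n]) else 0"
  show "?g (xs @ (a *\<^sub>R u + b *\<^sub>R v) # ys) = a *\<^sub>R ?g (xs @ u # ys) + b *\<^sub>R ?g (xs @ v # ys)"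
  proof (cases "Suc (length xs + length ys) = n")
    case True
    have perm: "\<sigma> permutes {1..n}" using assms by (simp add: Sym_def)
    define k where "k = \<sigma> (Suc (length xs))"
    have k: "k \<in> {1..n}"
      unfolding k_def using True by (subst permutes_in_image[OF perm]) auto
    have inv_k: "inv \<sigma> k = Suc (length xs)"
      unfolding k_def by (rule permutes_inverses(2)[OF perm])
    define f where "f i = (xs @ u # ys) ! (inv \<sigma> i - 1)" for i
    have split: "[1..<Suc n] = [1..<k] @ k # [Suc k..<Suc n]"
    proof -
      have "[1..<Suc n] = [1..<k] @ [k..<Suc n]"
        using k upt_add_eq_append[of 1 k "Suc n - k"] by simp
      also have "[k..<Suc n] = k # [Suc k..<Suc n]"
        using k by (intro upt_conv_Cons) auto
      finally show ?thesis .
    qed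
    have other: "(xs @ w # ys) ! (inv \<sigma> i - 1) = f i" if "i \<noteq> k" "i \<in> {1..n}" for i w
    proof -
      have "inv \<sigma> i \<in> {1..n}"
        using that(2) permutes_in_image[OF permutes_inv[OF perm]] by blast
      moreover have "inv \<sigma> i \<noteq> Suc (length xs)"
        using that(1) permutes_inverses(1)[OF perm] by (metis k_def)
      ultimately have "inv \<sigma> i - 1 \<noteq> length xs" by auto
      then show ?thesis unfolding f_def by (auto simp: nth_append nth_Cons')
    qed
    have eq: "?g (xs @ w # ys) = tens (map f [1..<k] @ w # map f [Suc k..<Suc n])" for w
    proof -
      have "map (\<lambda>i. (xs @ w # ys) ! (inv \<sigma> i - 1)) [1..<k] = map f [1..<k]"
        using k by (intro map_cong refl other) auto
      moreover have "map (\<lambda>i. (xs @ w # ys) ! (inv \<sigma> i - 1)) [Suc k..<Suc n] = map f [Suc k..<Suc n]"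
        using k by (intro map_cong refl other) auto
      ultimately show ?thesis
        using True unfolding split by (simp add: inv_k cong: map_cong del: upt_Suc map_eq_conv)
    qed
    show ?thesis unfolding eq by (rule tens_multilinear)
  qed simp
qed

definition contr_tens :: "nat \<Rightarrow> (nat \<Rightarrow> nat) \<Rightarrow> 'h::real_inner tensor \<Rightarrow> 'h tensor" where
  "contr_tens n \<pi> = tens_lift (\<lambda>hs.
     if length hs = n
     then (\<Prod>i | i < \<pi> i. hs ! (i - 1) \<bullet> hs ! (\<pi> i - 1)) *\<^sub>R
            tens (map (\<lambda>i. hs ! (i - 1)) (filter (\<lambda>i. \<pi> i = i) [1..<Suc n]))
     else 0)"


section \<open>The vector space of tensor-decorated permutations\<close>

text \<open>The triple \<open>(n, \<alpha>, F)\<close> stands for \<open>\<alpha> \<otimes>\<^sub>s F\<close> with \<open>\<alpha> \<in> Sym0 n\<close> and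
  \<open>F \<in> tpow n\<close>. The first two sets of relations give the direct sum over \<open>n\<close> of the complex vector
  spaces \<open>\<complex>[Sym0 n] \<otimes>\<^sub>\<real> tpow n\<close> with \<open>\<alpha> \<otimes> F\<close> and
  \<open>\<sigma>\<alpha>\<sigma>\<^sup>-\<^sup>1 \<otimes> U\<^sub>\<sigma> F\<close> identified; the last one discards the meaningless triples.\<close>

definition tp_relators :: "((nat \<times> (nat \<Rightarrow> nat) \<times> 'h::real_inner tensor) \<Rightarrow>\<^sub>0 complex) set" where
  "tp_relators =
     {Poly_Mapping.single (n, \<alpha>, a *\<^sub>R F + b *\<^sub>R G) 1
        - fscale (of_real a) (Poly_Mapping.single (n, \<alpha>, F) 1)
        - fscale (of_real b) (Poly_Mapping.single (n, \<alpha>, G) 1) | n \<alpha> a b F G.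
        \<alpha> \<in> Sym0 n \<and> F \<in> tpow n \<and> G \<in> tpow n} \<union>
     {Poly_Mapping.single (n, \<sigma> \<circ> \<alpha> \<circ> inv \<sigma>, Uperm n \<sigma> F) 1
        - Poly_Mapping.single (n, \<alpha>, F) 1 | n \<sigma> \<alpha> F.
        \<sigma> \<in> Sym n \<and> \<alpha> \<in> Sym0 n \<and> F \<in> tpow n} \<union>
     {Poly_Mapping.single (n, \<alpha>, F) 1 | n \<alpha> F. \<alpha> \<notin> Sym0 n \<or> F \<notin> tpow n}"

definition tp_rel :: "((nat \<times> (nat \<Rightarrow> nat) \<times> 'h::real_inner tensor) \<Rightarrow>\<^sub>0 complex)
    \<Rightarrow> ((nat \<times> (nat \<Rightarrow> nat) \<times> 'h tensor) \<Rightarrow>\<^sub>0 complex) \<Rightarrow> bool" where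
  "tp_rel x y \<longleftrightarrow> x - y \<in> free.span tp_relators"

quotient_type (overloaded) 'h tp =
    "(nat \<times> (nat \<Rightarrow> nat) \<times> 'h::real_inner tensor) \<Rightarrow>\<^sub>0 complex" / tp_rel
  unfolding tp_rel_def[abs_def] by (rule equivp_span_rel)

instantiation tp :: (real_inner) ab_group_add
begin

lift_definition zero_tp :: "'a tp" is 0 .

lift_definition plus_tp :: "'a tp \<Rightarrow> 'a tp \<Rightarrow> 'a tp" is "(+)"
  unfolding tp_rel_def by (rule span_rel_add)

lift_definition minus_tp :: "'a tp \<Rightarrow> 'a tp \<Rightarrow> 'a tp" is "(-)"
  unfolding tp_rel_def by (rule span_rel_diff)

lift_definition uminus_tp :: "'a tp \<Rightarrow> 'a tp" is uminus
  unfolding tp_rel_def by (rule span_rel_uminus)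

instance
  by standard (transfer, simp add: tp_rel_def free.span_zero algebra_simps)+

end

lift_definition scaleC :: "complex \<Rightarrow> 'h::real_inner tp \<Rightarrow> 'h tp" (infixr \<open>*\<^sub>C\<close> 75) is fscale
  unfolding tp_rel_def by (rule span_rel_scale)

interpretation tp: vector_space "scaleC :: complex \<Rightarrow> 'h::real_inner tp \<Rightarrow> 'h tp"
  by standard
    (transfer, simp add: tp_rel_def free.span_zero free.scale_left_distrib
       free.scale_right_distrib)+

abbreviation clinear :: "('h::real_inner tp \<Rightarrow> 'h tp) \<Rightarrow> bool" where
  "clinear \<equiv> Vector_Spaces.linear (*\<^sub>C) (*\<^sub>C)"

abbreviation clinear_functional :: "('h::real_inner tp \<Rightarrow> complex) \<Rightarrow> bool" where
  "clinear_functional \<equiv> Vector_Spaces.linear (*\<^sub>C) (*)"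

definition cantilinear :: "('h::real_inner tp \<Rightarrow> 'h tp) \<Rightarrow> bool" where
  "cantilinear f \<longleftrightarrow> (\<forall>x y. f (x + y) = f x + f y) \<and> (\<forall>c x. f (c *\<^sub>C x) = cnj c *\<^sub>C f x)"

definition sesquilinear :: "('h::real_inner tp \<Rightarrow> 'h tp \<Rightarrow> complex) \<Rightarrow> bool" where
  "sesquilinear B \<longleftrightarrow>
     (\<forall>y. clinear_functional (\<lambda>x. B x y)) \<and> (\<forall>x. clinear_functional (\<lambda>y. cnj (B x y)))"

definition Wperm :: "nat \<Rightarrow> (nat \<Rightarrow> nat) \<Rightarrow> 'h::real_inner tensor \<Rightarrow> 'h tp" where
  "Wperm n \<alpha> F = abs_tp (Poly_Mapping.single (n, \<alpha>, F) 1)"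

text \<open>\<open>W n \<eta> F\<close> is \<open>W(\<eta> \<otimes> F) = W(\<eta> \<otimes>\<^sub>s F)\<close> for \<open>\<eta> \<in> CSym0 n\<close> and \<open>F \<in> tpow n\<close>.\<close>

definition W :: "nat \<Rightarrow> grpalg \<Rightarrow> 'h::real_inner tensor \<Rightarrow> 'h tp" where
  "W n \<eta> F = (\<Sum>\<alpha>\<in>Poly_Mapping.keys \<eta>. Poly_Mapping.lookup \<eta> \<alpha> *\<^sub>C Wperm n \<alpha> F)"

lemma W_ga: "W n (ga \<alpha>) F = Wperm n \<alpha> F"
  by (simp add: W_def)

lemma Uperm_tpow:
  fixes F :: "'h::real_vector tensor"
  assumes "\<sigma> \<in> Sym n" "F \<in> tpow n"
  shows "Uperm n \<sigma> F \<in> tpow n"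
proof -
  note U = tens_lift[OF multilinear_Uperm[where 'h = 'h, OF assms(1)], folded Uperm_def]
  have "Uperm n \<sigma> ` span (tens ` {hs :: 'h list. length hs = n}) =
      span (Uperm n \<sigma> ` tens ` {hs. length hs = n})"
    by (rule span_linear_image[OF U(1), symmetric])
  also have "\<dots> \<subseteq> tpow n"
    unfolding tpow_def
  proof (intro span_mono subsetI)
    fix G :: "'h tensor" assume "G \<in> Uperm n \<sigma> ` tens ` {hs. length hs = n}"
    then obtain hs :: "'h list" where "length hs = n" "G = Uperm n \<sigma> (tens hs)" by blast
    then show "G \<in> tens ` {hs. length hs = n}" by (auto simp: U(2) simp del: upt_Suc intro!: imageI)
  qed
  finally show ?thesis using assms(2) unfolding tpow_def by blast
qed

lemma Sym0_conj:
  assumes "\<sigma> \<in> Sym n" "\<alpha> \<in> Sym0 n"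
  shows "\<sigma> \<circ> \<alpha> \<circ> inv \<sigma> \<in> Sym0 n"
proof -
  have "\<sigma> permutes {0..n}"
    using assms(1) unfolding Sym_def by (auto intro: permutes_subset)
  then show ?thesis
    using assms(2) unfolding Sym0_def by (auto intro!: permutes_compose permutes_inv)
qed

lemma W_conj:
  assumes "\<sigma> \<in> Sym n" "\<alpha> \<in> Sym0 n" "F \<in> tpow n"
  shows "W n (ga (\<sigma> \<circ> \<alpha> \<circ> inv \<sigma>)) (Uperm n \<sigma> F) = W n (ga \<alpha>) F"
  unfolding W_ga Wperm_def tp.abs_eq_iff tp_rel_def tp_relators_def
  using assms by (intro free.span_base UnI1 UnI2) blast

lemma W_average:
  assumes "\<alpha> \<in> Sym0 n" "F \<in> tpow n"
  shows "(1 / fact n) *\<^sub>C (\<Sum>\<sigma>\<in>Sym n. W n (ga (\<sigma> \<circ> \<alpha> \<circ> inv \<sigma>)) (Uperm n \<sigma> F)) = W n (ga \<alpha>) F"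
proof -
  have "(\<Sum>\<sigma>\<in>Sym n. W n (ga (\<sigma> \<circ> \<alpha> \<circ> inv \<sigma>)) (Uperm n \<sigma> F)) = (\<Sum>\<sigma>\<in>Sym n. W n (ga \<alpha>) F)"
    by (intro sum.cong refl W_conj assms)
  also have "\<dots> = of_nat (card (Sym n)) *\<^sub>C W n (ga \<alpha>) F"
    by (simp only: tp.sum_constant_scale)
  also have "card (Sym n) = fact n"
    unfolding Sym_def by (rule card_permutations) simp_all
  finally have eq: "(\<Sum>\<sigma>\<in>Sym n. W n (ga (\<sigma> \<circ> \<alpha> \<circ> inv \<sigma>)) (Uperm n \<sigma> F))
      = of_nat (fact n) *\<^sub>C W n (ga \<alpha>) F" .
  show ?thesis unfolding eq by simp
qed

lemma tp_expansion:
  "abs_tp x = (\<Sum>s\<in>Poly_Mapping.keys x. Poly_Mapping.lookup x s *\<^sub>C Wperm (fst s) (fst (snd s)) (snd (snd s)))"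
proof -
  have "abs_tp (\<Sum>s\<in>A. fscale (c s) (f s)) = (\<Sum>s\<in>A. c s *\<^sub>C abs_tp (f s))"
    for A c and f :: "_ \<Rightarrow> (nat \<times> (nat \<Rightarrow> nat) \<times> 'a tensor) \<Rightarrow>\<^sub>0 complex"
    by (induction A rule: infinite_finite_induct)
       (simp_all add: zero_tp.abs_eq[symmetric] plus_tp.abs_eq[symmetric] scaleC.abs_eq[symmetric])
  then show ?thesis
    by (subst free_expansion) (simp add: Wperm_def)
qed

lemma Wperm_illegal: "\<alpha> \<notin> Sym0 n \<or> F \<notin> tpow n \<Longrightarrow> Wperm n \<alpha> F = 0"
  unfolding Wperm_def zero_tp.abs_eq tp.abs_eq_iff tp_rel_def
  by (rule free.span_base) (auto simp: tp_relators_def)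

text \<open>The universal property of the quotient; it is what makes definitions by prescribing values
  on the generators meaningful.\<close>

lemma tp_lift_ex1:
  fixes sc :: "complex \<Rightarrow> 'v \<Rightarrow> 'v::ab_group_add"
    and g :: "nat \<Rightarrow> (nat \<Rightarrow> nat) \<Rightarrow> 'h::real_inner tensor \<Rightarrow> 'v"
  assumes sc: "vector_space sc"
    and lin: "\<And>n \<alpha> F G a b. \<alpha> \<in> Sym0 n \<Longrightarrow> F \<in> tpow n \<Longrightarrow> G \<in> tpow n \<Longrightarrow>
      g n \<alpha> (a *\<^sub>R F + b *\<^sub>R G) = sc (of_real a) (g n \<alpha> F) + sc (of_real b) (g n \<alpha> G)"
    and conj: "\<And>n \<sigma> \<alpha> F. \<sigma> \<in> Sym n \<Longrightarrow> \<alpha> \<in> Sym0 n \<Longrightarrow> F \<in> tpow n \<Longrightarrow>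
      g n (\<sigma> \<circ> \<alpha> \<circ> inv \<sigma>) (Uperm n \<sigma> F) = g n \<alpha> F"
  shows "\<exists>!L. Vector_Spaces.linear (*\<^sub>C) sc L \<and>
    (\<forall>n. \<forall>\<alpha>\<in>Sym0 n. \<forall>F\<in>tpow n. L (W n (ga \<alpha>) F) = g n \<alpha> F)"
proof (rule ex1I)
  interpret V: vector_space sc by (rule sc)
  define h where "h = (\<lambda>(n, \<alpha>, F). if \<alpha> \<in> Sym0 n \<and> F \<in> tpow n then g n \<alpha> F else 0)"
  have h_val: "h (n, \<alpha>, F) = (if \<alpha> \<in> Sym0 n \<and> F \<in> tpow n then g n \<alpha> F else 0)" for n \<alpha> F
    by (simp add: h_def)
  interpret E: Vector_Spaces.linear fscale sc "lin_ext sc h" by (rule V.linear_lin_ext)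
  define M where "M X = lin_ext sc h (rep_tp X)" for X
  have zero: "lin_ext sc h r = 0" if "r \<in> tp_relators" for r
  proof -
    have "a *\<^sub>R F + b *\<^sub>R G \<in> tpow n" if "F \<in> tpow n" "G \<in> tpow n" for a b n and F G :: "'h tensor"
      using that unfolding tpow_def by (intro span_add span_scale)
    then show ?thesis
      using that unfolding tp_relators_def
      by (auto simp: E.diff E.scale V.lin_ext_single h_val lin conj Uperm_tpow Sym0_conj)
  qed
  have M_abs: "M (abs_tp x) = lin_ext sc h x" for x
  proof -
    have "tp_rel (rep_tp (abs_tp x)) x"
      by (simp add: tp.abs_eq_iff[symmetric] Quotient3_abs_rep[OF Quotient3_tp])
    then show ?thesis
      using zero unfolding M_def tp_rel_def by (intro V.lin_ext_span_cong) auto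
  qed
  have lin_M: "Vector_Spaces.linear (*\<^sub>C) sc M"
  proof (unfold Vector_Spaces.linear_iff, intro conjI allI)
    show "M (X + Y) = M X + M Y" for X Y
      by (induction X rule: tp.abs_induct, induction Y rule: tp.abs_induct)
         (simp add: plus_tp.abs_eq M_abs E.add)
    show "M (c *\<^sub>C X) = sc c (M X)" for c X
      by (induction X rule: tp.abs_induct) (simp add: scaleC.abs_eq M_abs E.scale)
  qed (fact tp.vector_space_axioms, fact sc)
  have val_M: "M (Wperm n \<alpha> F) = h (n, \<alpha>, F)" for n \<alpha> F
    by (simp add: Wperm_def M_abs V.lin_ext_single)
  show "Vector_Spaces.linear (*\<^sub>C) sc M \<and>
    (\<forall>n. \<forall>\<alpha>\<in>Sym0 n. \<forall>F\<in>tpow n. M (W n (ga \<alpha>) F) = g n \<alpha> F)"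
    using lin_M by (simp add: W_ga val_M h_val)
  fix L assume L: "Vector_Spaces.linear (*\<^sub>C) sc L \<and>
    (\<forall>n. \<forall>\<alpha>\<in>Sym0 n. \<forall>F\<in>tpow n. L (W n (ga \<alpha>) F) = g n \<alpha> F)"
  interpret L: Vector_Spaces.linear "(*\<^sub>C)" sc L using L by blast
  interpret M: Vector_Spaces.linear "(*\<^sub>C)" sc M by (rule lin_M)
  have val: "L (Wperm n \<alpha> F) = M (Wperm n \<alpha> F)" for n \<alpha> F
    using L Wperm_illegal[of \<alpha> n F] by (cases "\<alpha> \<in> Sym0 n \<and> F \<in> tpow n")
      (auto simp: val_M h_val W_ga L.zero)
  show "L = M"
  proof
    fix X show "L X = M X"
      by (induction X rule: tp.abs_induct) (simp add: tp_expansion L.sum M.sum L.scale M.scale val)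
  qed
qed

definition T :: "real \<Rightarrow> nat \<Rightarrow> grpalg \<Rightarrow> 'h::real_inner tensor \<Rightarrow> 'h tp" where
  "T q n \<eta> F = (\<Sum>\<pi>\<in>P12 n. W (n - 2 * npairs \<pi>) (contr_ga q n \<pi> \<eta>) (contr_tens n \<pi> F))"


text \<open>The functional vanishing in all positive degrees exists and is unique.\<close>

lemma vacuum_functional_ex1:
  "\<exists>!\<phi> :: 'h::real_inner tp \<Rightarrow> complex. clinear_functional \<phi> \<and>
     \<phi> (W 0 (ga id) (tens [])) = 1 \<and>
     (\<forall>n\<ge>1. \<forall>\<eta>\<in>CSym0 n. \<forall>F\<in>tpow n. \<phi> (W n \<eta> F) = 0)"
proof -
  define g where "g n (\<alpha> :: nat \<Rightarrow> nat) F = (if n = 0 then complex_of_real (tens_scal F) else 0)"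
    for n :: nat and \<alpha> and F :: "'h tensor"
  have ml: "multilinear (\<lambda>hs :: 'h list. if hs = [] then 1 else (0::real))"
    by (simp add: multilinear_def)
  note scal = tens_lift[OF ml, folded tens_scal_def]
  have vs: "vector_space ((*) :: complex \<Rightarrow> _)"
    by unfold_locales (simp_all add: algebra_simps)
  have Sym0_0: "Sym0 0 = {id}" by (auto simp: Sym0_def)
  have Sym_0: "Sym 0 = {id}" by (auto simp: Sym_def)
  have tpow_0: "\<exists>c. F = c *\<^sub>R tens []" if "F \<in> tpow 0" for F :: "'h tensor"
    using that by (auto simp: tpow_def span_singleton)
  have U0: "Uperm 0 id F = F" if F: "F \<in> tpow 0" for F :: "'h tensor"
  proof -
    have "id \<in> Sym 0" by (simp add: Sym_0)
    note U = tens_lift[OF multilinear_Uperm[where 'h = 'h, OF this], folded Uperm_def]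
    obtain c where "F = c *\<^sub>R tens []" using tpow_0[OF F] by blast
    then show ?thesis by (simp add: linear_scale[OF U(1)] U(2))
  qed
  have ex1: "\<exists>!L. clinear_functional L \<and>
    (\<forall>n. \<forall>\<alpha>\<in>Sym0 n. \<forall>F :: 'h tensor \<in> tpow n. L (W n (ga \<alpha>) F) = g n \<alpha> F)"
    by (rule tp_lift_ex1[OF vs])
       (auto simp: g_def linear_add[OF scal(1)] linear_scale[OF scal(1)] Sym_0 U0)
  have "(clinear_functional \<phi> \<and> \<phi> (W 0 (ga id) (tens [])) = 1 \<and>
     (\<forall>n\<ge>1. \<forall>\<eta>\<in>CSym0 n. \<forall>F\<in>tpow n. \<phi> (W n \<eta> F) = 0)) \<longleftrightarrow>
     (clinear_functional \<phi> \<and> (\<forall>n. \<forall>\<alpha>\<in>Sym0 n. \<forall>F\<in>tpow n. \<phi> (W n (ga \<alpha>) F) = g n \<alpha> F))"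
    (is "?A \<longleftrightarrow> ?B") for \<phi> :: "'h tp \<Rightarrow> complex"
  proof
    assume A: ?A
    interpret P: Vector_Spaces.linear "(*\<^sub>C)" "(*)" \<phi> using A by blast
    have "\<phi> (W n (ga \<alpha>) F) = g n \<alpha> F" if a: "\<alpha> \<in> Sym0 n" and F: "F \<in> tpow n" for n \<alpha> F
    proof (cases "n = 0")
      case False
      then show ?thesis using A a F by (simp add: g_def CSym0_def)
    next
      case True
      then obtain c where c: "F = c *\<^sub>R tens []" using tpow_0 F by blast
      have t0: "tens [] \<in> (tpow 0 :: 'h tensor set)" by (simp add: tpow_def span_base)
      have "tp_rel (Poly_Mapping.single (0, id, c *\<^sub>R tens [] + 0 *\<^sub>R tens []) 1)
         (fscale (of_real c) (Poly_Mapping.single (0, id, tens [] :: 'h tensor) 1)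
          + fscale (of_real 0) (Poly_Mapping.single (0, id, tens []) 1))"
        unfolding tp_rel_def diff_diff_eq[symmetric] tp_relators_def
        using t0 Sym0_0 by (intro free.span_base UnI1) blast
      then have "Wperm 0 id (c *\<^sub>R tens [] + 0 *\<^sub>R tens [] :: 'h tensor)
          = of_real c *\<^sub>C Wperm 0 id (tens []) + of_real 0 *\<^sub>C Wperm 0 id (tens [])"
        unfolding Wperm_def scaleC.abs_eq plus_tp.abs_eq tp.abs_eq_iff .
      then have "W 0 (ga id) F = of_real c *\<^sub>C W 0 (ga id) (tens [])"
        by (simp add: W_ga c)
      then show ?thesis
        using A a True Sym0_0 by (simp add: P.scale g_def c linear_scale[OF scal(1)] scal(2))
    qed
    then show ?B using A by blast
  next
    assume B: ?B
    interpret P: Vector_Spaces.linear "(*\<^sub>C)" "(*)" \<phi> using B by blast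
    have t0: "tens [] \<in> (tpow 0 :: 'h tensor set)" by (simp add: tpow_def span_base)
    have "\<phi> (W n \<eta> F) = 0" if "n \<ge> 1" "\<eta> \<in> CSym0 n" "F \<in> tpow n" for n \<eta> F
    proof -
      have "\<phi> (Wperm n \<alpha> F) = 0" if "\<alpha> \<in> Poly_Mapping.keys \<eta>" for \<alpha>
        using B that \<open>n \<ge> 1\<close> \<open>\<eta> \<in> CSym0 n\<close> \<open>F \<in> tpow n\<close>
        by (auto simp: CSym0_def g_def simp flip: W_ga)
      then show ?thesis by (simp add: W_def P.sum P.scale)
    qed
    then show ?A using B t0 Sym0_0 by (simp add: g_def scal(2))
  qed
  then show ?thesis using ex1 by simp
qed


section \<open>Star-algebra structure and inner product\<close>

text \<open>The elements \<open>W n (ga \<alpha>) F\<close> span the space; so do the \<open>T q n (ga \<alpha>) F\<close>, as \<open>T\<close> is the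
  identity up to terms of lower degree. Hence the identities below determine the operations
  uniquely.\<close>

definition tp_mult :: "real \<Rightarrow> 'h::real_inner tp \<Rightarrow> 'h tp \<Rightarrow> 'h tp" where
  "tp_mult q = (THE m.
     (\<forall>y. clinear (\<lambda>x. m x y)) \<and> (\<forall>x. clinear (m x)) \<and>
     (\<forall>n k. \<forall>\<alpha>\<in>Sym0 n. \<forall>\<beta>\<in>Sym0 k. \<forall>F\<in>tpow n. \<forall>G\<in>tpow k.
        m (T q n (ga \<alpha>) F) (T q k (ga \<beta>) G) = T q (n + k) (ga (cup n \<alpha> \<beta>)) (tens_prod F G)))"

definition tp_star :: "real \<Rightarrow> 'h::real_inner tp \<Rightarrow> 'h tp" where
  "tp_star q = (THE s.
     cantilinear s \<and>
     (\<forall>n. \<forall>\<alpha>\<in>Sym0 n. \<forall>F\<in>tpow n. s (T q n (ga \<alpha>) F) = T q n (ga (inv \<alpha>)) F))"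

definition qform :: "real \<Rightarrow> 'h::real_inner tp \<Rightarrow> 'h tp \<Rightarrow> complex" where
  "qform q = (THE B.
     sesquilinear B \<and>
     (\<forall>n k. \<forall>\<alpha>\<in>Sym0 n. \<forall>\<beta>\<in>Sym0 k. \<forall>F\<in>tpow n. \<forall>G\<in>tpow k.
        B (W n (ga \<alpha>) F) (W k (ga \<beta>) G) =
          (if n = k
           then of_real (\<Sum>\<sigma>\<in>Sym n.
             chi q n (\<alpha> \<circ> \<sigma> \<circ> inv \<beta> \<circ> inv \<sigma>) * tens_inner F (Uperm n \<sigma> G))
           else 0)))"

definition Nvs :: "real \<Rightarrow> 'h::real_inner tp set" where
  "Nvs q = {\<xi>. qform q \<xi> \<xi> = 0}"


section \<open>The quotient by the kernel\<close>

definition nrel :: "real \<Rightarrow> ('h::real_inner tp \<times> 'h tp) set" where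
  "nrel q = {(A, B). A - B \<in> Nvs q}"

definition TPq :: "real \<Rightarrow> 'h::real_inner tp set set" where
  "TPq q = UNIV // nrel q"

definition tpq_zero :: "real \<Rightarrow> 'h::real_inner tp set" where
  "tpq_zero q = nrel q `` {0}"

definition tpq_mult :: "real \<Rightarrow> 'h::real_inner tp set \<Rightarrow> 'h tp set \<Rightarrow> 'h tp set" where
  "tpq_mult q X Y = (\<Union>A\<in>X. \<Union>B\<in>Y. nrel q `` {tp_mult q A B})"

definition tpq_star :: "real \<Rightarrow> 'h::real_inner tp set \<Rightarrow> 'h tp set" where
  "tpq_star q X = (\<Union>A\<in>X. nrel q `` {tp_star q A})"

text \<open>The map on the quotient induced by a map that is constant on the classes.\<close>

definition tpq_induced :: "('h::real_inner tp \<Rightarrow> complex) \<Rightarrow> 'h tp set \<Rightarrow> complex" where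
  "tpq_induced \<phi> X = the_elem (\<phi> ` X)"

end

theory Submission
  imports Defs
begin

text \<open>
  Everything follows from one identity, \<open>\<phi> (x y) = \<langle>y, x\<^sup>*\<rangle>\<^sub>q\<close> (\<open>phi_mult\<close>). Part (a) is this identity
  together with \<open>(x\<^sup>*)\<^sup>* = x\<close>. Traciality is the symmetry \<open>\<langle>y, x\<^sup>*\<rangle>\<^sub>q = \<langle>x, y\<^sup>*\<rangle>\<^sub>q\<close>, which on generators
  is the substitution \<open>\<sigma> \<mapsto> \<sigma>\<^sup>-\<^sup>1\<close> in the sum defining the form (\<open>qsum_swap\<close>). Positivity, the kernel and
  faithfulness are then properties of a positive semi-definite form. Part (e) holds because \<open>\<phi>\<close> sees
  only those contractions that leave no point unpaired (\<open>phi_T\<close>).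

  Both sides of the identity are bilinear, and the elements \<open>T(\<alpha> \<otimes> F)\<close> span because \<open>W \<mapsto> T\<close> is the
  identity up to terms of lower degree (\<open>bij_TT\<close>). So let \<open>x = T(\<beta> \<otimes> G)\<close> and \<open>y = T(\<alpha> \<otimes> F)\<close> with
  \<open>\<beta>\<close> in \<open>Sym0 k\<close> and \<open>\<alpha>\<close> in \<open>Sym0 n\<close>. The left side is \<open>\<phi> (T((\<beta> \<union> \<alpha>) \<otimes> (G \<otimes> F)))\<close>, a sum over the pair
  partitions of \<open>[k + n]\<close>. Each of them is glued in a unique way from a partial pairing \<open>\<pi>1\<close> of \<open>[k]\<close>, a
  partial pairing \<open>\<pi>2\<close> of \<open>[n]\<close> and a permutation \<open>\<sigma>\<close> matching the unpaired points
  (\<open>sum_P2_glue\<close>). The right side, expanded, is a sum over the same triples. The tensor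
  factors agree (\<open>prod_glue\<close>), and what remains is an identity between exponents of \<open>q\<close>
  (\<open>cyc0_glue\<close>): the cycles of the glued pairing times \<open>\<beta> \<union> \<alpha>\<close> are those destroyed by the two
  contractions and those of \<open>\<alpha>' \<sigma> \<beta>' \<sigma>\<^sup>-\<^sup>1\<close>, where \<open>\<alpha>'\<close> and \<open>\<beta>'\<close> are the contracted permutations.

  That identity is proved by erasing points from cycles. Erasing a set \<open>D\<close> loses exactly the cycles
  contained in \<open>D\<close> (\<open>cyc0_erase\<close>), and it is compatible with a product of permutations as long as
  every erased point is moved by at most one factor (\<open>erase_comp\<close>).

  For \<open>q = 1 / N\<close> the number \<open>N\<^sup>n\<^sup>+\<^sup>1 \<chi>\<^sub>q(\<gamma>)\<close> counts the colourings of \<open>[0, n]\<close> with \<open>N\<close> colours that \<open>\<gamma>\<close>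
  preserves, so it is the trace of \<open>\<gamma>\<close> in a permutation representation, and \<open>q = -1 / N\<close> adds the
  sign character. Hence \<open>\<chi>\<^sub>q\<close> is positive semi-definite. Entrywise multiplication by Gram matrices and
  summation over both conjugations preserve this, which gives \<open>qform_nonneg\<close>.
\<close>

section \<open>Erasing elements from cycles\<close>

lemma permutes_permutation: "\<gamma> permutes X \<Longrightarrow> finite X \<Longrightarrow> permutation \<gamma>"
  using permutation_permutes by blast

lemma orbit_eq_orbit:
  assumes "permutation \<gamma>" "y \<in> orbit \<gamma> x"
  shows "orbit \<gamma> y = orbit \<gamma> x"
  using orbit_cyclic_eq3[OF cyclic_on_orbit'[OF assms(1)] assms(2)] .

lemma erase_in [simp]: "x \<in> D \<Longrightarrow> erase D \<gamma> x = x"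
  by (simp add: erase_def)

lemma erase_eqI:
  assumes "x \<notin> D" "0 < j" "(\<gamma> ^^ j) x \<notin> D" "\<And>i. 0 < i \<Longrightarrow> i < j \<Longrightarrow> (\<gamma> ^^ i) x \<in> D"
  shows "erase D \<gamma> x = (\<gamma> ^^ j) x"
proof -
  have "(LEAST j. 0 < j \<and> (\<gamma> ^^ j) x \<notin> D) = j"
    using assms by (intro Least_equality) (auto simp: not_less[symmetric])
  then show ?thesis using assms(1) by (simp add: erase_def)
qed

lemma erase_first_return:
  assumes "permutation \<gamma>" "x \<notin> D"
  obtains j where "0 < j" "(\<gamma> ^^ j) x \<notin> D" "\<And>i. 0 < i \<Longrightarrow> i < j \<Longrightarrow> (\<gamma> ^^ i) x \<in> D"
    "erase D \<gamma> x = (\<gamma> ^^ j) x"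
proof -
  let ?P = "\<lambda>j. 0 < j \<and> (\<gamma> ^^ j) x \<notin> D"
  have "x \<in> orbit \<gamma> x" using assms(1) by (rule permutation_self_in_orbit)
  then obtain k where k: "0 < k" "x = (\<gamma> ^^ k) x" unfolding orbit_altdef by blast
  have "?P k" unfolding k(2)[symmetric] using k(1) assms(2) by (rule conjI)
  then have "?P (Least ?P)" by (rule LeastI)
  moreover have "(\<gamma> ^^ i) x \<in> D" if "0 < i" "i < Least ?P" for i
    using not_less_Least[OF that(2)] that(1) by simp
  ultimately show ?thesis using that[of "Least ?P"] assms(2) by (simp add: erase_def)
qed

lemma erase_step:
  assumes "x \<notin> D" "\<gamma> x \<notin> D" shows "erase D \<gamma> x = \<gamma> x"
proof -
  have "erase D \<gamma> x = (\<gamma> ^^ 1) x" using assms by (intro erase_eqI) simp_all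
  then show ?thesis by simp
qed

lemma erase_two_steps:
  assumes "x \<notin> D" "\<gamma> x \<in> D" "\<gamma> (\<gamma> x) \<notin> D" shows "erase D \<gamma> x = \<gamma> (\<gamma> x)"
proof -
  have "(\<gamma> ^^ i) x \<in> D" if "0 < i" "i < Suc (Suc 0)" for i
  proof -
    have "i = Suc 0" using that by simp
    then show ?thesis using assms(2) by simp
  qed
  then have "erase D \<gamma> x = (\<gamma> ^^ Suc (Suc 0)) x"
    using assms by (intro erase_eqI) simp_all
  then show ?thesis by simp
qed

lemma erase_fixed_point: "\<gamma> x = x \<Longrightarrow> erase D \<gamma> x = x"
  by (cases "x \<in> D") (simp_all add: erase_step)

text \<open>Running backwards along a cycle, the first element outside \<open>D\<close> before \<open>erase D \<gamma> x\<close> is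
  \<open>x\<close>.\<close>

lemma erase_inv_erase:
  assumes "permutation \<gamma>"
  shows "erase D (inv \<gamma>) (erase D \<gamma> x) = x"
proof (cases "x \<in> D")
  case False
  obtain j where j: "0 < j" "(\<gamma> ^^ j) x \<notin> D" "\<And>i. 0 < i \<Longrightarrow> i < j \<Longrightarrow> (\<gamma> ^^ i) x \<in> D"
    "erase D \<gamma> x = (\<gamma> ^^ j) x" by (rule erase_first_return[OF assms False]) blast
  have bij: "bij \<gamma>" using assms by (simp add: permutation)
  have backward: "(inv \<gamma> ^^ i) ((\<gamma> ^^ j) x) = (\<gamma> ^^ (j - i)) x" if "i \<le> j" for i
    using that
  proof (induction i)
    case (Suc i)
    then have "j - i = Suc (j - Suc i)" by simp
    then have "(inv \<gamma> ^^ i) ((\<gamma> ^^ j) x) = \<gamma> ((\<gamma> ^^ (j - Suc i)) x)"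
      using Suc by (metis Suc_leD comp_apply funpow.simps(2))
    then show ?case using bij by (simp add: bij_is_inj)
  qed simp
  have "erase D (inv \<gamma>) ((\<gamma> ^^ j) x) = (inv \<gamma> ^^ j) ((\<gamma> ^^ j) x)"
    using j False by (intro erase_eqI) (auto simp: backward)
  then show ?thesis using j by (simp add: backward)
qed simp

lemma bij_erase:
  assumes "permutation \<gamma>" shows "bij (erase D \<gamma>)"
proof (rule o_bij)
  show "erase D (inv \<gamma>) \<circ> erase D \<gamma> = id" using erase_inv_erase[OF assms] by auto
  have "inv (inv \<gamma>) = \<gamma>" using assms by (simp add: inv_inv_eq permutation)
  then have "erase D \<gamma> (erase D (inv \<gamma>) x) = x" for x
    using erase_inv_erase[OF permutation_inverse[OF assms], of D x] by (simp only:)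
  then show "erase D \<gamma> \<circ> erase D (inv \<gamma>) = id" by (simp add: fun_eq_iff)
qed

lemma erase_inv:
  assumes "permutation \<gamma>" shows "erase D (inv \<gamma>) = inv (erase D \<gamma>)"
proof (rule sym, rule inv_equality)
  show "erase D (inv \<gamma>) (erase D \<gamma> x) = x" for x by (rule erase_inv_erase[OF assms])
  have "inv (inv \<gamma>) = \<gamma>" using assms by (simp add: inv_inv_eq permutation)
  then show "erase D \<gamma> (erase D (inv \<gamma>) x) = x" for x
    using erase_inv_erase[OF permutation_inverse[OF assms], of D x] by (simp only:)
qed

lemma erase_permutes:
  assumes "\<gamma> permutes X" "finite X"
  shows "erase D \<gamma> permutes X - D"
proof -
  have g: "permutation \<gamma>" using assms permutation_permutes by blast
  have "erase D \<gamma> x = x" if "x \<notin> X - D" for x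
    using that assms(1) by (cases "x \<in> D") (auto intro!: erase_fixed_point simp: permutes_not_in)
  then show ?thesis
    using bij_erase[OF g, of D] unfolding permutes_def by (metis bij_pointE)
qed

lemma permutation_erase:
  assumes "permutation \<gamma>" shows "permutation (erase D \<gamma>)"
proof -
  obtain X where "\<gamma> permutes X" "finite X" using assms permutation_permutes by blast
  then show ?thesis using erase_permutes permutation_permutes by blast
qed

lemma erase_singleton:
  assumes "permutation \<gamma>"
  shows "erase {d} \<gamma> x = (if x = d then d else if \<gamma> x = d then \<gamma> d else \<gamma> x)"
proof -
  have "\<gamma> d \<noteq> d" if "\<gamma> x = d" "x \<noteq> d"
    using assms that by (metis bij_is_inj inj_eq permutation)
  then show ?thesis
    using erase_step[of x "{d}" \<gamma>] erase_two_steps[of x "{d}" \<gamma>] by auto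
qed

text \<open>Erasing one more point: if the first return of \<open>x\<close> outside \<open>D\<close> is \<open>d\<close>, the walk goes on to the
  first return of \<open>d\<close>, which is not \<open>d\<close> again because \<open>erase D \<gamma>\<close> is injective.\<close>

lemma erase_insert:
  assumes g: "permutation \<gamma>"
  shows "erase (insert d D) \<gamma> = erase {d} (erase D \<gamma>)"
proof
  fix x
  let ?e = "erase D \<gamma>"
  have pe: "permutation ?e" by (rule permutation_erase[OF g])
  show "erase (insert d D) \<gamma> x = erase {d} ?e x"
  proof (cases "x = d \<or> x \<in> D \<or> d \<in> D")
    case True
    then show ?thesis
    proof (elim disjE)
      assume "d \<in> D"
      then have "erase {d} ?e = ?e"
        by (auto simp: fun_eq_iff erase_singleton[OF pe])
      then show ?thesis using \<open>d \<in> D\<close> by (simp add: insert_absorb)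
    qed (simp_all add: erase_fixed_point)
  next
    case False
    then have x: "x \<noteq> d" "x \<notin> D" and d: "d \<notin> D" by auto
    obtain j where j: "0 < j" "(\<gamma> ^^ j) x \<notin> D" "\<And>i. 0 < i \<Longrightarrow> i < j \<Longrightarrow> (\<gamma> ^^ i) x \<in> D"
      "?e x = (\<gamma> ^^ j) x" by (rule erase_first_return[OF g x(2)]) blast
    show ?thesis
    proof (cases "?e x = d")
      case False
      then show ?thesis using j x by (simp add: erase_singleton[OF pe] erase_eqI[of x _ j])
    next
      case True
      obtain i where i: "0 < i" "(\<gamma> ^^ i) d \<notin> D" "\<And>l. 0 < l \<Longrightarrow> l < i \<Longrightarrow> (\<gamma> ^^ l) d \<in> D"
        "?e d = (\<gamma> ^^ i) d" by (rule erase_first_return[OF g d]) blast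
      have "?e d \<noteq> d" using True x(1) pe by (metis bij_is_inj inj_eq permutation)
      then have end_notin: "(\<gamma> ^^ (i + j)) x \<notin> insert d D"
        using i j True by (simp add: funpow_add)
      have mid: "(\<gamma> ^^ l) x \<in> insert d D" if "0 < l" "l < i + j" for l
      proof -
        consider "l < j" | "l = j" | "j < l" by linarith
        then show ?thesis
        proof cases
          case 3
          then have "(\<gamma> ^^ l) x = (\<gamma> ^^ (l - j)) ((\<gamma> ^^ j) x)"
            by (metis comp_apply funpow_add le_add_diff_inverse2 less_imp_le_nat)
          then show ?thesis using 3 that i j True by simp
        qed (use j True that in auto)
      qed
      have "erase (insert d D) \<gamma> x = (\<gamma> ^^ (i + j)) x"
        using x i(1) end_notin mid by (intro erase_eqI) auto
      then show ?thesis
        using True x i j by (simp add: erase_singleton[OF pe] funpow_add)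
    qed
  qed
qed

text \<open>Erasing is not multiplicative in general. It is if each erased point is moved by at most one
  of the two factors: for a single point this can be read off from \<open>erase_singleton\<close>, and points
  can be erased one at a time.\<close>

lemma erase_comp:
  assumes a: "permutation a" and b: "permutation b" and D: "finite D"
    and once: "\<And>d. d \<in> D \<Longrightarrow> a d = d \<or> b d = d"
  shows "erase D (a \<circ> b) = erase D a \<circ> erase D b"
  using D once
proof (induction D rule: finite_induct)
  case empty
  have "erase {} \<gamma> = \<gamma>" for \<gamma> :: "nat \<Rightarrow> nat" by (auto simp: fun_eq_iff erase_step)
  then show ?case by simp
next
  case (insert d D)
  have ab: "permutation (a \<circ> b)" using a b by (rule permutation_compose)
  let ?a = "erase D a" and ?b = "erase D b"
  have pa: "permutation ?a" and pb: "permutation ?b" using a b by (auto intro: permutation_erase)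
  have pab: "permutation (?a \<circ> ?b)" using pa pb by (rule permutation_compose)
  have "?a d = d \<or> ?b d = d" using insert.prems[of d] erase_fixed_point by blast
  then have "erase {d} (?a \<circ> ?b) = erase {d} ?a \<circ> erase {d} ?b"
    unfolding fun_eq_iff comp_apply erase_singleton[OF pa] erase_singleton[OF pb] erase_singleton[OF pab]
    using inj_eq[OF bij_is_inj, of ?a] inj_eq[OF bij_is_inj, of ?b] pa pb
    by (auto simp: permutation)
  moreover have "erase D (a \<circ> b) = ?a \<circ> ?b" using insert by blast
  ultimately show ?case by (simp only: erase_insert[OF a] erase_insert[OF b] erase_insert[OF ab])
qed

lemma erase_fixed:
  assumes "\<And>d. d \<in> D \<Longrightarrow> \<gamma> d = d" "permutation \<gamma>"
  shows "erase D \<gamma> = \<gamma>"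
proof
  fix x
  have "\<gamma> x \<notin> D" if "x \<notin> D"
    using assms that by (metis bij_is_inj inj_eq permutation)
  then show "erase D \<gamma> x = \<gamma> x"
    using assms by (cases "x \<in> D") (auto simp: erase_step)
qed

lemma erase_Un_fixed:
  assumes "permutation \<gamma>" "finite D" "\<And>d. d \<in> D \<Longrightarrow> \<gamma> d = d"
  shows "erase (D' \<union> D) \<gamma> = erase D' \<gamma>"
  using assms(2,3)
proof (induction D rule: finite_induct)
  case (insert d D)
  have "erase D' \<gamma> d = d" using insert.prems by (simp add: erase_fixed_point)
  then have "erase {d} (erase D' \<gamma>) = erase D' \<gamma>"
    by (intro erase_fixed permutation_erase assms) auto
  then show ?case using insert by (simp add: erase_insert[OF assms(1)])
qed simp

lemma orbit_erase:
  assumes g: "permutation \<gamma>" and x: "x \<notin> D"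
  shows "orbit (erase D \<gamma>) x = orbit \<gamma> x - D"
proof (intro equalityI subsetI)
  fix y assume "y \<in> orbit (erase D \<gamma>) x"
  then show "y \<in> orbit \<gamma> x - D"
  proof induction
    case base
    obtain j where j: "0 < j" "(\<gamma> ^^ j) x \<notin> D" "erase D \<gamma> x = (\<gamma> ^^ j) x"
      by (rule erase_first_return[OF g x]) blast
    then show ?case by (auto simp: orbit_altdef)
  next
    case (step y)
    then have y: "y \<in> orbit \<gamma> x" "y \<notin> D" by auto
    obtain j where j: "0 < j" "(\<gamma> ^^ j) y \<notin> D" "erase D \<gamma> y = (\<gamma> ^^ j) y"
      by (rule erase_first_return[OF g y(2)]) blast
    then show ?case using funpow_in_orbit[OF y(1)] by auto
  qed
next
  fix y assume "y \<in> orbit \<gamma> x - D"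
  then obtain n where "0 < n" "y = (\<gamma> ^^ n) x" and "y \<notin> D" by (auto simp: orbit_altdef)
  then show "y \<in> orbit (erase D \<gamma>) x"
    using x
  proof (induction n arbitrary: x rule: less_induct)
    case (less n)
    obtain j where j: "0 < j" "(\<gamma> ^^ j) x \<notin> D" "\<And>i. 0 < i \<Longrightarrow> i < j \<Longrightarrow> (\<gamma> ^^ i) x \<in> D"
      "erase D \<gamma> x = (\<gamma> ^^ j) x" by (rule erase_first_return[OF g less.prems(4)]) blast
    have "j \<le> n" using j(3)[of n] less.prems by force
    show ?case
    proof (cases "j = n")
      case True
      then show ?thesis using j less.prems by (metis orbit.base)
    next
      case False
      then have "y = (\<gamma> ^^ (n - j)) (erase D \<gamma> x)"
        using \<open>j \<le> n\<close> j(4) less.prems(2) by (metis comp_apply funpow_add le_add_diff_inverse2)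
      then have "y \<in> orbit (erase D \<gamma>) (erase D \<gamma> x)"
        using False \<open>j \<le> n\<close> j(1,2,4) less.prems by (intro less.IH[of "n - j"]) auto
      then show ?thesis by (rule orbit_subset)
    qed
  qed
qed


section \<open>Counting cycles\<close>

text \<open>The number of cycles lost when \<open>D\<close> is erased.\<close>

definition cyc_in :: "nat set \<Rightarrow> (nat \<Rightarrow> nat) \<Rightarrow> nat" where
  "cyc_in D \<gamma> = card {c \<in> orbit \<gamma> ` D. c \<subseteq> D}"

text \<open>The cycles of \<open>erase D \<gamma>\<close> are the traces on the complement of \<open>D\<close> of the cycles of \<open>\<gamma>\<close>; different
  cycles have different traces, and only the cycles inside \<open>D\<close> leave none.\<close>

lemma cyc0_erase:
  assumes g: "\<gamma> permutes X" and fin: "finite X" and D: "D \<subseteq> X" "0 \<notin> D"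
  shows "cyc0 X \<gamma> = cyc0 (X - D) (erase D \<gamma>) + cyc_in D \<gamma>"
proof -
  have perm: "permutation \<gamma>" using g fin permutation_permutes by blast
  note self = permutation_self_in_orbit[OF perm]
  define A where "A = {c \<in> orbit \<gamma> ` (X - D). 0 \<notin> c}"
  define B where "B = {c \<in> orbit \<gamma> ` D. c \<subseteq> D}"
  have "{c \<in> orbit \<gamma> ` X. 0 \<notin> c} = A \<union> B"
  proof (intro equalityI subsetI)
    fix c assume "c \<in> {c \<in> orbit \<gamma> ` X. 0 \<notin> c}"
    then obtain x where x: "x \<in> X" "c = orbit \<gamma> x" "0 \<notin> c" by auto
    show "c \<in> A \<union> B"
    proof (cases "c \<subseteq> D")
      case True
      then show ?thesis using x self[of x] by (auto simp: B_def)
    next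
      case False
      then obtain y where y: "y \<in> c" "y \<notin> D" by auto
      then have "y \<in> X - D" "c = orbit \<gamma> y"
        using x permutes_orbit_subset[OF g x(1)] orbit_eq_orbit[OF perm, of y x] by auto
      then show ?thesis using x by (auto simp: A_def)
    qed
  qed (use D in \<open>auto simp: A_def B_def\<close>)
  moreover have "A \<inter> B = {}" using self by (auto simp: A_def B_def)
  moreover have "finite A" "finite B"
    using fin D(1) finite_subset[OF D(1) fin] by (auto simp: A_def B_def)
  ultimately have "cyc0 X \<gamma> = card A + card B" by (simp add: cyc0_def card_Un_disjoint)
  moreover have "{c \<in> orbit (erase D \<gamma>) ` (X - D). 0 \<notin> c} = (\<lambda>c. c - D) ` A"
    using D(2) orbit_erase[OF perm] by (fastforce simp: A_def)
  moreover have "inj_on (\<lambda>c. c - D) A"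
  proof (rule inj_onI)
    fix c c' assume "c \<in> A" "c' \<in> A" and eq: "c - D = c' - D"
    then obtain x y where "x \<notin> D" "c = orbit \<gamma> x" "c' = orbit \<gamma> y" by (auto simp: A_def)
    then show "c = c'" using eq self[of x] orbit_eq_orbit[OF perm, of x y] by blast
  qed
  ultimately show ?thesis by (simp add: cyc0_def cyc_in_def B_def card_image)
qed

text \<open>A cycle inside \<open>D\<close> consists of steps that stay in \<open>D\<close>.\<close>

lemma cyc_in_cong:
  assumes "permutation \<gamma>" "permutation \<delta>"
    and "\<And>x. x \<in> D \<Longrightarrow> \<gamma> x \<in> D \<or> \<delta> x \<in> D \<Longrightarrow> \<gamma> x = \<delta> x"
  shows "cyc_in D \<gamma> = cyc_in D \<delta>"
proof -
  have orb: "orbit \<delta> x = orbit \<gamma> x"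
    if x: "x \<in> D" "orbit \<gamma> x \<subseteq> D" and eq: "\<And>x. x \<in> D \<Longrightarrow> \<gamma> x \<in> D \<Longrightarrow> \<gamma> x = \<delta> x"
    for \<gamma> \<delta> :: "nat \<Rightarrow> nat" and x
  proof -
    have inD: "(\<gamma> ^^ j) x \<in> D" for j
      using x by (cases "j = 0") (auto simp: orbit_altdef)
    have "(\<delta> ^^ j) x = (\<gamma> ^^ j) x" for j
    proof (induction j)
      case (Suc j)
      then show ?case using inD[of j] inD[of "Suc j"] eq[of "(\<gamma> ^^ j) x"] by simp
    qed simp
    then show ?thesis by (simp add: orbit_altdef)
  qed
  have "{c \<in> orbit \<gamma> ` D. c \<subseteq> D} \<subseteq> {c \<in> orbit \<delta> ` D. c \<subseteq> D}"
    using orb[of _ \<gamma> \<delta>] assms(3) by auto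
  moreover have "{c \<in> orbit \<delta> ` D. c \<subseteq> D} \<subseteq> {c \<in> orbit \<gamma> ` D. c \<subseteq> D}"
  proof
    fix c assume "c \<in> {c \<in> orbit \<delta> ` D. c \<subseteq> D}"
    then obtain x where x: "x \<in> D" "c = orbit \<delta> x" "c \<subseteq> D" by auto
    have "orbit \<gamma> x = orbit \<delta> x"
      using x assms(3) by (intro orb) (auto simp del: not_all, metis)
    then show "c \<in> {c \<in> orbit \<gamma> ` D. c \<subseteq> D}" using x by auto
  qed
  ultimately show ?thesis unfolding cyc_in_def by (metis subset_antisym)
qed

text \<open>A cycle that stays in \<open>D1 \<union> D2\<close> cannot leave \<open>D2\<close> once it is there, so it lies in one of the
  two sets.\<close>

lemma cyc_in_Un:
  assumes g: "permutation \<gamma>" and fin: "finite D1" "finite D2" and disj: "D1 \<inter> D2 = {}"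
    and stay: "\<And>x. x \<in> D2 \<Longrightarrow> \<gamma> x \<in> D1 \<union> D2 \<Longrightarrow> \<gamma> x \<in> D2"
  shows "cyc_in (D1 \<union> D2) \<gamma> = cyc_in D1 \<gamma> + cyc_in D2 \<gamma>"
proof -
  note self = permutation_self_in_orbit[OF g]
  have one: "c \<subseteq> D1 \<or> c \<subseteq> D2" if c: "c = orbit \<gamma> x" "c \<subseteq> D1 \<union> D2" for c x
  proof (cases "c \<inter> D2 = {}")
    case False
    then obtain y where y: "y \<in> c" "y \<in> D2" by auto
    then have cy: "c = orbit \<gamma> y" using c orbit_eq_orbit[OF g, of y x] by simp
    have "z \<in> D2" if "z \<in> orbit \<gamma> y" for z
      using that
    proof induction
      case base
      then show ?case using y cy c(2) stay[of y] orbit.base by fastforce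
    next
      case (step z)
      then have "\<gamma> z \<in> c" unfolding cy by (auto intro: orbit.step)
      then show ?case using step c(2) stay[of z] by blast
    qed
    then show ?thesis using cy by auto
  qed (use c in auto)
  have "{c \<in> orbit \<gamma> ` (D1 \<union> D2). c \<subseteq> D1 \<union> D2}
      = {c \<in> orbit \<gamma> ` D1. c \<subseteq> D1} \<union> {c \<in> orbit \<gamma> ` D2. c \<subseteq> D2}" (is "?L = ?R")
  proof (intro equalityI subsetI)
    fix c assume "c \<in> ?L"
    then obtain x where x: "c = orbit \<gamma> x" "c \<subseteq> D1 \<union> D2" by auto
    then have "x \<in> c" using self by simp
    then show "c \<in> ?R" using one[OF x] x(1) by blast
  qed auto
  moreover have "{c \<in> orbit \<gamma> ` D1. c \<subseteq> D1} \<inter> {c \<in> orbit \<gamma> ` D2. c \<subseteq> D2} = {}"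
    using self disj by blast
  ultimately show ?thesis using fin unfolding cyc_in_def by (simp add: card_Un_disjoint)
qed

text \<open>An injective semiconjugacy. It covers conjugation, the order-preserving relabelling of a
  contraction and the shift in a juxtaposition at the same time.\<close>

definition intertwines :: "('a \<Rightarrow> 'b) \<Rightarrow> 'a set \<Rightarrow> ('a \<Rightarrow> 'a) \<Rightarrow> ('b \<Rightarrow> 'b) \<Rightarrow> bool" where
  "intertwines f X \<gamma> \<delta> \<longleftrightarrow> inj_on f X \<and> \<gamma> ` X \<subseteq> X \<and> (\<forall>x\<in>X. \<delta> (f x) = f (\<gamma> x))"

lemma intertwinesD:
  assumes "intertwines f X \<gamma> \<delta>" "x \<in> X"
  shows "\<delta> (f x) = f (\<gamma> x)" "\<gamma> x \<in> X"
proof -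
  have *: "\<gamma> ` X \<subseteq> X" "\<forall>x\<in>X. \<delta> (f x) = f (\<gamma> x)" using assms(1) by (simp_all add: intertwines_def)
  show "\<delta> (f x) = f (\<gamma> x)" by (rule bspec[OF *(2) assms(2)])
  show "\<gamma> x \<in> X" by (rule subsetD[OF *(1) imageI[OF assms(2)]])
qed

lemma intertwines_funpow:
  assumes "intertwines f X \<gamma> \<delta>" "x \<in> X"
  shows "(\<gamma> ^^ n) x \<in> X \<and> (\<delta> ^^ n) (f x) = f ((\<gamma> ^^ n) x)"
proof (induction n)
  case (Suc n)
  then show ?case using intertwinesD[OF assms(1), of "(\<gamma> ^^ n) x"] by simp
qed (use assms in simp)

lemma intertwines_orbit:
  assumes "intertwines f X \<gamma> \<delta>" "x \<in> X"
  shows "orbit \<delta> (f x) = f ` orbit \<gamma> x" "orbit \<gamma> x \<subseteq> X"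
proof -
  note * = intertwines_funpow[OF assms]
  show "orbit \<delta> (f x) = f ` orbit \<gamma> x"
    unfolding orbit_altdef setcompr_eq_image image_image using * by (intro image_cong) auto
  show "orbit \<gamma> x \<subseteq> X" unfolding orbit_altdef using * by blast
qed

lemma filter_image: "(\<And>c. c \<in> C \<Longrightarrow> P (g c) \<longleftrightarrow> Q c) \<Longrightarrow> {c \<in> g ` C. P c} = g ` {c \<in> C. Q c}"
  by auto

lemma inj_on_image_image:
  assumes "inj_on f X" "\<And>c. c \<in> C \<Longrightarrow> c \<subseteq> X"
  shows "inj_on (image f) C"
proof (rule inj_onI)
  fix c d assume "c \<in> C" "d \<in> C" "f ` c = f ` d"
  then show "c = d" using inj_on_image_eq_iff[OF assms(1), of c d] assms(2) by blast
qed

lemma intertwines_cyc0: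
  assumes "intertwines f X \<gamma> \<delta>" "0 \<in> X" "f 0 = 0"
  shows "cyc0 (f ` X) \<delta> = cyc0 X \<gamma>"
proof -
  have inj: "inj_on f X" using assms by (simp add: intertwines_def)
  have sub: "c \<subseteq> X" if "c \<in> orbit \<gamma> ` X" for c
    using that intertwines_orbit(2)[OF assms(1)] by blast
  have zero: "0 \<in> f ` c \<longleftrightarrow> 0 \<in> c" if "c \<in> orbit \<gamma> ` X" for c
    using inj_on_image_mem_iff[OF inj assms(2) sub[OF that]] assms(3) by simp
  have "orbit \<delta> ` f ` X = image f ` orbit \<gamma> ` X"
    unfolding image_image by (intro image_cong refl intertwines_orbit(1)[OF assms(1)])
  then have "{c \<in> orbit \<delta> ` f ` X. 0 \<notin> c} = image f ` {c \<in> orbit \<gamma> ` X. 0 \<notin> c}"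
    by (simp only:) (rule filter_image, simp only: zero)
  moreover have "inj_on (image f) {c \<in> orbit \<gamma> ` X. 0 \<notin> c}"
    using sub by (intro inj_on_image_image[OF inj]) blast
  ultimately show ?thesis by (simp add: cyc0_def card_image)
qed

lemma intertwines_cyc_in:
  assumes "intertwines f X \<gamma> \<delta>" "D \<subseteq> X"
  shows "cyc_in (f ` D) \<delta> = cyc_in D \<gamma>"
proof -
  have inj: "inj_on f X" using assms by (simp add: intertwines_def)
  have sub: "c \<subseteq> X" if "c \<in> orbit \<gamma> ` D" for c
    using that assms(2) intertwines_orbit(2)[OF assms(1)] by blast
  have iff: "f ` c \<subseteq> f ` D \<longleftrightarrow> c \<subseteq> D" if "c \<in> orbit \<gamma> ` D" for c
    using inj_on_image_subset_iff[OF inj sub[OF that] assms(2)] .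
  have "orbit \<delta> ` f ` D = image f ` orbit \<gamma> ` D"
    unfolding image_image
    by (intro image_cong refl intertwines_orbit(1)[OF assms(1)] subsetD[OF assms(2)])
  then have "{c \<in> orbit \<delta> ` f ` D. c \<subseteq> f ` D} = image f ` {c \<in> orbit \<gamma> ` D. c \<subseteq> D}"
    by (simp only:) (rule filter_image, simp only: iff)
  moreover have "inj_on (image f) {c \<in> orbit \<gamma> ` D. c \<subseteq> D}"
    using sub by (intro inj_on_image_image[OF inj]) blast
  ultimately show ?thesis by (simp add: cyc_in_def card_image)
qed

lemma intertwines_erase:
  assumes "intertwines f X \<gamma> \<delta>" "D \<subseteq> X" "x \<in> X"
  shows "erase (f ` D) \<delta> (f x) = f (erase D \<gamma> x)"
proof -
  have inj: "inj_on f X" using assms by (simp add: intertwines_def)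
  have mem: "f y \<in> f ` D \<longleftrightarrow> y \<in> D" if "y \<in> X" for y
    using inj_on_image_mem_iff[OF inj that assms(2)] .
  have "(\<delta> ^^ j) (f x) \<notin> f ` D \<longleftrightarrow> (\<gamma> ^^ j) x \<notin> D" for j
    using intertwines_funpow[OF assms(1,3), of j] mem by auto
  then show ?thesis
    using intertwines_funpow[OF assms(1,3)] mem[OF assms(3)] by (simp add: erase_def)
qed

lemma orbit_inv: "permutation \<gamma> \<Longrightarrow> orbit (inv \<gamma>) = orbit \<gamma>"
  by (rule ext) (rule orbit_inv_eq)

lemma cyc_in_inv: "permutation \<gamma> \<Longrightarrow> cyc_in D (inv \<gamma>) = cyc_in D \<gamma>"
  unfolding cyc_in_def by (subst orbit_inv, assumption, rule refl)

lemma cyc0_le: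
  assumes "permutation \<gamma>"
  shows "cyc0 {0..n} \<gamma> \<le> n"
proof -
  have sub: "{c \<in> orbit \<gamma> ` {0..n}. 0 \<notin> c} \<subseteq> orbit \<gamma> ` {1..n}"
  proof (rule subsetI)
    fix c assume "c \<in> {c \<in> orbit \<gamma> ` {0..n}. 0 \<notin> c}"
    then have c: "c \<in> orbit \<gamma> ` {0..n}" "0 \<notin> c" by simp_all
    obtain x where x: "c = orbit \<gamma> x" "x \<in> {0..n}" using c(1) by (rule imageE)
    have "x \<in> c" unfolding x(1) by (rule permutation_self_in_orbit[OF assms])
    with c(2) have "x \<noteq> 0" by metis
    with x(2) have "x \<in> {1..n}" by simp
    then show "c \<in> orbit \<gamma> ` {1..n}" unfolding x(1) by (rule imageI)
  qed
  have "cyc0 {0..n} \<gamma> \<le> card (orbit \<gamma> ` {1..n})"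
    unfolding cyc0_def by (rule card_mono[OF _ sub]) (rule finite_imageI, rule finite_atLeastAtMost)
  also have "\<dots> \<le> card {1..n}" by (rule card_image_le) (rule finite_atLeastAtMost)
  also have "\<dots> = n" by simp
  finally show ?thesis .
qed

text \<open>The number of cycles not containing \<open>0\<close> is one less than the number of all cycles, so it is
  also invariant under conjugation by permutations that move \<open>0\<close>.\<close>

lemma card_orbits:
  assumes "permutation \<gamma>" "finite X" "0 \<in> X"
  shows "card (orbit \<gamma> ` X) = Suc (cyc0 X \<gamma>)"
proof -
  note self = permutation_self_in_orbit[OF assms(1)]
  have eq: "{c \<in> orbit \<gamma> ` X. 0 \<notin> c} = orbit \<gamma> ` X - {orbit \<gamma> 0}"
  proof (intro equalityI subsetI)
    fix c assume "c \<in> {c \<in> orbit \<gamma> ` X. 0 \<notin> c}"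
    then have c: "c \<in> orbit \<gamma> ` X" "0 \<notin> c" by simp_all
    then have "c \<noteq> orbit \<gamma> 0" using self[of 0] by metis
    then show "c \<in> orbit \<gamma> ` X - {orbit \<gamma> 0}" using c(1) by simp
  next
    fix c assume "c \<in> orbit \<gamma> ` X - {orbit \<gamma> 0}"
    then have c: "c \<in> orbit \<gamma> ` X" "c \<noteq> orbit \<gamma> 0" by simp_all
    then obtain x where "c = orbit \<gamma> x" by (elim imageE)
    then have "0 \<notin> c" using orbit_eq_orbit[OF assms(1), of 0 x] c(2) by metis
    then show "c \<in> {c \<in> orbit \<gamma> ` X. 0 \<notin> c}" using c(1) by simp
  qed
  have "orbit \<gamma> 0 \<in> orbit \<gamma> ` X" using assms(3) by (rule imageI)
  moreover have "finite (orbit \<gamma> ` X)" using assms(2) by (rule finite_imageI)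
  ultimately show ?thesis unfolding cyc0_def eq by (metis card.remove)
qed

lemma cyc0_conj:
  assumes g: "\<gamma> permutes X" and s: "\<sigma> permutes X" and X: "finite X" "0 \<in> X"
  shows "cyc0 X (\<sigma> \<circ> \<gamma> \<circ> inv \<sigma>) = cyc0 X \<gamma>"
proof -
  have I: "intertwines \<sigma> X \<gamma> (\<sigma> \<circ> \<gamma> \<circ> inv \<sigma>)"
    using g s permutes_image[OF g]
    by (auto simp: intertwines_def permutes_inverses intro: inj_on_subset[OF permutes_inj])
  have "\<sigma> \<circ> \<gamma> \<circ> inv \<sigma> permutes X" using g s by (intro permutes_compose permutes_inv)
  then have perm: "permutation \<gamma>" "permutation (\<sigma> \<circ> \<gamma> \<circ> inv \<sigma>)"
    using permutes_permutation g X(1) by blast+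
  have "orbit (\<sigma> \<circ> \<gamma> \<circ> inv \<sigma>) ` X = orbit (\<sigma> \<circ> \<gamma> \<circ> inv \<sigma>) ` \<sigma> ` X" by (simp only: permutes_image[OF s])
  also have "\<dots> = image \<sigma> ` orbit \<gamma> ` X"
    unfolding image_image by (intro image_cong refl intertwines_orbit(1)[OF I])
  finally have "card (orbit (\<sigma> \<circ> \<gamma> \<circ> inv \<sigma>) ` X) = card (image \<sigma> ` orbit \<gamma> ` X)" by (simp only:)
  also have "\<dots> = card (orbit \<gamma> ` X)"
    by (rule card_image, rule inj_on_image_image[OF inj_on_subset[OF permutes_inj[OF s] subset_UNIV, of UNIV]]) simp
  finally show ?thesis by (simp only: card_orbits[OF perm(1) X] card_orbits[OF perm(2) X] Suc_inject)
qed



section \<open>Order-preserving relabelling\<close>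

definition rank :: "nat set \<Rightarrow> nat \<Rightarrow> nat" where
  "rank X y = card {z \<in> X. z < y}"

definition enum :: "nat set \<Rightarrow> nat \<Rightarrow> nat" where
  "enum X r = sorted_list_of_set X ! r"

lemma rank_0 [simp]: "rank X 0 = 0"
  by (simp add: rank_def)

lemma rank_less_rank:
  assumes "finite X" "y \<in> X" "y < z" shows "rank X y < rank X z"
  unfolding rank_def using assms by (intro psubset_card_mono) auto

lemma rank_less_card:
  assumes "finite X" "y \<in> X" shows "rank X y < card X"
  unfolding rank_def using assms by (intro psubset_card_mono) auto

lemma inj_on_rank: assumes "finite X" shows "inj_on (rank X) X"
proof (rule inj_onI)
  fix y z assume "y \<in> X" "z \<in> X" "rank X y = rank X z"
  then show "y = z"
    using rank_less_rank[OF assms, of y z] rank_less_rank[OF assms, of z y] by (cases y z rule: linorder_cases) simp_all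
qed

lemma bij_betw_rank:
  assumes "finite X" shows "bij_betw (rank X) X {..<card X}"
proof -
  have "rank X ` X = {..<card X}"
    using assms rank_less_card[OF assms]
    by (intro card_subset_eq) (auto simp: card_image inj_on_rank)
  then show ?thesis using inj_on_rank[OF assms] by (simp add: bij_betw_def)
qed

lemma enum_in: "finite X \<Longrightarrow> r < card X \<Longrightarrow> enum X r \<in> X"
  unfolding enum_def by (metis length_sorted_list_of_set nth_mem set_sorted_list_of_set)

lemma enum_less_iff:
  assumes "finite X" "r < card X" "s < card X" shows "enum X r < enum X s \<longleftrightarrow> r < s"
proof -
  have "enum X i < enum X j" if "i < j" "j < card X" for i j
    unfolding enum_def using that assms(1)
    by (intro sorted_wrt_nth_less[OF strict_sorted_list_of_set]) simp_all
  from this[of r s] this[of s r] show ?thesis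
    using assms by (cases r s rule: linorder_cases) auto
qed

lemma rank_enum:
  assumes "finite X" "r < card X" shows "rank X (enum X r) = r"
proof -
  have inj: "inj_on (enum X) {..<card X}"
    using enum_less_iff[OF assms(1)]
    by (intro inj_onI) (metis lessThan_iff linorder_neq_iff)
  have "enum X ` {..<card X} = X"
    using assms(1) enum_in[OF assms(1)]
    by (intro card_subset_eq) (auto simp: card_image[OF inj])
  then have "{z \<in> X. z < enum X r} = {z \<in> enum X ` {..<card X}. z < enum X r}" by simp
  also have "\<dots> = enum X ` {i \<in> {..<card X}. i < r}"
    by (rule filter_image) (simp add: enum_less_iff assms)
  also have "{i \<in> {..<card X}. i < r} = {..<r}" using assms(2) by auto
  finally have "rank X (enum X r) = card (enum X ` {..<r})" by (simp only: rank_def)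
  also have "\<dots> = card {..<r}"
    using assms(2) by (intro card_image inj_on_subset[OF inj]) auto
  finally show ?thesis by simp
qed

lemma enum_rank:
  assumes "finite X" "y \<in> X" shows "enum X (rank X y) = y"
  using rank_less_card[OF assms] enum_in[OF assms(1)] rank_enum[OF assms(1)]
  by (intro inj_onD[OF inj_on_rank[OF assms(1)] _ _ assms(2)]) simp_all

lemma bij_betw_enum:
  assumes "finite X" shows "bij_betw (enum X) {..<card X} X"
  using assms enum_in rank_less_card
  by (intro bij_betw_byWitness[of _ "rank X"]) (auto simp: rank_enum enum_rank)

lemma relabel_eq: "r < card X \<Longrightarrow> relabel X \<beta> r = rank X (\<beta> (enum X r))"
  by (simp add: relabel_def rank_def enum_def)

lemma relabel_rank:
  assumes "finite X" "y \<in> X" shows "relabel X \<beta> (rank X y) = rank X (\<beta> y)"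
  using relabel_eq[OF rank_less_card[OF assms]] enum_rank[OF assms] by simp

lemma relabel_permutes:
  assumes "finite X" "\<beta> permutes X" shows "relabel X \<beta> permutes {..<card X}"
proof (rule bij_imp_permutes)
  have "bij_betw (rank X \<circ> (\<beta> \<circ> enum X)) {..<card X} {..<card X}"
    using bij_betw_enum[OF assms(1)] bij_betw_rank[OF assms(1)] permutes_imp_bij[OF assms(2)]
    by (meson bij_betw_trans)
  then show "bij_betw (relabel X \<beta>) {..<card X} {..<card X}"
    by (rule iffD1[OF bij_betw_cong, rotated]) (simp add: relabel_eq)
qed (simp add: relabel_def)

lemma relabel_inv:
  assumes "finite X" "\<beta> permutes X" shows "relabel X (inv \<beta>) = inv (relabel X \<beta>)"
proof (rule sym, rule inv_unique_comp)
  have *: "relabel X \<beta>' (relabel X \<beta>'' r) = r"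
    if "\<beta>'' permutes X" and inv: "\<And>y. \<beta>' (\<beta>'' y) = y" for \<beta>' \<beta>'' r
  proof (cases "r < card X")
    case True
    have e: "enum X r \<in> X" by (rule enum_in[OF assms(1) True])
    then have b: "\<beta>'' (enum X r) \<in> X" using that(1) by (simp add: permutes_in_image)
    show ?thesis
      by (simp only: relabel_eq[OF True] relabel_rank[OF assms(1) b] inv rank_enum[OF assms(1) True])
  qed (simp add: relabel_def)
  show "relabel X \<beta> \<circ> relabel X (inv \<beta>) = id"
    using *[OF permutes_inv[OF assms(2)], of \<beta>] permutes_inverses[OF assms(2)]
    by (simp add: fun_eq_iff)
  show "relabel X (inv \<beta>) \<circ> relabel X \<beta> = id"
    using *[OF assms(2), of "inv \<beta>"] permutes_inverses[OF assms(2)] by (simp add: fun_eq_iff)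
qed


section \<open>Contraction of permutations\<close>

lemma Sym_permutes: "\<sigma> \<in> Sym n \<Longrightarrow> \<sigma> permutes {1..n}"
  by (simp add: Sym_def)

lemma Sym_permutes0: "\<sigma> \<in> Sym n \<Longrightarrow> \<sigma> permutes {0..n}"
  unfolding Sym_def by (auto intro: permutes_subset)

lemma Sym_0: "\<sigma> \<in> Sym n \<Longrightarrow> \<sigma> 0 = 0"
  by (simp add: Sym_def permutes_not_in)

lemma SymI0:
  assumes "\<sigma> permutes {0..n}" "\<sigma> 0 = 0" shows "\<sigma> \<in> Sym n"
  unfolding Sym_def mem_Collect_eq
  using assms(1) by (rule permutes_superset) (use assms(2) in \<open>auto simp: Suc_le_eq\<close>)

lemma Sym0_permutes: "\<alpha> \<in> Sym0 n \<Longrightarrow> \<alpha> permutes {0..n}"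
  by (simp add: Sym0_def)

lemma Sym0_permutation: "\<alpha> \<in> Sym0 n \<Longrightarrow> permutation \<alpha>"
  using permutes_permutation[of \<alpha> "{0..n}"] by (simp add: Sym0_def)

lemma Sym_inv: "\<sigma> \<in> Sym n \<Longrightarrow> inv \<sigma> \<in> Sym n"
  by (simp add: Sym_def permutes_inv)

lemma Sym0_inv: "\<sigma> \<in> Sym0 n \<Longrightarrow> inv \<sigma> \<in> Sym0 n"
  by (simp add: Sym0_def permutes_inv)

lemma P12D:
  assumes "\<pi> \<in> P12 n"
  shows "\<pi> \<in> Sym n" "\<pi> (\<pi> x) = x" "\<pi> 0 = 0" "psupp \<pi> \<subseteq> {1..n}" "finite (psupp \<pi>)"
    "0 \<notin> psupp \<pi>" "x \<in> psupp \<pi> \<Longrightarrow> \<pi> x \<in> psupp \<pi>" "x \<notin> psupp \<pi> \<Longrightarrow> \<pi> x = x"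
    "\<pi> permutes {0..n}" "permutation \<pi>"
proof -
  show S: "\<pi> \<in> Sym n" using assms by (simp add: P12_def)
  show "\<pi> 0 = 0" using S by (rule Sym_0)
  then show "0 \<notin> psupp \<pi>" by (simp add: psupp_def)
  show sub: "psupp \<pi> \<subseteq> {1..n}"
  proof
    fix x assume "x \<in> psupp \<pi>"
    then show "x \<in> {1..n}" using permutes_not_in[OF Sym_permutes[OF S], of x] by (auto simp: psupp_def)
  qed
  show "finite (psupp \<pi>)" by (rule finite_subset[OF sub]) simp
  have inv: "\<pi> (\<pi> y) = y" for y using assms by (simp add: P12_def fun_eq_iff)
  show "\<pi> (\<pi> x) = x" by (rule inv)
  show "x \<in> psupp \<pi> \<Longrightarrow> \<pi> x \<in> psupp \<pi>" using inv[of x] by (auto simp: psupp_def)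
  show "x \<notin> psupp \<pi> \<Longrightarrow> \<pi> x = x" by (simp add: psupp_def)
  show "\<pi> permutes {0..n}" by (rule Sym_permutes0[OF S])
  then show "permutation \<pi>" by (rule permutes_permutation) simp
qed

lemma card_psupp:
  assumes "\<pi> \<in> P12 n" shows "card (psupp \<pi>) = 2 * npairs \<pi>"
proof -
  let ?L = "{i. i < \<pi> i}" and ?U = "{i. \<pi> i < i}"
  have U: "?U = \<pi> ` ?L"
  proof (intro equalityI subsetI)
    fix x assume "x \<in> ?U"
    then have "\<pi> x \<in> ?L" "x = \<pi> (\<pi> x)" using P12D(2)[OF assms] by simp_all
    then show "x \<in> \<pi> ` ?L" by blast
  qed (use P12D(2)[OF assms] in auto)
  have inj: "inj_on \<pi> ?L" by (rule inj_onI) (metis P12D(2)[OF assms])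
  have un: "psupp \<pi> = ?L \<union> ?U" by (auto simp: psupp_def)
  have fin: "finite ?L" "finite ?U" using P12D(5)[OF assms] unfolding un by simp_all
  have "card (psupp \<pi>) = card ?L + card ?U" unfolding un using fin by (intro card_Un_disjoint) auto
  also have "card ?U = card ?L" unfolding U using inj by (rule card_image)
  finally show ?thesis by (simp add: npairs_def)
qed

text \<open>The points that \<open>\<pi>\<close> leaves unpaired, including \<open>0\<close>.\<close>

definition rest :: "nat \<Rightarrow> (nat \<Rightarrow> nat) \<Rightarrow> nat set" where
  "rest n \<pi> = {0..n} - psupp \<pi>"

lemma rest_simps:
  assumes "\<pi> \<in> P12 n"
  shows "finite (rest n \<pi>)" "0 \<in> rest n \<pi>" "card (rest n \<pi>) = Suc (n - 2 * npairs \<pi>)"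
    "2 * npairs \<pi> \<le> n" "{..<card (rest n \<pi>)} = {0..n - 2 * npairs \<pi>}"
proof -
  show "finite (rest n \<pi>)" "0 \<in> rest n \<pi>" using P12D(6)[OF assms] by (simp_all add: rest_def)
  have "card (psupp \<pi>) \<le> card {1..n}" using P12D(4)[OF assms] by (intro card_mono) simp_all
  then show le: "2 * npairs \<pi> \<le> n" by (simp add: card_psupp[OF assms])
  have "card (rest n \<pi>) = card {0..n} - card (psupp \<pi>)"
    unfolding rest_def using P12D(4,5)[OF assms] by (intro card_Diff_subset) auto
  then show *: "card (rest n \<pi>) = Suc (n - 2 * npairs \<pi>)" using le by (simp add: card_psupp[OF assms])
  show "{..<card (rest n \<pi>)} = {0..n - 2 * npairs \<pi>}" unfolding * by auto
qed

definition red :: "nat \<Rightarrow> (nat \<Rightarrow> nat) \<Rightarrow> (nat \<Rightarrow> nat) \<Rightarrow> nat \<Rightarrow> nat" where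
  "red n \<pi> \<alpha> = relabel (rest n \<pi>) (erase (psupp \<pi>) (\<pi> \<circ> \<alpha>))"

lemma P12_comp_permutes:
  assumes "\<pi> \<in> P12 n" "\<alpha> \<in> Sym0 n"
  shows "\<pi> \<circ> \<alpha> permutes {0..n}" "permutation (\<pi> \<circ> \<alpha>)"
    "erase (psupp \<pi>) (\<pi> \<circ> \<alpha>) permutes rest n \<pi>"
proof -
  show *: "\<pi> \<circ> \<alpha> permutes {0..n}"
    using P12D(9)[OF assms(1)] Sym0_permutes[OF assms(2)] by (simp add: permutes_compose)
  then show "permutation (\<pi> \<circ> \<alpha>)" by (rule permutes_permutation) simp
  show "erase (psupp \<pi>) (\<pi> \<circ> \<alpha>) permutes rest n \<pi>"
    unfolding rest_def using * by (rule erase_permutes) simp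
qed

lemma red_Sym0:
  assumes "\<pi> \<in> P12 n" "\<alpha> \<in> Sym0 n" shows "red n \<pi> \<alpha> \<in> Sym0 (n - 2 * npairs \<pi>)"
  using relabel_permutes[OF rest_simps(1)[OF assms(1)] P12_comp_permutes(3)[OF assms]]
  unfolding rest_simps(5)[OF assms(1)] by (simp add: Sym0_def red_def)

lemma red_rank:
  assumes "\<pi> \<in> P12 n" "y \<in> rest n \<pi>"
  shows "red n \<pi> \<alpha> (rank (rest n \<pi>) y) = rank (rest n \<pi>) (erase (psupp \<pi>) (\<pi> \<circ> \<alpha>) y)"
  unfolding red_def by (rule relabel_rank[OF rest_simps(1)[OF assms(1)] assms(2)])

text \<open>The exponent of \<open>q\<close> in a contraction is the number of pairs minus the number of cycles that
  the contraction destroys, because \<open>relabel\<close> does not change the number of cycles.\<close>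

definition cweight :: "real \<Rightarrow> (nat \<Rightarrow> nat) \<Rightarrow> (nat \<Rightarrow> nat) \<Rightarrow> real" where
  "cweight q \<pi> \<alpha> = q powi (int (npairs \<pi>) - int (cyc_in (psupp \<pi>) (\<pi> \<circ> \<alpha>)))"

lemma contr_perm_eq:
  assumes "\<pi> \<in> P12 n" "\<alpha> \<in> Sym0 n"
  shows "contr_perm q n \<pi> \<alpha> = fscale (of_real (cweight q \<pi> \<alpha>)) (ga (red n \<pi> \<alpha>))"
proof -
  have "cyc0 {0..n} (\<pi> \<circ> \<alpha>) = cyc0 (rest n \<pi>) (erase (psupp \<pi>) (\<pi> \<circ> \<alpha>)) + cyc_in (psupp \<pi>) (\<pi> \<circ> \<alpha>)"
    unfolding rest_def using P12D(4,6)[OF assms(1)]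
    by (intro cyc0_erase P12_comp_permutes[OF assms]) auto
  then have "int (cyc0 (rest n \<pi>) (erase (psupp \<pi>) (\<pi> \<circ> \<alpha>))) - int (cyc0 {0..n} (\<pi> \<circ> \<alpha>)) + int (npairs \<pi>)
      = int (npairs \<pi>) - int (cyc_in (psupp \<pi>) (\<pi> \<circ> \<alpha>))" by simp
  then show ?thesis unfolding contr_perm_def Let_def red_def rest_def cweight_def by (simp only:)
qed

lemma W_contr:
  assumes "\<pi> \<in> P12 n" "\<alpha> \<in> Sym0 n"
  shows "W m (contr_ga q n \<pi> (ga \<alpha>)) F = of_real (cweight q \<pi> \<alpha>) *\<^sub>C W m (ga (red n \<pi> \<alpha>)) F"
proof -
  have one: "fscale 1 x = x" for x :: grpalg by (rule free.scale_one)
  have "W m (fscale c (ga \<gamma>)) F = c *\<^sub>C W m (ga \<gamma>) F" for c \<gamma>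
  proof (cases "c = 0")
    case False
    then have "Poly_Mapping.keys (fscale c (ga \<gamma>)) = {\<gamma>}"
      by (auto simp: in_keys_iff lookup_single when_def split: if_splits)
    then show ?thesis by (simp add: W_def)
  qed (simp add: W_def)
  then show ?thesis by (simp add: contr_ga_def one contr_perm_eq[OF assms])
qed

text \<open>Conjugation by \<open>\<sigma>\<close> permutes the unpaired points; \<open>rank_conj\<close> is the permutation that this
  induces on their relabelled versions.\<close>

definition rank_conj :: "nat set \<Rightarrow> (nat \<Rightarrow> nat) \<Rightarrow> nat \<Rightarrow> nat" where
  "rank_conj X \<sigma> r = (if r < card X then rank (\<sigma> ` X) (\<sigma> (enum X r)) else r)"

lemma rank_conj_permutes:
  assumes "finite X" "inj_on \<sigma> X" shows "rank_conj X \<sigma> permutes {..<card X}"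
proof (rule bij_imp_permutes)
  have "bij_betw (rank (\<sigma> ` X)) (\<sigma> ` X) {..<card X}"
    using bij_betw_rank[of "\<sigma> ` X"] assms by (simp add: card_image)
  then have "bij_betw (rank (\<sigma> ` X) \<circ> (\<sigma> \<circ> enum X)) {..<card X} {..<card X}"
    using bij_betw_enum[OF assms(1)] inj_on_imp_bij_betw[OF assms(2)]
    by (meson bij_betw_trans)
  then show "bij_betw (rank_conj X \<sigma>) {..<card X} {..<card X}"
    by (rule iffD1[OF bij_betw_cong, rotated]) (simp add: rank_conj_def)
qed (simp add: rank_conj_def)

lemma rank_conj_rank:
  assumes "finite X" "y \<in> X" shows "rank_conj X \<sigma> (rank X y) = rank (\<sigma> ` X) (\<sigma> y)"
  using rank_less_card[OF assms] enum_rank[OF assms] by (simp add: rank_conj_def)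

lemma conj_P12:
  assumes s: "\<sigma> \<in> Sym n" and p: "\<pi> \<in> P12 n"
  shows "\<sigma> \<circ> \<pi> \<circ> inv \<sigma> \<in> P12 n" "psupp (\<sigma> \<circ> \<pi> \<circ> inv \<sigma>) = \<sigma> ` psupp \<pi>"
    "npairs (\<sigma> \<circ> \<pi> \<circ> inv \<sigma>) = npairs \<pi>" "rest n (\<sigma> \<circ> \<pi> \<circ> inv \<sigma>) = \<sigma> ` rest n \<pi>"
    "rank_conj (rest n \<pi>) \<sigma> \<in> Sym (n - 2 * npairs \<pi>)"
proof -
  note sp = Sym_permutes[OF s]
  note inv = permutes_inverses[OF sp]
  show P: "\<sigma> \<circ> \<pi> \<circ> inv \<sigma> \<in> P12 n"
    using sp Sym_permutes[OF P12D(1)[OF p]] P12D(2)[OF p] inv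
    by (simp add: P12_def Sym_def permutes_compose permutes_inv fun_eq_iff)
  show supp: "psupp (\<sigma> \<circ> \<pi> \<circ> inv \<sigma>) = \<sigma> ` psupp \<pi>"
  proof (intro equalityI subsetI)
    fix x assume "x \<in> psupp (\<sigma> \<circ> \<pi> \<circ> inv \<sigma>)"
    then have "inv \<sigma> x \<in> psupp \<pi>" using inv by (auto simp: psupp_def)
    then show "x \<in> \<sigma> ` psupp \<pi>" using inv(1)[of x] by (metis imageI)
  next
    fix x assume "x \<in> \<sigma> ` psupp \<pi>"
    then obtain y where y: "x = \<sigma> y" "\<pi> y \<noteq> y" by (auto simp: psupp_def)
    then have "\<sigma> (\<pi> y) \<noteq> \<sigma> y" using permutes_inj[OF sp] by (simp add: inj_eq)
    then show "x \<in> psupp (\<sigma> \<circ> \<pi> \<circ> inv \<sigma>)" using y inv by (simp add: psupp_def)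
  qed
  have "card (psupp (\<sigma> \<circ> \<pi> \<circ> inv \<sigma>)) = card (psupp \<pi>)"
    unfolding supp by (rule card_image) (rule inj_on_subset[OF permutes_inj[OF sp] subset_UNIV])
  then show "npairs (\<sigma> \<circ> \<pi> \<circ> inv \<sigma>) = npairs \<pi>" by (simp add: card_psupp[OF p] card_psupp[OF P])
  show "rest n (\<sigma> \<circ> \<pi> \<circ> inv \<sigma>) = \<sigma> ` rest n \<pi>"
    unfolding rest_def supp image_set_diff[OF permutes_inj[OF sp]] permutes_image[OF Sym_permutes0[OF s]] ..
  have inj: "inj_on \<sigma> (rest n \<pi>)" by (rule inj_on_subset[OF permutes_inj[OF sp] subset_UNIV])
  show "rank_conj (rest n \<pi>) \<sigma> \<in> Sym (n - 2 * npairs \<pi>)"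
  proof (rule SymI0)
    show "rank_conj (rest n \<pi>) \<sigma> permutes {0..n - 2 * npairs \<pi>}"
      using rank_conj_permutes[OF rest_simps(1)[OF p] inj] unfolding rest_simps(5)[OF p] .
    show "rank_conj (rest n \<pi>) \<sigma> 0 = 0"
      using rank_conj_rank[OF rest_simps(1,2)[OF p], of \<sigma>] Sym_0[OF s] by simp
  qed
qed

text \<open>Contractions are equivariant under conjugation, which is why \<open>T\<close> is well defined on the
  symmetrized space.\<close>

lemma conj_red:
  assumes s: "\<sigma> \<in> Sym n" and p: "\<pi> \<in> P12 n" and a: "\<alpha> \<in> Sym0 n"
  shows "cyc_in (psupp (\<sigma> \<circ> \<pi> \<circ> inv \<sigma>)) (\<sigma> \<circ> \<pi> \<circ> inv \<sigma> \<circ> (\<sigma> \<circ> \<alpha> \<circ> inv \<sigma>)) = cyc_in (psupp \<pi>) (\<pi> \<circ> \<alpha>)" (is ?A)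
    and "red n (\<sigma> \<circ> \<pi> \<circ> inv \<sigma>) (\<sigma> \<circ> \<alpha> \<circ> inv \<sigma>)
      = rank_conj (rest n \<pi>) \<sigma> \<circ> red n \<pi> \<alpha> \<circ> inv (rank_conj (rest n \<pi>) \<sigma>)" (is "?L = ?t \<circ> _ \<circ> _")
proof -
  note sp = Sym_permutes[OF s]
  note inv = permutes_inverses[OF sp]
  note P = P12_comp_permutes[OF p a]
  have eq: "\<sigma> \<circ> \<pi> \<circ> inv \<sigma> \<circ> (\<sigma> \<circ> \<alpha> \<circ> inv \<sigma>) = \<sigma> \<circ> (\<pi> \<circ> \<alpha>) \<circ> inv \<sigma>" by (simp add: fun_eq_iff inv)
  have I: "intertwines \<sigma> {0..n} (\<pi> \<circ> \<alpha>) (\<sigma> \<circ> \<pi> \<circ> inv \<sigma> \<circ> (\<sigma> \<circ> \<alpha> \<circ> inv \<sigma>))"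
    unfolding intertwines_def eq permutes_image[OF P(1)]
    using inj_on_subset[OF permutes_inj[OF sp] subset_UNIV, of "{0..n}"] inv by simp
  have sub: "psupp \<pi> \<subseteq> {0..n}" using P12D(4)[OF p] by auto
  show ?A unfolding conj_P12(2)[OF s p] using I sub by (rule intertwines_cyc_in)
  let ?X = "rest n \<pi>" and ?e = "erase (psupp \<pi>) (\<pi> \<circ> \<alpha>)" and ?m = "n - 2 * npairs \<pi>"
  have comm: "?L \<circ> ?t = ?t \<circ> red n \<pi> \<alpha>"
  proof
    fix r show "(?L \<circ> ?t) r = (?t \<circ> red n \<pi> \<alpha>) r"
    proof (cases "r \<le> ?m")
      case True
      then have "r < card ?X" by (simp add: rest_simps(3)[OF p])
      then obtain y where y: "y \<in> ?X" "r = rank ?X y"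
        using enum_in rank_enum rest_simps(1)[OF p] by metis
      have ey: "?e y \<in> ?X" using y(1) P(3) by (simp add: permutes_in_image)
      have "\<sigma> y \<in> rest n (\<sigma> \<circ> \<pi> \<circ> inv \<sigma>)" unfolding conj_P12(4)[OF s p] using y(1) by simp
      then have "?L (?t r) = rank (\<sigma> ` ?X) (erase (\<sigma> ` psupp \<pi>) (\<sigma> \<circ> \<pi> \<circ> inv \<sigma> \<circ> (\<sigma> \<circ> \<alpha> \<circ> inv \<sigma>)) (\<sigma> y))"
        using red_rank[OF conj_P12(1)[OF s p]]
        unfolding y(2) rank_conj_rank[OF rest_simps(1)[OF p] y(1)] conj_P12(2,4)[OF s p] by simp
      also have "\<dots> = rank (\<sigma> ` ?X) (\<sigma> (?e y))"
        using intertwines_erase[OF I sub, of y] y(1) by (simp add: rest_def)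
      also have "\<dots> = ?t (rank ?X (?e y))" by (rule rank_conj_rank[OF rest_simps(1)[OF p] ey, symmetric])
      also have "rank ?X (?e y) = red n \<pi> \<alpha> r" unfolding y(2) by (rule red_rank[OF p y(1), symmetric])
      finally have *: "?L (?t r) = ?t (red n \<pi> \<alpha> r)" .
      have "(f \<circ> g) r = (h \<circ> k) r" if "f (g r) = h (k r)" for f g h k :: "nat \<Rightarrow> nat"
        using that by simp
      from this[of ?L ?t ?t "red n \<pi> \<alpha>", OF *] show ?thesis .
    next
      case False
      have "?L \<in> Sym0 ?m"
        using red_Sym0[OF conj_P12(1)[OF s p] Sym0_conj[OF s a]] conj_P12(3)[OF s p] by simp
      then show ?thesis
        using False red_Sym0[OF p a] conj_P12(5)[OF s p] by (simp add: Sym0_def Sym_def permutes_not_in)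
    qed
  qed
  have "?t \<circ> inv ?t = id" using conj_P12(5)[OF s p] by (simp add: Sym_def permutes_inv_o)
  then have "?L = (?L \<circ> ?t) \<circ> inv ?t" by (simp add: comp_assoc)
  then show "?L = ?t \<circ> red n \<pi> \<alpha> \<circ> inv ?t" unfolding comm .
qed

text \<open>\<open>\<pi> \<alpha>\<^sup>-\<^sup>1\<close> and \<open>(\<pi> \<alpha>)\<^sup>-\<^sup>1\<close> are conjugate by \<open>\<pi>\<close>, which does not move the points that survive.\<close>

lemma red_inv:
  assumes p: "\<pi> \<in> P12 n" and a: "\<alpha> \<in> Sym0 n"
  shows "red n \<pi> (inv \<alpha>) = inv (red n \<pi> \<alpha>)"
    and "cyc_in (psupp \<pi>) (\<pi> \<circ> inv \<alpha>) = cyc_in (psupp \<pi>) (\<pi> \<circ> \<alpha>)"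
proof -
  note P = P12_comp_permutes[OF p a]
  have ainv: "inv \<alpha> (\<alpha> x) = x" "\<alpha> (inv \<alpha> x) = x" for x
    using permutes_inverses[OF Sym0_permutes[OF a]] by simp_all
  have inv: "inv (\<pi> \<circ> \<alpha>) = inv \<alpha> \<circ> \<pi>"
    by (rule inv_unique_comp) (simp_all add: fun_eq_iff ainv P12D(2)[OF p])
  have Q: "inv \<alpha> \<circ> \<pi> permutes {0..n}" using permutes_inv[OF P(1)] unfolding inv .
  have I: "intertwines \<pi> {0..n} (inv (\<pi> \<circ> \<alpha>)) (\<pi> \<circ> inv \<alpha>)"
    unfolding intertwines_def inv permutes_image[OF Q]
    using inj_on_subset[OF permutes_inj[OF P12D(9)[OF p]] subset_UNIV, of "{0..n}"] by simp
  have sub: "psupp \<pi> \<subseteq> {0..n}" using P12D(4)[OF p] by auto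
  have im: "\<pi> ` psupp \<pi> = psupp \<pi>"
    using P12D(2,7)[OF p] by (metis (no_types, opaque_lifting) image_eqI image_subsetI subsetI subset_antisym)
  have "cyc_in (\<pi> ` psupp \<pi>) (\<pi> \<circ> inv \<alpha>) = cyc_in (psupp \<pi>) (inv (\<pi> \<circ> \<alpha>))"
    using I sub by (rule intertwines_cyc_in)
  then show "cyc_in (psupp \<pi>) (\<pi> \<circ> inv \<alpha>) = cyc_in (psupp \<pi>) (\<pi> \<circ> \<alpha>)"
    unfolding im cyc_in_inv[OF P(2)] .
  let ?e = "erase (psupp \<pi>) (\<pi> \<circ> \<alpha>)"
  have "erase (psupp \<pi>) (\<pi> \<circ> inv \<alpha>) = inv ?e"
  proof
    fix x
    have R: "inv ?e permutes rest n \<pi>" by (rule permutes_inv[OF P(3)])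
    have S: "erase (psupp \<pi>) (\<pi> \<circ> inv \<alpha>) permutes rest n \<pi>"
      by (rule P12_comp_permutes(3)[OF p Sym0_inv[OF a]])
    show "erase (psupp \<pi>) (\<pi> \<circ> inv \<alpha>) x = inv ?e x"
    proof (cases "x \<in> rest n \<pi>")
      case True
      then have x: "x \<in> {0..n}" "x \<notin> psupp \<pi>" by (auto simp: rest_def)
      have y: "inv ?e x \<notin> psupp \<pi>" using True permutes_in_image[OF R, of x] by (auto simp: rest_def)
      have "erase (\<pi> ` psupp \<pi>) (\<pi> \<circ> inv \<alpha>) (\<pi> x) = \<pi> (erase (psupp \<pi>) (inv (\<pi> \<circ> \<alpha>)) x)"
        using I sub x(1) by (rule intertwines_erase)
      then show ?thesis
        unfolding im erase_inv[OF P(2)] P12D(8)[OF p x(2)] P12D(8)[OF p y] .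
    qed (simp add: permutes_not_in[OF R] permutes_not_in[OF S])
  qed
  then show "red n \<pi> (inv \<alpha>) = inv (red n \<pi> \<alpha>)"
    unfolding red_def by (simp only: relabel_inv[OF rest_simps(1)[OF p] P(3)])
qed

lemma id_P12: "id \<in> P12 n"
  by (simp add: P12_def Sym_def permutes_id)

lemma psupp_id [simp]: "psupp id = {}" and npairs_id [simp]: "npairs id = 0"
  by (simp_all add: psupp_def npairs_def)

lemma red_id: "\<alpha> \<in> Sym0 n \<Longrightarrow> red n id \<alpha> = \<alpha>"
proof
  fix r assume a: "\<alpha> \<in> Sym0 n"
  have rk: "rank {0..n} y = y" if "y \<le> n" for y
  proof -
    have "{z \<in> {0..n}. z < y} = {..<y}" using that by auto
    then show ?thesis by (simp add: rank_def)
  qed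
  have e: "erase {} \<alpha> = \<alpha>" by (auto simp: fun_eq_iff erase_step)
  show "red n id \<alpha> r = \<alpha> r"
  proof (cases "r \<le> n")
    case True
    then have "\<alpha> r \<le> n" using permutes_in_image[OF Sym0_permutes[OF a], of r] by simp
    then show ?thesis
      using True red_rank[OF id_P12, of r n \<alpha>] by (simp add: rest_def rk e)
  next
    case False
    then show ?thesis
      using red_Sym0[OF id_P12 a] Sym0_permutes[OF a] by (simp add: Sym0_def permutes_not_in)
  qed
qed

lemma npairs_pos:
  assumes "\<pi> \<in> P12 n" "\<pi> \<noteq> id" shows "0 < npairs \<pi>"
proof -
  obtain x where "x \<in> psupp \<pi>" using assms(2) by (auto simp: psupp_def fun_eq_iff)
  then have "card (psupp \<pi>) \<noteq> 0" using P12D(5)[OF assms(1)] by auto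
  then show ?thesis by (simp add: card_psupp[OF assms(1)])
qed



section \<open>Juxtaposition of permutations\<close>

text \<open>The renaming underlying \<open>shift\<close>: the two sides of a juxtaposition share the point \<open>0\<close>.\<close>

definition emb :: "nat \<Rightarrow> nat \<Rightarrow> nat" where
  "emb k j = (if j = 0 then 0 else k + j)"

lemma emb_0 [simp]: "emb k 0 = 0" and emb_eq_0 [simp]: "emb k j = 0 \<longleftrightarrow> j = 0"
  and emb_le_iff [simp]: "emb k j \<le> k \<longleftrightarrow> j = 0"
  by (simp_all add: emb_def)

lemma inj_emb: "inj_on (emb k) X"
  by (auto simp: inj_on_def emb_def split: if_splits)

lemma emb_eq_iff [simp]: "emb k i = emb k j \<longleftrightarrow> i = j"
  by (auto simp: emb_def)

lemma shift_emb: "shift k \<beta> (emb k j) = emb k (\<beta> j)"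
  by (simp add: shift_def emb_def)

lemma shift_low: "0 < x \<Longrightarrow> x \<le> k \<Longrightarrow> shift k \<beta> x = x"
  by (simp add: shift_def)

lemma emb_cases:
  obtains (low) "0 < x" "x \<le> k" | (high) j where "x = emb k j"
proof (cases "0 < x \<and> x \<le> k")
  case False
  then have "x = emb k (x - k)" by (auto simp: emb_def)
  then show ?thesis using that by blast
qed (use that in auto)

lemma shift_comp: "shift k (\<beta> \<circ> \<gamma>) = shift k \<beta> \<circ> shift k \<gamma>"
proof
  fix x show "shift k (\<beta> \<circ> \<gamma>) x = (shift k \<beta> \<circ> shift k \<gamma>) x"
    by (cases x k rule: emb_cases) (simp_all add: shift_emb shift_low)
qed

lemma shift_id: "shift k id = id"
proof
  fix x show "shift k id x = id x" by (cases x k rule: emb_cases) (simp_all add: shift_emb shift_low)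
qed

lemma shift_permutes:
  assumes "\<beta> permutes {0..n}" shows "shift k \<beta> permutes {0..k + n}"
proof -
  have inv: "shift k (inv \<beta>) \<circ> shift k \<beta> = id" "shift k \<beta> \<circ> shift k (inv \<beta>) = id"
    unfolding shift_comp[symmetric] using permutes_inv_o[OF assms] by (simp_all add: shift_id)
  have "shift k \<beta> x = x" if "x \<notin> {0..k + n}" for x
  proof -
    have "x = emb k (x - k)" "x - k \<notin> {0..n}" using that by (auto simp: emb_def)
    then show ?thesis using shift_emb[of k \<beta> "x - k"] permutes_not_in[OF assms] by simp
  qed
  then show ?thesis using o_bij[OF inv] unfolding permutes_def by (metis bij_pointE)
qed

lemma inv_shift:
  assumes "\<beta> permutes {0..n}" shows "inv (shift k \<beta>) = shift k (inv \<beta>)"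
  by (rule inv_unique_comp)
     (simp_all add: shift_comp[symmetric] permutes_inv_o[OF assms] shift_id)

lemma shift_Sym: "\<tau> \<in> Sym n \<Longrightarrow> shift k \<tau> \<in> Sym (k + n)"
  using shift_permutes[OF Sym_permutes0] shift_emb[of k \<tau> 0] Sym_0 by (intro SymI0) simp_all

lemma Sym_mono: "\<sigma> \<in> Sym k \<Longrightarrow> \<sigma> \<in> Sym (k + n)"
  unfolding Sym_def by (auto intro: permutes_subset)

lemma cup_Sym0:
  assumes "\<beta> \<in> Sym0 k" "\<alpha> \<in> Sym0 n" shows "cup k \<beta> \<alpha> \<in> Sym0 (k + n)"
proof -
  have "\<beta> permutes {0..k + n}" using permutes_subset[OF Sym0_permutes[OF assms(1)]] by simp
  then show ?thesis
    unfolding cup_def Sym0_def mem_Collect_eq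
    by (rule permutes_compose) (rule shift_permutes[OF Sym0_permutes[OF assms(2)]])
qed

lemma low_commutes_shift:
  assumes "\<sigma> \<in> Sym k" shows "\<sigma> \<circ> shift k \<alpha> = shift k \<alpha> \<circ> \<sigma>"
proof
  note perm = Sym_permutes[OF assms]
  fix x show "(\<sigma> \<circ> shift k \<alpha>) x = (shift k \<alpha> \<circ> \<sigma>) x"
  proof (cases x k rule: emb_cases)
    case low
    then have "\<sigma> x \<in> {1..k}" using permutes_in_image[OF perm, of x] by simp
    then show ?thesis using low by (simp add: shift_low)
  next
    case (high j)
    have "\<sigma> (emb k i) = emb k i" for i by (rule permutes_not_in[OF perm]) (auto simp: emb_def)
    then show ?thesis using high by (simp add: shift_emb)
  qed
qed

text \<open>Conjugating one side of a juxtaposition is conjugating the whole, since a permutation of the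
  points of one side that fixes \<open>0\<close> commutes with the permutation on the other side.\<close>

lemma cup_conj_left:
  assumes "\<sigma> \<in> Sym k"
  shows "cup k (\<sigma> \<circ> \<beta> \<circ> inv \<sigma>) \<alpha> = \<sigma> \<circ> cup k \<beta> \<alpha> \<circ> inv \<sigma>"
  using low_commutes_shift[OF assms] by (simp add: cup_def comp_assoc[symmetric])

lemma cup_conj_right:
  assumes "\<tau> \<in> Sym n" and b: "\<beta> \<in> Sym0 k"
  shows "cup k \<beta> (\<tau> \<circ> \<alpha> \<circ> inv \<tau>) = shift k \<tau> \<circ> cup k \<beta> \<alpha> \<circ> inv (shift k \<tau>)"
proof -
  have i: "inv (shift k \<tau>) = shift k (inv \<tau>)" by (rule inv_shift[OF Sym_permutes0[OF assms(1)]])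
  have "shift k (inv \<tau>) \<circ> \<beta> = \<beta> \<circ> shift k (inv \<tau>)"
  proof
    fix x
    have 0: "shift k (inv \<tau>) 0 = 0"
      using shift_emb[of k "inv \<tau>" 0] Sym_0[OF Sym_inv[OF assms(1)]] by simp
    show "(shift k (inv \<tau>) \<circ> \<beta>) x = (\<beta> \<circ> shift k (inv \<tau>)) x"
    proof (cases "x \<le> k")
      case True
      then have "\<beta> x \<le> k" using permutes_in_image[OF Sym0_permutes[OF b], of x] by simp
      then show ?thesis using True 0 shift_low[of x] shift_low[of "\<beta> x"] by (cases "x = 0"; cases "\<beta> x = 0") simp_all
    next
      case False
      then have x: "x = emb k (x - k)" and "x - k \<noteq> 0" by (auto simp: emb_def)
      moreover have "inv \<tau> (x - k) \<noteq> 0"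
        using \<open>x - k \<noteq> 0\<close> permutes_inverses[OF Sym_permutes[OF assms(1)]] Sym_0[OF assms(1)] by metis
      ultimately have "\<not> shift k (inv \<tau>) x \<le> k" using shift_emb[of k "inv \<tau>" "x - k"] by simp
      then show ?thesis using False permutes_not_in[OF Sym0_permutes[OF b]] by simp
    qed
  qed
  then show ?thesis unfolding i cup_def shift_comp by (simp add: comp_assoc)
qed


section \<open>Gluing two partial pairings\<close>

lemma involution_Sym:
  assumes inv: "\<And>x. f (f x) = x" and out: "\<And>x. x \<notin> {1..n} \<Longrightarrow> f x = x"
  shows "f \<in> Sym n"
proof -
  have "\<exists>!x. f x = y" for y using inv by metis
  then show ?thesis using out by (simp add: Sym_def permutes_def)
qed

text \<open>A pair partition of \<open>[k + n]\<close> consists of its pairs within \<open>[k]\<close>, its pairs within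
  \<open>k + [n]\<close> and the pairs joining the remaining points of both sides, which amount to a
  permutation once those points are numbered increasingly.\<close>

definition glue :: "nat \<Rightarrow> nat \<Rightarrow> (nat \<Rightarrow> nat) \<Rightarrow> (nat \<Rightarrow> nat) \<Rightarrow> (nat \<Rightarrow> nat) \<Rightarrow> nat \<Rightarrow> nat" where
  "glue k n \<pi>1 \<pi>2 \<sigma> i =
     (if i = 0 \<or> k + n < i then i
      else if i \<le> k then
        (if \<pi>1 i \<noteq> i then \<pi>1 i else k + enum (rest n \<pi>2) (\<sigma> (rank (rest k \<pi>1) i)))
      else
        (if \<pi>2 (i - k) \<noteq> i - k then k + \<pi>2 (i - k)
         else enum (rest k \<pi>1) (inv \<sigma> (rank (rest n \<pi>2) (i - k)))))"

locale gluing =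
  fixes k n m :: nat and \<pi>1 \<pi>2 \<sigma> :: "nat \<Rightarrow> nat"
  assumes p1: "\<pi>1 \<in> P12 k" and p2: "\<pi>2 \<in> P12 n" and s: "\<sigma> \<in> Sym m"
    and m1: "k - 2 * npairs \<pi>1 = m" and m2: "n - 2 * npairs \<pi>2 = m"
begin

abbreviation "X1 \<equiv> rest k \<pi>1"
abbreviation "X2 \<equiv> rest n \<pi>2"
abbreviation "g \<equiv> glue k n \<pi>1 \<pi>2 \<sigma>"

text \<open>The matching of the unpaired points of the left side with those of the right side.\<close>

definition "match x = enum X2 (\<sigma> (rank X1 x))"
definition "match' y = enum X1 (inv \<sigma> (rank X2 y))"

lemmas X1 = rest_simps[OF p1, unfolded m1]
lemmas X2 = rest_simps[OF p2, unfolded m2]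

lemma s_le: "\<sigma> r \<le> m \<longleftrightarrow> r \<le> m" "inv \<sigma> r \<le> m \<longleftrightarrow> r \<le> m"
  using permutes_in_image[OF Sym_permutes0[OF s], of r]
    permutes_in_image[OF Sym_permutes0[OF Sym_inv[OF s]], of r] by simp_all

lemma s_inv: "\<sigma> (inv \<sigma> r) = r" "inv \<sigma> (\<sigma> r) = r"
  using permutes_inverses[OF Sym_permutes[OF s]] by simp_all

lemma rank1: "x \<in> X1 \<Longrightarrow> rank X1 x \<le> m" and rank2: "y \<in> X2 \<Longrightarrow> rank X2 y \<le> m"
  using rank_less_card[OF X1(1), of x] rank_less_card[OF X2(1), of y] by (simp_all add: X1(3) X2(3))

lemma match_in: "x \<in> X1 \<Longrightarrow> match x \<in> X2" and match'_in: "y \<in> X2 \<Longrightarrow> match' y \<in> X1"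
  unfolding match_def match'_def using rank1[of x] rank2[of y]
  by (auto intro!: enum_in X1(1) X2(1) simp: X1(3) X2(3) less_Suc_eq_le s_le)

lemma rank_match: "x \<in> X1 \<Longrightarrow> rank X2 (match x) = \<sigma> (rank X1 x)"
  unfolding match_def using rank1[of x] by (intro rank_enum X2(1)) (simp add: X2(3) less_Suc_eq_le s_le)

lemma rank_match': "y \<in> X2 \<Longrightarrow> rank X1 (match' y) = inv \<sigma> (rank X2 y)"
  unfolding match'_def using rank2[of y] by (intro rank_enum X1(1)) (simp add: X1(3) less_Suc_eq_le s_le)

lemma match_match': "y \<in> X2 \<Longrightarrow> match (match' y) = y"
  by (simp add: match_def rank_match' s_inv enum_rank[OF X2(1)])

lemma match'_match: "x \<in> X1 \<Longrightarrow> match' (match x) = x"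
  by (simp add: match'_def rank_match s_inv enum_rank[OF X1(1)])

lemma match_0 [simp]: "match 0 = 0" and match'_0 [simp]: "match' 0 = 0"
  using enum_rank[OF X2(1,2)] enum_rank[OF X1(1,2)] Sym_0[OF s] Sym_0[OF Sym_inv[OF s]]
  by (simp_all add: match_def match'_def)

lemma match_pos: "x \<in> X1 \<Longrightarrow> 0 < x \<Longrightarrow> 0 < match x" and match'_pos: "y \<in> X2 \<Longrightarrow> 0 < y \<Longrightarrow> 0 < match' y"
  using match'_match[of x] match_match'[of y] by (auto intro: gr0I)

lemma X1_iff: "x \<in> X1 \<longleftrightarrow> x \<le> k \<and> \<pi>1 x = x" and X2_iff: "y \<in> X2 \<longleftrightarrow> y \<le> n \<and> \<pi>2 y = y"
  by (auto simp: rest_def psupp_def)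

lemma p1_range: "\<pi>1 x \<noteq> x \<Longrightarrow> 0 < x \<and> x \<le> k \<and> 0 < \<pi>1 x \<and> \<pi>1 x \<le> k \<and> \<pi>1 (\<pi>1 x) = x"
  using P12D(4)[OF p1] P12D(7)[OF p1, of x] P12D(2)[OF p1] by (auto simp: psupp_def subset_iff Suc_le_eq)

lemma p2_range: "\<pi>2 x \<noteq> x \<Longrightarrow> 0 < x \<and> x \<le> n \<and> 0 < \<pi>2 x \<and> \<pi>2 x \<le> n \<and> \<pi>2 (\<pi>2 x) = x"
  using P12D(4)[OF p2] P12D(7)[OF p2, of x] P12D(2)[OF p2] by (auto simp: psupp_def subset_iff Suc_le_eq)

lemma glue_simps:
  "g 0 = 0" "k + n < i \<Longrightarrow> g i = i"
  "\<pi>1 i \<noteq> i \<Longrightarrow> g i = \<pi>1 i"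
  "i \<in> X1 \<Longrightarrow> g i = emb k (match i)"
  "\<pi>2 j \<noteq> j \<Longrightarrow> g (emb k j) = emb k (\<pi>2 j)"
  "j \<in> X2 \<Longrightarrow> g (emb k j) = match' j"
proof -
  show "g 0 = 0" "k + n < i \<Longrightarrow> g i = i" by (simp_all add: glue_def)
  show "\<pi>1 i \<noteq> i \<Longrightarrow> g i = \<pi>1 i" using p1_range[of i] by (simp add: glue_def)
  show "i \<in> X1 \<Longrightarrow> g i = emb k (match i)"
    using match_pos[of i] match_0 by (cases "i = 0") (simp_all add: glue_def emb_def X1_iff match_def)
  show "\<pi>2 j \<noteq> j \<Longrightarrow> g (emb k j) = emb k (\<pi>2 j)"
    using p2_range[of j] by (simp add: glue_def emb_def)
  show "j \<in> X2 \<Longrightarrow> g (emb k j) = match' j"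
    using match'_0 by (cases "j = 0") (simp_all add: glue_def emb_def X2_iff match'_def)
qed

lemma glue_cases [case_names zero out supp1 rest1 supp2 rest2]:
  obtains "i = 0" | "k + n < i" | "\<pi>1 i \<noteq> i" | "i \<in> X1" "0 < i"
  | j where "i = emb k j" "\<pi>2 j \<noteq> j" | j where "i = emb k j" "j \<in> X2" "0 < j"
proof (cases i k rule: emb_cases)
  case low
  then show ?thesis using that(3,4) X1_iff by blast
next
  case (high j)
  show ?thesis
  proof (cases "j = 0 \<or> n < j")
    case True
    then show ?thesis using that(1,2) high by (auto simp: emb_def)
  next
    case False
    then show ?thesis using that(5,6) high X2_iff by (metis gr0I not_less)
  qed
qed

lemma glue_glue: "g (g i) = i"
proof (cases i rule: glue_cases)
  case supp1
  then have "\<pi>1 (\<pi>1 i) \<noteq> \<pi>1 i" "\<pi>1 (\<pi>1 i) = i" using p1_range[of i] by simp_all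
  then show ?thesis using supp1 by (simp add: glue_simps)
next
  case (supp2 j)
  then have "\<pi>2 (\<pi>2 j) \<noteq> \<pi>2 j" "\<pi>2 (\<pi>2 j) = j" using p2_range[of j] by simp_all
  then show ?thesis using supp2 by (simp add: glue_simps)
next
  case rest1
  then show ?thesis using match_in by (simp add: glue_simps match'_match)
next
  case (rest2 j)
  then show ?thesis using match'_in by (simp add: glue_simps match_match')
qed (simp_all add: glue_simps)

lemma glue_Sym: "g \<in> Sym (k + n)"
proof (rule involution_Sym[OF glue_glue])
  show "g x = x" if "x \<notin> {1..k + n}" for x
    using that glue_simps(1) glue_simps(2)[of x] by (cases "x = 0") auto
qed

lemma glue_P2: "g \<in> P2 (k + n)"
proof -
  have "g \<in> P12 (k + n)" using glue_Sym glue_glue by (simp add: P12_def fun_eq_iff)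
  moreover have "g i \<noteq> i" if i: "i \<in> {1..k + n}" for i
  proof (cases i rule: glue_cases)
    case rest1
    then show ?thesis using match_pos[of i] X1_iff by (auto simp: glue_simps emb_def)
  next
    case (rest2 j)
    have "match' j \<le> k" using match'_in[OF rest2(2)] by (simp add: X1_iff)
    moreover have "k < i" using rest2 by (simp add: emb_def)
    moreover have "g i = match' j" unfolding rest2(1) by (rule glue_simps(6)[OF rest2(2)])
    ultimately show ?thesis by simp
  qed (use i glue_simps(3,5) in auto)
  ultimately show ?thesis by (simp add: P2_def)
qed

text \<open>The part of the gluing that pairs points of different sides.\<close>

definition "cross = g \<circ> (\<pi>1 \<circ> shift k \<pi>2)"

lemma cross_simps:
  "x \<in> psupp \<pi>1 \<Longrightarrow> cross x = x" "j \<in> psupp \<pi>2 \<Longrightarrow> cross (emb k j) = emb k j"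
  "x \<in> X1 \<Longrightarrow> cross x = emb k (match x)" "y \<in> X2 \<Longrightarrow> cross (emb k y) = match' y"
proof -
  have p1_emb: "\<pi>1 (emb k j) = emb k j" for j
    using p1_range[of "emb k j"] P12D(3)[OF p1] by (cases "j = 0") auto
  show "x \<in> psupp \<pi>1 \<Longrightarrow> cross x = x"
    using p1_range[of x] shift_low[of x k] glue_simps(3)[of "\<pi>1 x"]
    by (auto simp: cross_def psupp_def)
  show "j \<in> psupp \<pi>2 \<Longrightarrow> cross (emb k j) = emb k j"
    using p2_range[of j] glue_simps(5)[of "\<pi>2 j"] by (auto simp: cross_def psupp_def shift_emb p1_emb)
  show "x \<in> X1 \<Longrightarrow> cross x = emb k (match x)"
    using shift_low[of x k] glue_simps(1) glue_simps(4)[of x] shift_emb[of k \<pi>2 0] P12D(3)[OF p2] P12D(3)[OF p1]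
    by (cases "x = 0") (auto simp: cross_def X1_iff)
  show "y \<in> X2 \<Longrightarrow> cross (emb k y) = match' y"
    using glue_simps(6)[of y] by (simp add: cross_def shift_emb p1_emb X2_iff)
qed

lemma glue_cup:
  "g \<circ> cup k \<beta> \<alpha> = cross \<circ> (shift k (\<pi>2 \<circ> \<alpha>) \<circ> (\<pi>1 \<circ> \<beta>))"
proof -
  have S: "\<pi>1 \<in> Sym k" by (rule P12D(1)[OF p1])
  have i1: "\<pi>1 \<circ> \<pi>1 = id" and i2: "\<pi>2 \<circ> \<pi>2 = id" using p1 p2 by (simp_all add: P12_def)
  have "cross \<circ> (shift k (\<pi>2 \<circ> \<alpha>) \<circ> (\<pi>1 \<circ> \<beta>)) =
      g \<circ> \<pi>1 \<circ> (shift k \<pi>2 \<circ> shift k \<pi>2) \<circ> (shift k \<alpha> \<circ> \<pi>1) \<circ> \<beta>"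
    by (simp add: cross_def shift_comp comp_assoc)
  also have "\<dots> = g \<circ> (\<pi>1 \<circ> \<pi>1) \<circ> shift k \<alpha> \<circ> \<beta>"
    unfolding shift_comp[symmetric] i2 shift_id low_commutes_shift[OF S, symmetric] by (simp add: comp_assoc)
  finally show ?thesis by (simp add: i1 cup_def comp_assoc)
qed

lemma cross_permutes: "cross permutes {0..k + n}"
proof -
  have "\<pi>1 permutes {0..k + n}" using permutes_subset[OF P12D(9)[OF p1], of "{0..k + n}"] by simp
  then show ?thesis
    unfolding cross_def using shift_permutes[OF P12D(9)[OF p2]] Sym_permutes0[OF glue_Sym]
    by (intro permutes_compose)
qed

text \<open>In \<open>\<gamma> = cross (\<pi>2 \<alpha>)' (\<pi>1 \<beta>)\<close> the points paired within one side are moved by at most one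
  of the three factors, so they can be erased from each factor separately. Afterwards a point on
  the right side is always sent to the left side, and erasing the right side leaves a conjugate of
  the product of the two contracted permutations.\<close>

lemma cyc0_glue:
  assumes b: "\<beta> \<in> Sym0 k" and a: "\<alpha> \<in> Sym0 n"
  shows "cyc0 {0..k + n} (g \<circ> cup k \<beta> \<alpha>) =
    cyc0 {0..m} (red n \<pi>2 \<alpha> \<circ> \<sigma> \<circ> red k \<pi>1 \<beta> \<circ> inv \<sigma>)
      + cyc_in (psupp \<pi>1) (\<pi>1 \<circ> \<beta>) + cyc_in (psupp \<pi>2) (\<pi>2 \<circ> \<alpha>)"
proof -
  let ?X = "{0..k + n}"
  define bb where "bb = \<pi>1 \<circ> \<beta>"
  define aa where "aa = shift k (\<pi>2 \<circ> \<alpha>)"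
  define \<gamma> where "\<gamma> = cross \<circ> (aa \<circ> bb)"
  define D1 where "D1 = psupp \<pi>1"
  define D2 where "D2 = emb k ` psupp \<pi>2"
  note P1 = P12_comp_permutes[OF p1 b] and P2 = P12_comp_permutes[OF p2 a]
  have bb_perm: "bb permutes {0..k}" "permutation bb" using P1 by (simp_all add: bb_def)
  have aa_perm: "aa permutes ?X" unfolding aa_def by (rule shift_permutes[OF P2(1)])
  have g_perm: "\<gamma> permutes ?X"
    unfolding \<gamma>_def using permutes_subset[OF bb_perm(1), of ?X] aa_perm cross_permutes
    by (intro permutes_compose) simp_all
  have perm: "permutation aa" "permutation cross" "permutation \<gamma>" "permutation (aa \<circ> bb)"
    using aa_perm cross_permutes g_perm bb_perm(2) permutes_permutation[of _ ?X]
    by (auto intro: permutation_compose)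
  have inj: "cross x = cross y \<longleftrightarrow> x = y" "aa x = aa y \<longleftrightarrow> x = y" for x y
    using permutes_inj[OF cross_permutes] permutes_inj[OF aa_perm] by (simp_all add: inj_eq)
  have D1: "finite D1" "D1 \<subseteq> {1..k}" and D2: "finite D2" "D2 \<subseteq> {k + 1..k + n}"
    using P12D(4,5)[OF p1] P12D(4,5)[OF p2] by (auto simp: D1_def D2_def emb_def subset_iff)
  have D1_range: "0 < x \<and> x \<le> k" if "x \<in> D1" for x
    using subsetD[OF D1(2) that] by simp
  have D2_range: "k < x \<and> x \<le> k + n" if "x \<in> D2" for x
    using subsetD[OF D2(2) that] by simp
  have b_fix: "bb x = x" if "k < x" for x using permutes_not_in[OF bb_perm(1)] that by simp
  have a_fix: "aa x = x" if "0 < x" "x \<le> k" for x using that by (simp add: aa_def shift_low)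
  have c_fix: "cross x = x" if "x \<in> D1 \<union> D2" for x
    using that cross_simps(1,2) by (auto simp: D1_def D2_def)
  have b_fix2: "bb x = x" if "x \<in> D2" for x using b_fix D2_range[OF that] by blast
  have a_fix1: "aa x = x" if "x \<in> D1" for x using a_fix D1_range[OF that] by blast
  have c_eq: "cross y = d \<longleftrightarrow> y = d" if "d \<in> D1 \<union> D2" for y d
    using inj(1)[of y d] c_fix[OF that] by simp
  have aa_high: "aa x = 0 \<or> k < aa x" if "k < x" for x
  proof -
    have "x = emb k (x - k)" using that by (simp add: emb_def)
    then have "aa x = emb k ((\<pi>2 \<circ> \<alpha>) (x - k))" unfolding aa_def by (metis shift_emb)
    then show ?thesis by (simp add: emb_def)
  qed
  have eq: "g \<circ> cup k \<beta> \<alpha> = \<gamma>" unfolding glue_cup \<gamma>_def aa_def bb_def ..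

  have "cyc_in D2 aa = cyc_in (psupp \<pi>2) (\<pi>2 \<circ> \<alpha>)"
  proof -
    have I: "intertwines (emb k) {0..n} (\<pi>2 \<circ> \<alpha>) aa"
      unfolding intertwines_def permutes_image[OF P2(1)] by (simp add: inj_emb aa_def shift_emb)
    show ?thesis unfolding D2_def using P12D(4)[OF p2] by (intro intertwines_cyc_in[OF I]) auto
  qed
  moreover have "cyc_in D2 \<gamma> = cyc_in D2 aa"
  proof (rule cyc_in_cong[OF perm(3,1)])
    fix x assume x: "x \<in> D2" "\<gamma> x \<in> D2 \<or> aa x \<in> D2"
    then have "\<gamma> x = cross (aa x)" by (simp add: \<gamma>_def b_fix2)
    then show "\<gamma> x = aa x" using x(2) c_eq[of "\<gamma> x" "aa x"] c_eq[of "aa x" "aa x"] by auto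
  qed
  moreover have "cyc_in D1 \<gamma> = cyc_in D1 bb"
  proof (rule cyc_in_cong[OF perm(3) bb_perm(2)])
    fix x assume x: "x \<in> D1" "\<gamma> x \<in> D1 \<or> bb x \<in> D1"
    show "\<gamma> x = bb x"
    proof (cases "bb x \<in> D1")
      case True
      then show ?thesis by (simp add: \<gamma>_def a_fix1 c_fix)
    next
      case False
      then have "\<gamma> x \<in> D1" using x by simp
      then have "aa (bb x) = \<gamma> x" using c_eq[of "\<gamma> x" "aa (bb x)"] by (simp add: \<gamma>_def)
      then have "aa (bb x) = aa (\<gamma> x)" using a_fix1[OF \<open>\<gamma> x \<in> D1\<close>] by simp
      then show ?thesis using inj(2) by simp
    qed
  qed
  moreover have "cyc_in (D1 \<union> D2) \<gamma> = cyc_in D1 \<gamma> + cyc_in D2 \<gamma>"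
  proof (rule cyc_in_Un[OF perm(3) D1(1) D2(1)])
    show "D1 \<inter> D2 = {}" using D1_range D2_range by (meson disjoint_iff not_less)
    fix x assume x: "x \<in> D2" "\<gamma> x \<in> D1 \<union> D2"
    have "\<gamma> x = cross (aa x)" using x(1) by (simp add: \<gamma>_def b_fix2)
    then have "\<gamma> x = aa x" using c_eq[OF x(2), of "aa x"] by simp
    moreover have "k < x" using D2_range[OF x(1)] by blast
    ultimately have "\<gamma> x = 0 \<or> k < \<gamma> x" using aa_high by simp
    then have "\<gamma> x \<notin> D1" using D1_range[of "\<gamma> x"] by auto
    then show "\<gamma> x \<in> D2" using x(2) by blast
  qed
  ultimately have lost: "cyc_in (D1 \<union> D2) \<gamma> = cyc_in D1 bb + cyc_in (psupp \<pi>2) (\<pi>2 \<circ> \<alpha>)" by simp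

  define b1 where "b1 = erase D1 bb"
  define a1 where "a1 = erase (psupp \<pi>2) (\<pi>2 \<circ> \<alpha>)"
  define \<gamma>1 where "\<gamma>1 = erase (D1 \<union> D2) \<gamma>"
  have b1_perm: "b1 permutes X1" using P1(3) by (simp add: b1_def bb_def D1_def)
  have a1_perm: "a1 permutes X2" using P2(3) by (simp add: a1_def)
  have "erase (D1 \<union> D2) bb = b1"
    unfolding b1_def using bb_perm(2) D2(1) b_fix2 by (rule erase_Un_fixed)
  moreover have "erase (D1 \<union> D2) aa = shift k a1"
  proof -
    have "erase (D1 \<union> D2) aa = erase D2 aa"
      unfolding Un_commute[of D1] using perm(1) D1(1) a_fix1 by (rule erase_Un_fixed)
    also have "\<dots> = shift k a1"
    proof
      fix x show "erase D2 aa x = shift k a1 x"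
      proof (cases x k rule: emb_cases)
        case low
        then show ?thesis by (simp add: erase_fixed_point a_fix shift_low)
      next
        case (high j)
        have I: "intertwines (emb k) UNIV (\<pi>2 \<circ> \<alpha>) aa"
          unfolding intertwines_def by (simp add: inj_emb aa_def shift_emb)
        show ?thesis
          unfolding high D2_def a1_def shift_emb by (rule intertwines_erase[OF I]) simp_all
      qed
    qed
    finally show ?thesis .
  qed
  moreover have "erase (D1 \<union> D2) cross = cross" by (rule erase_fixed[OF c_fix perm(2)])
  moreover have "erase (D1 \<union> D2) (aa \<circ> bb) = erase (D1 \<union> D2) aa \<circ> erase (D1 \<union> D2) bb"
    using D1(1) D2(1) a_fix1 b_fix2 by (intro erase_comp perm bb_perm(2)) auto
  moreover have "\<gamma>1 = erase (D1 \<union> D2) cross \<circ> erase (D1 \<union> D2) (aa \<circ> bb)"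
    unfolding \<gamma>1_def \<gamma>_def using D1(1) D2(1) c_fix by (intro erase_comp perm) auto
  ultimately have g1: "\<gamma>1 = cross \<circ> (shift k a1 \<circ> b1)" by simp

  define Y where "Y = ?X - (D1 \<union> D2)"
  define K where "K = emb k ` (X2 - {0})"
  have g1_perm: "\<gamma>1 permutes Y" "permutation \<gamma>1"
    unfolding \<gamma>1_def Y_def using erase_permutes[OF g_perm] permutation_erase[OF perm(3)] by simp_all
  have "cyc0 ?X \<gamma> = cyc0 Y \<gamma>1 + cyc_in (D1 \<union> D2) \<gamma>"
    unfolding Y_def \<gamma>1_def using D1(2) D2(2) by (intro cyc0_erase g_perm) auto
  have K_high: "k < x" if "x \<in> K" for x using that by (auto simp: K_def emb_def)
  have XK: "x \<notin> K" if "x \<in> X1" for x using that K_high[of x] by (auto simp: X1_iff)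
  have YK: "Y - K = X1" "K \<subseteq> Y"
  proof -
    have "x \<in> Y \<longleftrightarrow> x \<in> X1 \<or> x \<in> K" for x
    proof (cases "x \<le> k")
      case True
      then have "x \<notin> D2" "x \<notin> K" using D2_range[of x] K_high[of x] by auto
      then show ?thesis using True by (auto simp: Y_def rest_def D1_def)
    next
      case False
      then have x: "x = emb k (x - k)" "x \<notin> X1" "x \<notin> D1"
        using D1_range[of x] by (auto simp: emb_def X1_iff)
      have "emb k j \<in> D2 \<longleftrightarrow> j \<in> psupp \<pi>2" for j
        unfolding D2_def by (rule inj_image_mem_iff[OF inj_emb])
      then have "x \<in> D2 \<longleftrightarrow> x - k \<in> psupp \<pi>2" by (subst x(1))
      moreover have "emb k j \<in> K \<longleftrightarrow> j \<in> X2 - {0}" for j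
        unfolding K_def by (rule inj_image_mem_iff[OF inj_emb])
      then have "x \<in> K \<longleftrightarrow> x - k \<in> X2 - {0}" by (subst x(1))
      then have "x \<in> K \<longleftrightarrow> x - k \<in> X2" using False by simp
      moreover have "x \<in> ?X \<longleftrightarrow> x - k \<le> n" using False by auto
      ultimately show ?thesis using x(2,3) by (auto simp: Y_def rest_def)
    qed
    then show "Y - K = X1" "K \<subseteq> Y" using XK by auto
  qed
  have step2: "\<gamma>1 (emb k y) = match' (a1 y)" if "y \<in> X2" "y \<noteq> 0" for y
  proof -
    have "b1 (emb k y) = emb k y"
      using that(2) by (intro permutes_not_in[OF b1_perm]) (simp add: X1_iff)
    moreover have "a1 y \<in> X2" using that(1) by (simp add: permutes_in_image[OF a1_perm])
    ultimately show ?thesis by (simp add: g1 shift_emb cross_simps(4))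
  qed
  have "cyc_in K \<gamma>1 = 0"
  proof -
    have leaves: "\<not> orbit \<gamma>1 x \<subseteq> K" if x: "x \<in> K" for x
    proof -
      obtain y where y: "x = emb k y" "y \<in> X2" "y \<noteq> 0" using x by (auto simp: K_def)
      have "match' (a1 y) \<in> X1" using y(2) by (intro match'_in) (simp add: permutes_in_image[OF a1_perm])
      then have "\<gamma>1 x \<notin> K" unfolding y(1) step2[OF y(2,3)] by (rule XK)
      then show ?thesis using orbit.base[of \<gamma>1 x] by (meson subsetD)
    qed
    have "{c \<in> orbit \<gamma>1 ` K. c \<subseteq> K} = {}"
    proof (rule equals0I)
      fix c assume "c \<in> {c \<in> orbit \<gamma>1 ` K. c \<subseteq> K}"
      then have c: "c \<in> orbit \<gamma>1 ` K" "c \<subseteq> K" by simp_all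
      obtain x where x: "c = orbit \<gamma>1 x" "x \<in> K" using c(1) by (rule imageE)
      show False using leaves[OF x(2)] c(2) unfolding x(1) by (rule notE)
    qed
    then show ?thesis unfolding cyc_in_def by (simp only: card.empty)
  qed
  moreover have "cyc0 Y \<gamma>1 = cyc0 X1 (erase K \<gamma>1) + cyc_in K \<gamma>1"
    unfolding YK(1)[symmetric] using g1_perm(1) YK(2) K_high[of 0] by (intro cyc0_erase) (auto simp: Y_def)
  moreover have "cyc0 ((\<lambda>x. \<sigma> (rank X1 x)) ` X1) (red n \<pi>2 \<alpha> \<circ> \<sigma> \<circ> red k \<pi>1 \<beta> \<circ> inv \<sigma>) = cyc0 X1 (erase K \<gamma>1)"
  proof (rule intertwines_cyc0)
    show "0 \<in> X1" by (rule X1(2))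
    show "\<sigma> (rank X1 0) = 0" using Sym_0[OF s] by simp
    have "erase K \<gamma>1 permutes X1" using erase_permutes[OF g1_perm(1), of K] unfolding YK(1) by (simp add: Y_def)
    then have into: "erase K \<gamma>1 ` X1 \<subseteq> X1" by (simp add: permutes_image)
    have inj1: "inj_on (\<lambda>x. \<sigma> (rank X1 x)) X1"
      using comp_inj_on[OF inj_on_rank[OF X1(1)] inj_on_subset[OF permutes_inj[OF Sym_permutes[OF s]] subset_UNIV]]
      by (simp add: comp_def)
    have main: "(red n \<pi>2 \<alpha> \<circ> \<sigma> \<circ> red k \<pi>1 \<beta> \<circ> inv \<sigma>) (\<sigma> (rank X1 x)) = \<sigma> (rank X1 (erase K \<gamma>1 x))"
      if x: "x \<in> X1" for x
    proof -
      have y: "b1 x \<in> X1" using x by (simp add: permutes_in_image[OF b1_perm])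
      have "red k \<pi>1 \<beta> (rank X1 x) = rank X1 (b1 x)"
        unfolding b1_def D1_def bb_def by (rule red_rank[OF p1 x])
      moreover have "red n \<pi>2 \<alpha> (rank X2 (match (b1 x))) = rank X2 (a1 (match (b1 x)))"
        unfolding a1_def by (rule red_rank[OF p2 match_in[OF y]])
      ultimately have lhs: "(red n \<pi>2 \<alpha> \<circ> \<sigma> \<circ> red k \<pi>1 \<beta> \<circ> inv \<sigma>) (\<sigma> (rank X1 x)) = rank X2 (a1 (match (b1 x)))"
        by (simp add: s_inv rank_match[OF y])
      have im: "a1 (match (b1 x)) \<in> X2" using match_in[OF y] by (simp add: permutes_in_image[OF a1_perm])
      have "erase K \<gamma>1 x = match' (a1 (match (b1 x)))"
      proof (cases "b1 x = 0")
        case True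
        have "\<gamma>1 x = match' (a1 0)"
          using True im shift_emb[of k a1 0] cross_simps(4)[of "a1 0"] by (simp add: g1)
        moreover have "match' (a1 0) \<notin> K" using XK[OF match'_in[OF im]] True by simp
        ultimately show ?thesis using XK[OF x] True by (simp add: erase_step)
      next
        case False
        have g: "\<gamma>1 x = emb k (match (b1 x))"
          using False y cross_simps(3)[OF y] by (simp add: g1 shift_low X1_iff)
        have pos: "match (b1 x) \<noteq> 0" using match_pos[OF y] False by simp
        have "\<gamma>1 x \<in> K" unfolding g K_def using match_in[OF y] pos by simp
        moreover have "\<gamma>1 (\<gamma>1 x) = match' (a1 (match (b1 x)))"
          unfolding g by (rule step2[OF match_in[OF y] pos])
        ultimately show ?thesis using XK[OF x] XK[OF match'_in[OF im]] by (simp add: erase_two_steps)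
      qed
      then show ?thesis unfolding lhs by (simp add: rank_match'[OF im] s_inv)
    qed
    show "intertwines (\<lambda>x. \<sigma> (rank X1 x)) X1 (erase K \<gamma>1) (red n \<pi>2 \<alpha> \<circ> \<sigma> \<circ> red k \<pi>1 \<beta> \<circ> inv \<sigma>)"
      unfolding intertwines_def using inj1 into main by (intro conjI ballI)
  qed
  moreover have "(\<lambda>x. \<sigma> (rank X1 x)) ` X1 = {0..m}"
  proof -
    have "(\<lambda>x. \<sigma> (rank X1 x)) ` X1 = \<sigma> ` rank X1 ` X1" by (simp only: image_image)
    also have "rank X1 ` X1 = {0..m}"
      using bij_betw_rank[OF X1(1)] X1(5) by (simp only: bij_betw_def)
    finally show ?thesis by (simp only: permutes_image[OF Sym_permutes0[OF s]])
  qed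
  ultimately show ?thesis
    using \<open>cyc0 ?X \<gamma> = cyc0 Y \<gamma>1 + cyc_in (D1 \<union> D2) \<gamma>\<close> lost
    unfolding eq D1_def bb_def by simp
qed

end



context gluing
begin

lemma glue_determines:
  "\<pi>1 i = (if i \<le> k \<and> g i \<le> k then g i else i)"
  "\<pi>2 j = (if k < g (emb k j) \<and> j \<le> n then g (emb k j) - k else j)"
  "\<sigma> r = (if 0 < r \<and> r \<le> m then rank X2 (g (enum X1 r) - k) else r)"
proof -
  show "\<pi>1 i = (if i \<le> k \<and> g i \<le> k then g i else i)"
  proof (cases "\<pi>1 i = i")
    case False
    then show ?thesis using p1_range[of i] by (simp add: glue_simps(3))
  next
    case True
    show ?thesis
    proof (cases "i \<le> k")
      case le: True
      then have "i \<in> X1" using True by (simp add: X1_iff)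
      then show ?thesis using True match_pos[of i] glue_simps(1) glue_simps(4)[of i]
        by (cases "i = 0") (simp_all add: emb_def)
    qed (use True in simp)
  qed
  show "\<pi>2 j = (if k < g (emb k j) \<and> j \<le> n then g (emb k j) - k else j)"
  proof (cases "\<pi>2 j = j")
    case False
    then show ?thesis using p2_range[of j] glue_simps(5)[of j] by (simp add: emb_def)
  next
    case True
    show ?thesis
    proof (cases "j \<le> n")
      case le: True
      then have j: "j \<in> X2" using True by (simp add: X2_iff)
      then have "g (emb k j) \<le> k" using match'_in[OF j] glue_simps(6)[OF j] by (simp add: X1_iff)
      then show ?thesis using True by simp
    qed (use True in simp)
  qed
  show "\<sigma> r = (if 0 < r \<and> r \<le> m then rank X2 (g (enum X1 r) - k) else r)"
  proof (cases "0 < r \<and> r \<le> m")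
    case True
    then have r: "r < card X1" by (simp add: X1(3))
    have e: "enum X1 r \<in> X1" by (rule enum_in[OF X1(1) r])
    have re: "rank X1 (enum X1 r) = r" by (rule rank_enum[OF X1(1) r])
    then have "enum X1 r \<noteq> 0" using True by (metis less_not_refl rank_0)
    then have "g (enum X1 r) - k = match (enum X1 r)"
      using glue_simps(4)[OF e] match_pos[OF e] by (simp add: emb_def)
    then show ?thesis using True rank_match[OF e] re by simp
  next
    case False
    then have "r \<notin> {1..m}" by auto
    then show ?thesis using permutes_not_in[OF Sym_permutes[OF s]] False by metis
  qed
qed

end

text \<open>Restricting a pair partition to both sides gives \<open>\<pi>1\<close> and \<open>\<pi>2\<close>; the remaining pairs are a bijection
  between the unpaired points, read as a permutation through their numbering.\<close>

lemma gluing_surj: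
  assumes r: "\<rho> \<in> P2 (k + n)"
  shows "\<exists>\<pi>1\<in>P12 k. \<exists>\<pi>2\<in>P12 n. k - 2 * npairs \<pi>1 = n - 2 * npairs \<pi>2 \<and>
    (\<exists>\<sigma>\<in>Sym (k - 2 * npairs \<pi>1). \<rho> = glue k n \<pi>1 \<pi>2 \<sigma>)"
proof -
  have rP: "\<rho> \<in> P12 (k + n)" and nofix: "\<And>i. 0 < i \<Longrightarrow> i \<le> k + n \<Longrightarrow> \<rho> i \<noteq> i"
    using r by (auto simp: P2_def)
  note inv = P12D(2)[OF rP] and zero = P12D(3)[OF rP]
  have perm: "\<rho> permutes {1..k + n}" by (rule Sym_permutes[OF P12D(1)[OF rP]])
  have range: "0 < \<rho> i \<and> \<rho> i \<le> k + n" if "0 < i" "i \<le> k + n" for i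
    using permutes_in_image[OF perm, of i] that by auto
  have out: "\<rho> i = i" if "k + n < i" for i using permutes_not_in[OF perm, of i] that by simp
  have up: "\<rho> i \<le> k + n" if "i \<le> k + n" for i using range[of i] that zero by (cases "i = 0") simp_all
  define p where "p i = (if i \<le> k \<and> \<rho> i \<le> k then \<rho> i else i)" for i
  define t where "t j = (if 0 < j \<and> j \<le> n \<and> k < \<rho> (k + j) then \<rho> (k + j) - k else j)" for j
  have pp: "p (p i) = i" for i
  proof (cases "i \<le> k \<and> \<rho> i \<le> k")
    case False
    then have "p i = i" unfolding p_def by (rule if_not_P)
    then show ?thesis by simp
  qed (simp add: p_def inv)
  have p: "p \<in> P12 k"
  proof -
    have "p \<in> Sym k"
    proof (rule involution_Sym[OF pp])
      show "p i = i" if "i \<notin> {1..k}" for i using that zero by (cases "i = 0") (auto simp: p_def)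
    qed
    then show ?thesis using pp by (simp add: P12_def fun_eq_iff)
  qed
  have tt: "t (t j) = j" for j
  proof (cases "0 < j \<and> j \<le> n \<and> k < \<rho> (k + j)")
    case True
    then have "t j = \<rho> (k + j) - k" "k + t j = \<rho> (k + j)" by (simp_all add: t_def)
    moreover have "\<rho> (k + j) \<le> k + n" using True range[of "k + j"] by simp
    ultimately show ?thesis using True by (auto simp: t_def inv)
  next
    case False
    then have "t j = j" unfolding t_def by (rule if_not_P)
    then show ?thesis by simp
  qed
  have t: "t \<in> P12 n"
  proof -
    have "t \<in> Sym n" by (rule involution_Sym[OF tt]) (auto simp: t_def)
    then show ?thesis using tt by (simp add: P12_def fun_eq_iff)
  qed
  have mem1: "i \<in> rest k p \<longleftrightarrow> i = 0 \<or> (i \<le> k \<and> k < \<rho> i)" for i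
    using nofix[of i] zero by (cases "i = 0") (auto simp: rest_def psupp_def p_def)
  have mem2: "j \<in> rest n t \<longleftrightarrow> j = 0 \<or> (j \<le> n \<and> \<rho> (k + j) \<le> k)" for j
    using nofix[of "k + j"] by (cases "j = 0") (auto simp: rest_def psupp_def t_def)
  have bij: "bij_betw (\<lambda>i. \<rho> i - k) (rest k p) (rest n t)"
  proof (rule bij_betw_byWitness[where f' = "\<lambda>j. \<rho> (emb k j)"])
    show "\<forall>i\<in>rest k p. \<rho> (emb k (\<rho> i - k)) = i"
      using zero inv by (auto simp: mem1 emb_def)
    show "\<forall>j\<in>rest n t. \<rho> (\<rho> (emb k j)) - k = j"
      using zero inv by (auto simp: mem2 emb_def) 
    show "(\<lambda>i. \<rho> i - k) ` rest k p \<subseteq> rest n t"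
    proof (rule image_subsetI)
      fix i assume i: "i \<in> rest k p"
      then have "\<rho> i \<le> k + n" using mem1 by (intro up) auto
      then show "\<rho> i - k \<in> rest n t" using i zero by (auto simp: mem1 mem2 inv)
    qed
    show "(\<lambda>j. \<rho> (emb k j)) ` rest n t \<subseteq> rest k p"
      using zero inv by (auto simp: mem1 mem2 emb_def)
  qed
  then have "card (rest k p) = card (rest n t)" by (rule bij_betw_same_card)
  then have eq: "k - 2 * npairs p = n - 2 * npairs t" by (simp add: rest_simps(3) p t)
  define m where "m = k - 2 * npairs p"
  have cards: "{..<card (rest k p)} = {0..m}" "{..<card (rest n t)} = {0..m}"
    using rest_simps(5)[OF p] rest_simps(5)[OF t] eq by (simp_all only: m_def)
  define s where "s r = (if r \<le> m then rank (rest n t) (\<rho> (enum (rest k p) r) - k) else r)" for r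
  have s: "s \<in> Sym m"
  proof (rule SymI0)
    have "bij_betw (rank (rest n t) \<circ> ((\<lambda>i. \<rho> i - k) \<circ> enum (rest k p))) {0..m} {0..m}"
      using bij_betw_enum[OF rest_simps(1)[OF p]] bij bij_betw_rank[OF rest_simps(1)[OF t]]
      unfolding cards by (meson bij_betw_trans)
    then have "bij_betw s {0..m} {0..m}"
      by (rule iffD1[OF bij_betw_cong, rotated]) (simp add: s_def)
    then show "s permutes {0..m}" by (rule bij_imp_permutes) (simp add: s_def)
    show "s 0 = 0"
      using enum_rank[OF rest_simps(1,2)[OF p]] zero by (simp add: s_def)
  qed
  interpret gluing k n m p t s
    by unfold_locales (use p t s eq in \<open>simp_all add: m_def\<close>)
  have match: "match i = \<rho> i - k" if i: "i \<in> rest k p" for i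
  proof -
    have "\<rho> i - k \<in> rest n t" using bij i by (metis bij_betwE)
    then have "match i = enum (rest n t) (rank (rest n t) (\<rho> i - k))"
      using rank1[OF i] enum_rank[OF rest_simps(1)[OF p] i] by (simp add: match_def s_def)
    also have "\<dots> = \<rho> i - k" by (rule enum_rank[OF rest_simps(1)[OF t]]) fact
    finally show ?thesis .
  qed
  have "\<rho> = glue k n p t s"
  proof
    fix i
    show "\<rho> i = glue k n p t s i"
    proof (cases i rule: glue_cases)
      case supp1
      then show ?thesis using glue_simps(3)[OF supp1] by (auto simp: p_def split: if_splits)
    next
      case rest1
      then show ?thesis
        using glue_simps(4)[OF rest1(1)] match[OF rest1(1)] mem1[of i] by (simp add: emb_def)
    next
      case (supp2 j)
      then show ?thesis using glue_simps(5)[OF supp2(2)] by (auto simp: t_def emb_def split: if_splits)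
    next
      case (rest2 j)
      have mem: "\<rho> i \<in> rest k p" using rest2 mem1 mem2[of j] inv[of "k + j"] by (auto simp: emb_def)
      have "match (\<rho> i) = j" using match[OF mem] inv[of i] rest2 by (simp add: emb_def)
      then have "match' j = \<rho> i" using match'_match[OF mem] by simp
      then show ?thesis using rest2(1) glue_simps(6)[OF rest2(2)] by simp
    qed (use zero out glue_simps in simp_all)
  qed
  then show ?thesis using p t eq s unfolding m_def by blast
qed

lemma finite_Sym: "finite (Sym n)"
  unfolding Sym_def by (rule finite_permutations) simp

lemma finite_P12: "finite (P12 n)"
  by (rule finite_subset[OF _ finite_Sym[of n]]) (auto simp: P12_def)

lemma sum_P2_glue:
  fixes f :: "(nat \<Rightarrow> nat) \<Rightarrow> 'a::comm_monoid_add"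
  shows "(\<Sum>\<rho>\<in>P2 (k + n). f \<rho>) = (\<Sum>\<pi>1\<in>P12 k. \<Sum>\<pi>2\<in>P12 n.
    if k - 2 * npairs \<pi>1 = n - 2 * npairs \<pi>2
    then \<Sum>\<sigma>\<in>Sym (k - 2 * npairs \<pi>1). f (glue k n \<pi>1 \<pi>2 \<sigma>) else 0)"
proof -
  define S where "S \<pi>1 \<pi>2 = (if k - 2 * npairs \<pi>1 = n - 2 * npairs \<pi>2
    then Sym (k - 2 * npairs \<pi>1) else {})" for \<pi>1 \<pi>2
  define Z where "Z = (SIGMA p:(P12 k \<times> P12 n). S (fst p) (snd p))"
  define G where "G z = glue k n (fst (fst z)) (snd (fst z)) (snd z)" for z
  have g: "gluing k n (k - 2 * npairs (fst (fst z))) (fst (fst z)) (snd (fst z)) (snd z)" if "z \<in> Z" for z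
    using that by (auto simp: Z_def S_def gluing_def split: if_splits)
  have "inj_on G Z"
  proof (rule inj_onI)
    fix y z assume yz: "y \<in> Z" "z \<in> Z" and eq: "G y = G z"
    note dy = gluing.glue_determines[OF g[OF yz(1)], folded G_def]
      and dz = gluing.glue_determines[OF g[OF yz(2)], folded G_def]
    have 1: "fst (fst y) = fst (fst z)" by (rule ext) (simp only: dy(1) dz(1) eq)
    have 2: "snd (fst y) = snd (fst z)" by (rule ext) (simp only: dy(2) dz(2) eq)
    have "snd y = snd z" by (rule ext) (simp only: dy(3) dz(3) eq 1 2)
    then show "y = z" using 1 2 by (simp add: prod_eq_iff)
  qed
  moreover have "G ` Z = P2 (k + n)"
  proof (intro equalityI subsetI)
    fix \<rho> assume "\<rho> \<in> G ` Z"
    then obtain z where z: "z \<in> Z" "\<rho> = G z" by blast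
    show "\<rho> \<in> P2 (k + n)" unfolding z(2) G_def by (rule gluing.glue_P2[OF g[OF z(1)]])
  next
    fix \<rho> assume "\<rho> \<in> P2 (k + n)"
    then obtain \<pi>1 \<pi>2 \<sigma> where "\<pi>1 \<in> P12 k" "\<pi>2 \<in> P12 n"
      "k - 2 * npairs \<pi>1 = n - 2 * npairs \<pi>2" "\<sigma> \<in> Sym (k - 2 * npairs \<pi>1)"
      "\<rho> = glue k n \<pi>1 \<pi>2 \<sigma>" using gluing_surj by blast
    then have "((\<pi>1, \<pi>2), \<sigma>) \<in> Z" "\<rho> = G ((\<pi>1, \<pi>2), \<sigma>)" by (simp_all add: Z_def S_def G_def)
    then show "\<rho> \<in> G ` Z" by blast
  qed
  ultimately have "bij_betw G Z (P2 (k + n))" by (simp add: bij_betw_def)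
  then have "(\<Sum>\<rho>\<in>P2 (k + n). f \<rho>) = (\<Sum>z\<in>Z. f (G z))" by (rule sum.reindex_bij_betw[symmetric])
  also have "\<dots> = (\<Sum>p\<in>P12 k \<times> P12 n. \<Sum>\<sigma>\<in>S (fst p) (snd p). f (glue k n (fst p) (snd p) \<sigma>))"
    unfolding Z_def G_def
    by (subst sum.Sigma) (auto simp: finite_P12 finite_Sym S_def case_prod_beta)
  also have "\<dots> = (\<Sum>\<pi>1\<in>P12 k. \<Sum>\<pi>2\<in>P12 n. \<Sum>\<sigma>\<in>S \<pi>1 \<pi>2. f (glue k n \<pi>1 \<pi>2 \<sigma>))"
    by (simp add: sum.cartesian_product case_prod_beta)
  finally show ?thesis by (simp add: S_def if_distrib[of "sum _"] cong: if_cong)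
qed

lemma (in gluing) prod_glue:
  fixes F :: "nat \<Rightarrow> nat \<Rightarrow> 'a::comm_monoid_mult"
  shows "(\<Prod>i | i < g i. F i (g i)) =
    (\<Prod>i | i < \<pi>1 i. F i (\<pi>1 i)) * (\<Prod>j | j < \<pi>2 j. F (emb k j) (emb k (\<pi>2 j)))
      * (\<Prod>r\<in>{1..m}. F (enum X1 (inv \<sigma> r)) (emb k (enum X2 r)))"
proof -
  define L where "L = {i. i < \<pi>1 i}"
  define R where "R = {j. j < \<pi>2 j}"
  define M where "M = X1 - {0}"
  have L: "\<pi>1 i \<noteq> i" "i < \<pi>1 i" "g i = \<pi>1 i" "i \<le> k" if "i \<in> L" for i
    using that p1_range[of i] glue_simps(3)[of i] by (simp_all add: L_def)
  have R: "\<pi>2 j \<noteq> j" "j < \<pi>2 j" "g (emb k j) = emb k (\<pi>2 j)" "0 < j" if "j \<in> R" for j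
    using that p2_range[of j] glue_simps(5)[of j] by (simp_all add: R_def)
  have M: "i \<le> k" "\<pi>1 i = i" "g i = emb k (match i)" "k < emb k (match i)" "0 < i" "i \<in> X1" if "i \<in> M" for i
    using that match_pos[of i] glue_simps(4)[of i] by (auto simp: M_def X1_iff emb_def)
  have fin: "finite L" "finite R" "finite M"
  proof -
    show "finite L" by (rule finite_subset[of _ "{..k}"]) (use L in auto)
    show "finite R" by (rule finite_subset[OF _ P12D(5)[OF p2]]) (auto simp: R_def psupp_def)
    show "finite M" using X1(1) by (simp add: M_def)
  qed
  have set: "{i. i < g i} = (L \<union> emb k ` R) \<union> M"
  proof (intro equalityI subsetI)
    fix i assume "i \<in> {i. i < g i}"
    then have i: "i < g i" by simp
    show "i \<in> (L \<union> emb k ` R) \<union> M"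
    proof (cases i rule: glue_cases)
      case supp1
      then show ?thesis using i glue_simps(3) by (simp add: L_def)
    next
      case rest1
      then show ?thesis by (simp add: M_def)
    next
      case (supp2 j)
      then have "j < \<pi>2 j" using i glue_simps(5)[OF supp2(2)] p2_range[of j] by (simp add: emb_def)
      then show ?thesis using supp2 by (simp add: R_def)
    next
      case (rest2 j)
      then have "g i \<le> k" "k < i"
        using match'_in[OF rest2(2)] glue_simps(6)[OF rest2(2)] by (simp_all add: X1_iff emb_def)
      then show ?thesis using i by simp
    qed (use i glue_simps in auto)
  next
    fix i assume i: "i \<in> (L \<union> emb k ` R) \<union> M"
    show "i \<in> {i. i < g i}"
    proof (cases "i \<in> emb k ` R")
      case True
      then obtain j where "i = emb k j" "j \<in> R" by blast
      then show ?thesis using R[of j] by (simp add: emb_def)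
    next
      case False
      then show ?thesis using i L[of i] M[of i] by auto
    qed
  qed
  have disj: "L \<inter> emb k ` R = {}" "(L \<union> emb k ` R) \<inter> M = {}"
  proof -
    have "\<not> emb k j \<le> k" if "j \<in> R" for j using R(4)[OF that] by simp
    then have A: "i \<notin> emb k ` R" if "i \<le> k" for i using that by blast
    have B: "i \<notin> L" if "i \<in> M" for i using L(1)[of i] M(2)[OF that] by blast
    show "L \<inter> emb k ` R = {}" using A L(4) by blast
    show "(L \<union> emb k ` R) \<inter> M = {}" using A B M(1) by blast
  qed
  have "(\<Prod>i | i < g i. F i (g i)) = (\<Prod>i\<in>L. F i (g i)) * (\<Prod>i\<in>emb k ` R. F i (g i)) * (\<Prod>i\<in>M. F i (g i))"
    unfolding set using fin disj by (simp add: prod.union_disjoint)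
  also have "(\<Prod>i\<in>L. F i (g i)) = (\<Prod>i\<in>L. F i (\<pi>1 i))" by (rule prod.cong) (simp_all add: L(3))
  also have "(\<Prod>i\<in>emb k ` R. F i (g i)) = (\<Prod>j\<in>R. F (emb k j) (emb k (\<pi>2 j)))"
    by (subst prod.reindex[OF inj_emb]) (simp add: R(3))
  also have "(\<Prod>i\<in>M. F i (g i)) = (\<Prod>i\<in>M. F i (emb k (match i)))" by (rule prod.cong) (simp_all add: M(3))
  also have "\<dots> = (\<Prod>r\<in>{1..m}. F (enum X1 (inv \<sigma> r)) (emb k (enum X2 r)))"
  proof (rule prod.reindex_bij_witness[where i = "\<lambda>r. enum X1 (inv \<sigma> r)" and j = "\<lambda>i. \<sigma> (rank X1 i)"])
    fix i assume i: "i \<in> M"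
    show "enum X1 (inv \<sigma> (\<sigma> (rank X1 i))) = i" by (simp add: s_inv enum_rank[OF X1(1) M(6)[OF i]])
    have "rank X1 i \<noteq> 0"
      using enum_rank[OF X1(1) M(6)[OF i]] enum_rank[OF X1(1,2)] M(5)[OF i] by (metis less_not_refl rank_0)
    then have "\<sigma> (rank X1 i) \<noteq> 0" using s_inv(2)[of "rank X1 i"] Sym_0[OF Sym_inv[OF s]] by metis
    then show "\<sigma> (rank X1 i) \<in> {1..m}" using rank1[OF M(6)[OF i]] s_le by simp
    show "F (enum X1 (inv \<sigma> (\<sigma> (rank X1 i)))) (emb k (enum X2 (\<sigma> (rank X1 i)))) = F i (emb k (match i))"
      by (simp add: s_inv enum_rank[OF X1(1) M(6)[OF i]] match_def)
  next
    fix r assume r: "r \<in> {1..m}"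
    then have lt: "inv \<sigma> r < card X1" by (simp add: X1(3) s_le less_Suc_eq_le)
    show "\<sigma> (rank X1 (enum X1 (inv \<sigma> r))) = r" by (simp add: rank_enum[OF X1(1) lt] s_inv)
    then have "enum X1 (inv \<sigma> r) \<noteq> 0" using r Sym_0[OF s] by (metis One_nat_def atLeastAtMost_iff not_less_eq_eq rank_0 zero_le)
    then show "enum X1 (inv \<sigma> r) \<in> M" using enum_in[OF X1(1) lt] by (simp add: M_def)
  qed
  finally show ?thesis by (simp add: L_def R_def)
qed

text \<open>The order of the two elements of a pair may change under \<open>\<sigma>\<close>, hence the symmetry of \<open>F\<close>.\<close>

lemma prod_pairs_conj:
  fixes F :: "nat \<Rightarrow> nat \<Rightarrow> 'a::comm_monoid_mult"
  assumes s: "\<sigma> \<in> Sym n" and p: "\<pi> \<in> P12 n" and sym: "\<And>i j. F i j = F j i"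
  shows "(\<Prod>i | i < (\<sigma> \<circ> \<pi> \<circ> inv \<sigma>) i. F i ((\<sigma> \<circ> \<pi> \<circ> inv \<sigma>) i)) = (\<Prod>i | i < \<pi> i. F (\<sigma> i) (\<sigma> (\<pi> i)))"
proof -
  note inv = permutes_inverses[OF Sym_permutes[OF s]]
  note pp = P12D(2)[OF p]
  have seq: "\<sigma> x = \<sigma> y \<longleftrightarrow> x = y" "inv \<sigma> x = inv \<sigma> y \<longleftrightarrow> x = y" for x y using inv by metis+
  show ?thesis
  proof (rule prod.reindex_bij_witness[where
      i = "\<lambda>i. if \<sigma> i < \<sigma> (\<pi> i) then \<sigma> i else \<sigma> (\<pi> i)" and
      j = "\<lambda>j. if inv \<sigma> j < \<pi> (inv \<sigma> j) then inv \<sigma> j else \<pi> (inv \<sigma> j)"])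
    fix a assume a: "a \<in> {i. i < (\<sigma> \<circ> \<pi> \<circ> inv \<sigma>) i}"
    let ?x = "inv \<sigma> a"
    have x: "\<sigma> ?x < \<sigma> (\<pi> ?x)" "?x \<noteq> \<pi> ?x" using a by (auto simp: inv)
    show "(if \<sigma> (if ?x < \<pi> ?x then ?x else \<pi> ?x) < \<sigma> (\<pi> (if ?x < \<pi> ?x then ?x else \<pi> ?x))
        then \<sigma> (if ?x < \<pi> ?x then ?x else \<pi> ?x) else \<sigma> (\<pi> (if ?x < \<pi> ?x then ?x else \<pi> ?x))) = a"
      using x by (simp add: pp inv)
    show "(if ?x < \<pi> ?x then ?x else \<pi> ?x) \<in> {i. i < \<pi> i}" using x by (simp add: pp)
    show "F (\<sigma> (if ?x < \<pi> ?x then ?x else \<pi> ?x)) (\<sigma> (\<pi> (if ?x < \<pi> ?x then ?x else \<pi> ?x)))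
        = F a ((\<sigma> \<circ> \<pi> \<circ> inv \<sigma>) a)"
      using x sym[of a "\<sigma> (\<pi> ?x)"] by (simp add: pp inv)
  next
    fix b assume b: "b \<in> {i. i < \<pi> i}"
    then have "\<sigma> b \<noteq> \<sigma> (\<pi> b)" by (auto simp: seq)
    let ?y = "if \<sigma> b < \<sigma> (\<pi> b) then \<sigma> b else \<sigma> (\<pi> b)"
    show "(if inv \<sigma> ?y < \<pi> (inv \<sigma> ?y) then inv \<sigma> ?y else \<pi> (inv \<sigma> ?y)) = b"
      using b by (simp add: pp inv)
    show "?y \<in> {i. i < (\<sigma> \<circ> \<pi> \<circ> inv \<sigma>) i}" using \<open>\<sigma> b \<noteq> \<sigma> (\<pi> b)\<close> by (simp add: pp inv)
  qed
qed



section \<open>Tensors\<close>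

text \<open>Tensor positions start at \<open>1\<close>, list positions at \<open>0\<close>; writing lists as \<open>[h 1, \<dots>, h n]\<close> turns the
  operations on tensors into operations on index functions.\<close>

definition tab :: "nat \<Rightarrow> (nat \<Rightarrow> 'a) \<Rightarrow> 'a list" where
  "tab n h = map h [1..<Suc n]"

lemma length_tab [simp]: "length (tab n h) = n"
  by (simp add: tab_def del: upt_Suc)

lemma tab_nth [simp]: "i < n \<Longrightarrow> tab n h ! i = h (Suc i)"
  by (simp add: tab_def del: upt_Suc)

lemma tab_nth_pred: "i \<in> {1..n} \<Longrightarrow> tab n h ! (i - 1) = h i"
  by (cases i) simp_all

lemma tab_cong: "(\<And>i. 1 \<le> i \<Longrightarrow> i \<le> n \<Longrightarrow> h i = h' i) \<Longrightarrow> tab n h = tab n h'"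
  by (rule nth_equalityI) simp_all

lemma list_eq_tab: "length hs = n \<Longrightarrow> hs = tab n (\<lambda>i. hs ! (i - 1))"
  by (rule nth_equalityI) simp_all

lemma tab_0 [simp]: "tab 0 h = []"
  by (simp add: tab_def)

lemma tens_tab_tpow: "tens (tab n h) \<in> tpow n"
  unfolding tpow_def by (rule span_base) simp

lemma tpow_lin:
  fixes F G :: "'h::real_vector tensor"
  shows "F \<in> tpow n \<Longrightarrow> G \<in> tpow n \<Longrightarrow> a *\<^sub>R F + b *\<^sub>R G \<in> tpow n"
  unfolding tpow_def by (intro span_add span_scale)

lemma tpow_induct [consumes 1, case_names tens lin]:
  fixes F :: "'h::real_vector tensor"
  assumes F: "F \<in> tpow n"
    and tens: "\<And>h. P (tens (tab n h))"
    and lin: "\<And>a b F G. F \<in> tpow n \<Longrightarrow> G \<in> tpow n \<Longrightarrow> P F \<Longrightarrow> P G \<Longrightarrow> P (a *\<^sub>R F + b *\<^sub>R G)"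
  shows "P F"
proof -
  have "F \<in> span (tens ` {hs. length hs = n})" using F by (simp add: tpow_def)
  then have "F \<in> tpow n \<and> P F"
  proof (induction rule: span_induct_alt)
    case base
    have "P (0 *\<^sub>R tens (tab n (\<lambda>_. 0)) + 0 *\<^sub>R tens (tab n (\<lambda>_. 0)))"
      by (intro lin tens_tab_tpow tens)
    then show ?case by (simp add: tpow_def span_zero)
  next
    case (step c x y)
    then obtain hs where "x = tens hs" "length hs = n" by blast
    then have x: "x = tens (tab n (\<lambda>i. hs ! (i - 1)))" using list_eq_tab by metis
    have "P (c *\<^sub>R x + 1 *\<^sub>R y)" "c *\<^sub>R x + 1 *\<^sub>R y \<in> tpow n"
      using step.IH unfolding x by (blast intro: lin tens tpow_lin tens_tab_tpow)+
    then show ?case by simp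
  qed
  then show ?thesis by simp
qed

lemma tensor_eqI:
  assumes L: "linear L" and M: "linear M" and eq: "\<And>hs. L (tens hs) = M (tens hs)"
  shows "L F = M F"
proof -
  define g where "g hs = L (tens hs)" for hs
  have g: "multilinear g"
    unfolding multilinear_def g_def tens_multilinear linear_add[OF L] linear_scale[OF L] by (intro allI refl)
  have "tens_lift g = L"
    unfolding tens_lift_def by (rule the1_equality[OF tens_lift_ex1[OF g]]) (simp add: L g_def)
  moreover have "tens_lift g = M"
    unfolding tens_lift_def by (rule the1_equality[OF tens_lift_ex1[OF g]]) (simp add: M g_def eq)
  ultimately show ?thesis by simp
qed

lemma bilinear_extension:
  fixes g :: "'h::real_vector list \<Rightarrow> 'h list \<Rightarrow> 'v::real_vector"
  assumes m1: "\<And>gs. multilinear (\<lambda>hs. g hs gs)" and m2: "\<And>hs. multilinear (g hs)"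
  defines "B \<equiv> \<lambda>F G. tens_lift (\<lambda>hs. tens_lift (g hs) G) F"
  shows "linear (\<lambda>F. B F G)" "linear (B F)" "B (tens hs) (tens gs) = g hs gs"
proof -
  note l2 = tens_lift[OF m2]
  have ml: "multilinear (\<lambda>hs. tens_lift (g hs) G)" for G
    unfolding multilinear_def
  proof (intro allI)
    fix xs u v ys a b
    show "tens_lift (g (xs @ (a *\<^sub>R u + b *\<^sub>R v) # ys)) G =
        a *\<^sub>R tens_lift (g (xs @ u # ys)) G + b *\<^sub>R tens_lift (g (xs @ v # ys)) G"
    proof (rule tensor_eqI[OF l2(1)])
      show "linear (\<lambda>G. a *\<^sub>R tens_lift (g (xs @ u # ys)) G + b *\<^sub>R tens_lift (g (xs @ v # ys)) G)"
        by (intro linear_compose_add linear_compose_scale_right l2(1))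
      fix gs show "tens_lift (g (xs @ (a *\<^sub>R u + b *\<^sub>R v) # ys)) (tens gs) =
        a *\<^sub>R tens_lift (g (xs @ u # ys)) (tens gs) + b *\<^sub>R tens_lift (g (xs @ v # ys)) (tens gs)"
        using m1[of gs] by (simp add: l2(2) multilinear_def)
    qed
  qed
  note l1 = tens_lift[OF ml]
  show lin1: "linear (\<lambda>F. B F G)" for G unfolding B_def by (rule l1(1))
  show "B (tens hs) (tens gs) = g hs gs" by (simp add: B_def l1(2) l2(2))
  have val: "B (tens hs) G = tens_lift (g hs) G" for hs G by (simp add: B_def l1(2))
  show "linear (B F)"
  proof (rule linearI)
    fix G G' show "B F (G + G') = B F G + B F G'"
    proof (rule tensor_eqI[OF lin1])
      show "linear (\<lambda>F. B F G + B F G')" by (intro linear_compose_add lin1)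
      show "B (tens hs) (G + G') = B (tens hs) G + B (tens hs) G'" for hs
        unfolding val by (rule linear_add[OF l2(1)])
    qed
  next
    fix c G show "B F (c *\<^sub>R G) = c *\<^sub>R B F G"
    proof (rule tensor_eqI[OF lin1])
      show "linear (\<lambda>F. c *\<^sub>R B F G)" by (intro linear_compose_scale_right lin1)
      show "B (tens hs) (c *\<^sub>R G) = c *\<^sub>R B (tens hs) G" for hs
        unfolding val by (rule linear_scale[OF l2(1)])
    qed
  qed
qed

text \<open>A function of \<open>n\<close> vectors \<open>h 1, \<dots>, h n\<close> that is linear in each of them defines a linear map
  on tensors that vanishes outside degree \<open>n\<close>.\<close>

lemma multilinearI:
  fixes K :: "(nat \<Rightarrow> 'h::real_vector) \<Rightarrow> 'v::real_vector"
  assumes slot: "\<And>p h u v a b. p \<in> {1..n} \<Longrightarrow>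
      K (h(p := a *\<^sub>R u + b *\<^sub>R v)) = a *\<^sub>R K (h(p := u)) + b *\<^sub>R K (h(p := v))"
    and cong: "\<And>h h'. (\<And>i. i \<in> {1..n} \<Longrightarrow> h i = h' i) \<Longrightarrow> K h = K h'"
  shows "multilinear (\<lambda>hs. if length hs = n then K (\<lambda>i. hs ! (i - 1)) else 0)"
  unfolding multilinear_def
proof (intro allI)
  fix xs ys :: "'h list" and u v :: 'h and a b :: real
  let ?G = "\<lambda>hs. if length hs = n then K (\<lambda>i. hs ! (i - 1)) else 0"
  show "?G (xs @ (a *\<^sub>R u + b *\<^sub>R v) # ys) = a *\<^sub>R ?G (xs @ u # ys) + b *\<^sub>R ?G (xs @ v # ys)"
  proof (cases "Suc (length xs + length ys) = n")
    case True
    define p where "p = Suc (length xs)"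
    define h where "h i = (xs @ u # ys) ! (i - 1)" for i
    have "K (\<lambda>i. (xs @ w # ys) ! (i - 1)) = K (h(p := w))" for w
      by (rule cong) (auto simp: h_def p_def nth_append nth_Cons')
    moreover have "p \<in> {1..n}" using True by (simp add: p_def)
    ultimately show ?thesis using True slot[of p h a u b v] by simp
  qed simp
qed

lemma multilinear_tens_append: "multilinear (\<lambda>gs. tens (hs @ gs))" "multilinear (\<lambda>hs. tens (hs @ gs))"
proof -
  show "multilinear (\<lambda>gs. tens (hs @ gs))"
    unfolding multilinear_def append_assoc[symmetric] tens_multilinear by simp
  show "multilinear (\<lambda>hs. tens (hs @ gs))"
    unfolding multilinear_def append_assoc append_Cons tens_multilinear by simp
qed

lemma tens_prod:
  fixes F G :: "'h::real_vector tensor"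
  shows "linear (\<lambda>F. tens_prod F G)" "linear (tens_prod F)"
    "tens_prod (tens hs) (tens gs) = (tens (hs @ gs) :: 'h tensor)"
  using bilinear_extension[of "\<lambda>hs gs. tens (hs @ gs) :: 'h tensor"] multilinear_tens_append
  unfolding tens_prod_def[abs_def] by auto

lemma tens_prod_tab:
  "tens_prod (tens (tab k g)) (tens (tab n h)) = tens (tab (k + n) (\<lambda>i. if i \<le> k then g i else h (i - k)))"
proof -
  have "tab k g @ tab n h = tab (k + n) (\<lambda>i. if i \<le> k then g i else h (i - k))"
    by (rule nth_equalityI) (auto simp: nth_append Suc_diff_le)
  then show ?thesis by (simp add: tens_prod(3))
qed

lemma tens_prod_lin:
  "tens_prod (a *\<^sub>R F + b *\<^sub>R F') G = a *\<^sub>R tens_prod F G + b *\<^sub>R tens_prod F' G"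
  "tens_prod F (a *\<^sub>R G + b *\<^sub>R G') = a *\<^sub>R tens_prod F G + b *\<^sub>R tens_prod F G'"
  by (simp_all add: linear_add[OF tens_prod(1)] linear_scale[OF tens_prod(1)]
    linear_add[OF tens_prod(2)] linear_scale[OF tens_prod(2)])

lemma tens_prod_tpow:
  assumes "F \<in> tpow k" "G \<in> tpow n" shows "tens_prod F G \<in> tpow (k + n)"
  using assms(1)
proof (induction rule: tpow_induct)
  case (tens h)
  show ?case using assms(2)
    by (induction rule: tpow_induct) (simp_all add: tens_prod_tab tens_tab_tpow tens_prod_lin tpow_lin)
qed (simp add: tens_prod_lin tpow_lin)

lemma multilinear_inner:
  "multilinear (\<lambda>hs. if length hs = length gs then \<Prod>i<length hs. hs ! i \<bullet> gs ! i else (0::real))"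
proof -
  define K where "K h = (\<Prod>i<length gs. h (Suc i) \<bullet> gs ! i)" for h :: "nat \<Rightarrow> 'a"
  have "multilinear (\<lambda>hs. if length hs = length gs then K (\<lambda>i. hs ! (i - 1)) else 0)"
  proof (rule multilinearI)
    fix p h and u v :: 'a and a b :: real assume "p \<in> {1..length gs}"
    then obtain r where r: "p = Suc r" "r < length gs" by (cases p) auto
    have "K (h(p := w)) = (w \<bullet> gs ! r) * (\<Prod>i\<in>{..<length gs} - {r}. h (Suc i) \<bullet> gs ! i)" for w
      unfolding K_def using r by (subst prod.remove[of _ r]) (auto intro!: prod.cong)
    then show "K (h(p := a *\<^sub>R u + b *\<^sub>R v)) = a *\<^sub>R K (h(p := u)) + b *\<^sub>R K (h(p := v))"
      by (simp add: inner_add_left algebra_simps)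
  qed (simp add: K_def)
  then show ?thesis unfolding K_def by (simp cong: if_cong)
qed

lemma tens_inner:
  fixes F G :: "'h::real_inner tensor"
  shows "linear (\<lambda>F. tens_inner F G)" "linear (tens_inner F)"
    "tens_inner (tens hs) (tens gs :: 'h tensor) =
      (if length hs = length gs then \<Prod>i<length hs. hs ! i \<bullet> gs ! i else 0)"
proof -
  have sym: "(\<lambda>gs. if length hs = length gs then \<Prod>i<length hs. hs ! i \<bullet> gs ! i else 0) =
    (\<lambda>gs. if length gs = length hs then \<Prod>i<length gs. gs ! i \<bullet> hs ! i else 0)" for hs :: "'h list"
    by (auto simp: fun_eq_iff inner_commute)
  note B = bilinear_extension[of "\<lambda>hs gs :: 'h list. if length hs = length gs then \<Prod>i<length hs. hs ! i \<bullet> gs ! i else 0",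
      OF multilinear_inner, unfolded sym, OF multilinear_inner, folded sym]
  show "linear (\<lambda>F. tens_inner F G)" "linear (tens_inner F)" "tens_inner (tens hs) (tens gs :: 'h tensor) =
      (if length hs = length gs then \<Prod>i<length hs. hs ! i \<bullet> gs ! i else 0)"
    unfolding tens_inner_def[abs_def] by (rule B)+
qed

lemma tens_inner_tab: "tens_inner (tens (tab n h)) (tens (tab n g)) = (\<Prod>i\<in>{1..n}. h i \<bullet> g i)"
proof -
  have "tens_inner (tens (tab n h)) (tens (tab n g)) = (\<Prod>i<n. h (Suc i) \<bullet> g (Suc i))"
    by (simp add: tens_inner(3))
  also have "\<dots> = (\<Prod>i\<in>{1..n}. h i \<bullet> g i)"
    by (rule prod.reindex_bij_witness[of _ "\<lambda>i. i - 1" Suc]) auto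
  finally show ?thesis .
qed

lemma tens_inner_lin:
  "tens_inner (a *\<^sub>R F + b *\<^sub>R F') G = a * tens_inner F G + b * tens_inner F' G"
  "tens_inner F (a *\<^sub>R G + b *\<^sub>R G') = a * tens_inner F G + b * tens_inner F G'"
  by (simp_all add: linear_add[OF tens_inner(1)] linear_scale[OF tens_inner(1)]
    linear_add[OF tens_inner(2)] linear_scale[OF tens_inner(2)])

lemma linear_Uperm:
  assumes "\<sigma> \<in> Sym n" shows "linear (Uperm n \<sigma> :: 'h::real_vector tensor \<Rightarrow> _)"
  unfolding Uperm_def by (rule tens_lift(1)[OF multilinear_Uperm[OF assms]])

lemma Uperm_tab:
  assumes "\<sigma> \<in> Sym n"
  shows "Uperm n \<sigma> (tens (tab n h)) = tens (tab n (h \<circ> inv \<sigma>))"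
proof -
  have "Uperm n \<sigma> (tens (tab n h)) = tens (map (\<lambda>i. tab n h ! (inv \<sigma> i - 1)) [1..<Suc n])"
    unfolding Uperm_def by (subst tens_lift(2)[OF multilinear_Uperm[OF assms]]) simp
  also have "map (\<lambda>i. tab n h ! (inv \<sigma> i - 1)) [1..<Suc n] = tab n (h \<circ> inv \<sigma>)"
    unfolding tab_def[of n "h \<circ> inv \<sigma>"]
  proof (rule map_cong[OF refl])
    fix i assume "i \<in> set [1..<Suc n]"
    then have "i \<in> {1..n}" by (simp only: set_upt atLeastLessThanSuc_atLeastAtMost)
    then have "inv \<sigma> i \<in> {1..n}"
      using permutes_in_image[OF permutes_inv[OF Sym_permutes[OF assms]], of i] by blast
    then show "tab n h ! (inv \<sigma> i - 1) = (h \<circ> inv \<sigma>) i" by (simp only: tab_nth_pred comp_apply)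
  qed
  finally show ?thesis .
qed

lemma Uperm_lin:
  assumes "\<sigma> \<in> Sym n"
  shows "Uperm n \<sigma> (a *\<^sub>R F + b *\<^sub>R G) = a *\<^sub>R Uperm n \<sigma> F + b *\<^sub>R Uperm n \<sigma> G"
  by (simp add: linear_add[OF linear_Uperm[OF assms]] linear_scale[OF linear_Uperm[OF assms]])

lemma multilinear_contr:
  fixes \<pi> :: "nat \<Rightarrow> nat"
  assumes p: "\<pi> \<in> P12 n"
  shows "multilinear (\<lambda>hs :: 'h::real_inner list. if length hs = n
     then (\<Prod>i | i < \<pi> i. hs ! (i - 1) \<bullet> hs ! (\<pi> i - 1)) *\<^sub>R
            tens (map (\<lambda>i. hs ! (i - 1)) (filter (\<lambda>i. \<pi> i = i) [1..<Suc n])) else 0)"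
proof -
  define L where "L = filter (\<lambda>i. \<pi> i = i) [1..<Suc n]"
  define K where "K h = (\<Prod>i | i < \<pi> i. h i \<bullet> h (\<pi> i)) *\<^sub>R tens (map h L)" for h :: "nat \<Rightarrow> 'h"
  have L: "set L = {i\<in>{1..n}. \<pi> i = i}" "distinct L" by (auto simp: L_def)
  have fin: "finite {i. i < \<pi> i}"
    by (rule finite_subset[OF _ P12D(5)[OF p]]) (auto simp: psupp_def)
  have range: "i \<in> {1..n}" "\<pi> i \<in> {1..n}" if "i < \<pi> i" for i
  proof -
    have "i \<in> psupp \<pi>" using that by (simp add: psupp_def)
    then show "i \<in> {1..n}" "\<pi> i \<in> {1..n}" using P12D(4,7)[OF p] by blast+
  qed
  have "multilinear (\<lambda>hs. if length hs = n then K (\<lambda>i. hs ! (i - 1)) else 0)"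
  proof (rule multilinearI)
    fix x h and u v :: 'h and a b :: real assume x: "x \<in> {1..n}"
    show "K (h(x := a *\<^sub>R u + b *\<^sub>R v)) = a *\<^sub>R K (h(x := u)) + b *\<^sub>R K (h(x := v))"
    proof (cases "\<pi> x = x")
      case True
      then have "x \<in> set L" using x L(1) by simp
      then obtain A B where AB: "L = A @ x # B" "x \<notin> set A" "x \<notin> set B"
        using L(2) by (metis distinct.simps(2) distinct_append not_distinct_conv_prefix split_list disjoint_iff list.set_intros(1))
      have "tens (map (h(x := w)) L) = tens (map h A @ w # map h B)" for w
        using AB(2,3) unfolding AB(1) by (simp add: map_fun_upd)
      moreover have "(\<Prod>i | i < \<pi> i. (h(x := w)) i \<bullet> (h(x := w)) (\<pi> i)) = (\<Prod>i | i < \<pi> i. h i \<bullet> h (\<pi> i))" for w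
      proof (rule prod.cong[OF refl])
        fix i assume "i \<in> {i. i < \<pi> i}"
        then have "i \<noteq> x" "\<pi> i \<noteq> x" using True P12D(2)[OF p, of i] by auto
        then show "(h(x := w)) i \<bullet> (h(x := w)) (\<pi> i) = h i \<bullet> h (\<pi> i)" by simp
      qed
      ultimately show ?thesis by (simp add: K_def tens_multilinear scaleR_add_right mult.commute)
    next
      case False
      then have "x \<notin> set L" using L(1) by simp
      then have t: "map (h(x := w)) L = map h L" for w by simp
      define i0 where "i0 = min x (\<pi> x)"
      have i0: "i0 \<in> {i. i < \<pi> i}" using False P12D(2)[OF p, of x] by (auto simp: i0_def min_def)
      have other: "i \<noteq> x \<and> \<pi> i \<noteq> x" if "i < \<pi> i" "i \<noteq> i0" for i
        using that P12D(2)[OF p, of i] by (auto simp: i0_def min_def split: if_splits)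
      define c where "c = (\<Prod>i\<in>{i. i < \<pi> i} - {i0}. h i \<bullet> h (\<pi> i))"
      have "(h(x := w)) i0 \<bullet> (h(x := w)) (\<pi> i0) = w \<bullet> h (\<pi> x)" for w
        using False P12D(2)[OF p, of x] by (auto simp: i0_def min_def inner_commute)
      moreover have "(\<Prod>i\<in>{i. i < \<pi> i} - {i0}. (h(x := w)) i \<bullet> (h(x := w)) (\<pi> i)) = c" for w
        unfolding c_def using other by (intro prod.cong) auto
      ultimately have "(\<Prod>i | i < \<pi> i. (h(x := w)) i \<bullet> (h(x := w)) (\<pi> i)) = (w \<bullet> h (\<pi> x)) * c" for w
        using prod.remove[OF fin i0, of "\<lambda>i. (h(x := w)) i \<bullet> (h(x := w)) (\<pi> i)"] by simp
      then show ?thesis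
        unfolding K_def t by (simp add: inner_add_left scaleR_add_left algebra_simps)
    qed
  next
    fix h h' :: "nat \<Rightarrow> 'h" assume eq: "\<And>i. i \<in> {1..n} \<Longrightarrow> h i = h' i"
    have "(\<Prod>i | i < \<pi> i. h i \<bullet> h (\<pi> i)) = (\<Prod>i | i < \<pi> i. h' i \<bullet> h' (\<pi> i))"
      by (rule prod.cong[OF refl]) (simp only: mem_Collect_eq eq[OF range(1)] eq[OF range(2)])
    moreover have "map h L = map h' L" using eq L(1) by simp
    ultimately show "K h = K h'" by (simp only: K_def)
  qed
  then show ?thesis unfolding K_def L_def .
qed

lemma filter_fixed_eq:
  assumes p: "\<pi> \<in> P12 n"
  shows "map h (filter (\<lambda>i. \<pi> i = i) [1..<Suc n]) = tab (n - 2 * npairs \<pi>) (h \<circ> enum (rest n \<pi>))"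
proof -
  let ?L = "filter (\<lambda>i. \<pi> i = i) [0..<Suc n]" and ?M = "filter (\<lambda>i. \<pi> i = i) [1..<Suc n]"
  have L: "?L = 0 # ?M" using P12D(3)[OF p] by (subst upt_conv_Cons) simp_all
  have set: "set ?L = rest n \<pi>" by (auto simp: rest_def psupp_def simp del: upt_Suc)
  have "sorted_list_of_set (set ?L) = ?L"
    by (rule sorted_list_of_set.idem_if_sorted_distinct) (simp_all only: sorted_wrt_filter sorted_upt distinct_filter distinct_upt)
  then have "sorted_list_of_set (rest n \<pi>) = ?L" unfolding set .
  then have e: "sorted_list_of_set (rest n \<pi>) = 0 # ?M" by (simp only: L)
  have len: "length ?M = n - 2 * npairs \<pi>"
    using arg_cong[OF e, of length] rest_simps(1,3)[OF p] by simp
  show ?thesis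
  proof (rule nth_equalityI)
    show "length (map h ?M) = length (tab (n - 2 * npairs \<pi>) (h \<circ> enum (rest n \<pi>)))" using len by simp
    fix i assume "i < length (map h ?M)"
    then have i: "i < length ?M" by simp
    then have "enum (rest n \<pi>) (Suc i) = ?M ! i" unfolding enum_def e by simp
    then show "map h ?M ! i = tab (n - 2 * npairs \<pi>) (h \<circ> enum (rest n \<pi>)) ! i"
      using i len by (simp del: upt_Suc)
  qed
qed

lemma linear_contr: "\<pi> \<in> P12 n \<Longrightarrow> linear (contr_tens n \<pi>)"
  unfolding contr_tens_def by (rule tens_lift(1)[OF multilinear_contr])

lemma contr_tens_lin:
  assumes "\<pi> \<in> P12 n"
  shows "contr_tens n \<pi> (a *\<^sub>R F + b *\<^sub>R G) = a *\<^sub>R contr_tens n \<pi> F + b *\<^sub>R contr_tens n \<pi> G"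
  by (simp add: linear_add[OF linear_contr[OF assms]] linear_scale[OF linear_contr[OF assms]])

lemma contr_tens_tab:
  assumes p: "\<pi> \<in> P12 n"
  shows "contr_tens n \<pi> (tens (tab n h)) =
    (\<Prod>i | i < \<pi> i. h i \<bullet> h (\<pi> i)) *\<^sub>R tens (tab (n - 2 * npairs \<pi>) (h \<circ> enum (rest n \<pi>)))"
proof -
  have v: "tab n h ! (i - 1) = h i" if "i \<in> {1..n}" for i
    using that by (rule tab_nth_pred)
  have 1: "(\<Prod>i | i < \<pi> i. tab n h ! (i - 1) \<bullet> tab n h ! (\<pi> i - 1)) = (\<Prod>i | i < \<pi> i. h i \<bullet> h (\<pi> i))"
  proof (rule prod.cong[OF refl])
    fix i assume "i \<in> {i. i < \<pi> i}"
    then have "i \<in> psupp \<pi>" by (simp add: psupp_def)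
    then have "i \<in> {1..n}" "\<pi> i \<in> {1..n}" using P12D(4,7)[OF p] by blast+
    then show "tab n h ! (i - 1) \<bullet> tab n h ! (\<pi> i - 1) = h i \<bullet> h (\<pi> i)" by (simp only: v)
  qed
  have 2: "map (\<lambda>i. tab n h ! (i - 1)) (filter (\<lambda>i. \<pi> i = i) [1..<Suc n]) = map h (filter (\<lambda>i. \<pi> i = i) [1..<Suc n])"
  proof (rule map_cong[OF refl])
    fix i assume "i \<in> set (filter (\<lambda>i. \<pi> i = i) [1..<Suc n])"
    then have "i \<in> {1..n}" by (simp only: set_filter set_upt atLeastLessThanSuc_atLeastAtMost mem_Collect_eq)
    then show "tab n h ! (i - 1) = h i" by (rule v)
  qed
  show ?thesis
    unfolding contr_tens_def tens_lift(2)[OF multilinear_contr[OF p]] length_tab 1 2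
    by (simp only: if_True filter_fixed_eq[OF p] simp_thms)
qed

lemma contr_tens_tpow:
  assumes p: "\<pi> \<in> P12 n" and "F \<in> tpow n"
  shows "contr_tens n \<pi> F \<in> tpow (n - 2 * npairs \<pi>)"
  using assms(2)
proof (induction rule: tpow_induct)
  case (tens h)
  then show ?case
    unfolding contr_tens_tab[OF p] using tens_tab_tpow unfolding tpow_def by (rule span_scale)
qed (simp add: contr_tens_lin[OF p] tpow_lin)

lemma contr_tens_id: "F \<in> tpow n \<Longrightarrow> contr_tens n id F = F"
proof (induction rule: tpow_induct)
  case (tens h)
  have "enum (rest n id) i = i" if "i \<le> n" for i
  proof -
    have r: "rest n id = {0..n}" by (simp add: rest_def)
    have "rank {0..n} i = i"
    proof -
      have "{z \<in> {0..n}. z < i} = {..<i}" using that by auto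
      then show ?thesis by (simp add: rank_def)
    qed
    then show ?thesis using enum_rank[of "{0..n}" i] that unfolding r by simp
  qed
  then have "tab n (h \<circ> enum (rest n id)) = tab n h" by (intro tab_cong) simp
  moreover have "(\<Prod>i | i < id i. h i \<bullet> h (id i)) = 1" "n - 2 * npairs id = n" by simp_all
  ultimately show ?case unfolding contr_tens_tab[OF id_P12] by (simp only: scaleR_one)
qed (simp only: contr_tens_lin[OF id_P12])

lemma contr_tens_conj:
  assumes s: "\<sigma> \<in> Sym n" and p: "\<pi> \<in> P12 n" and "F \<in> tpow n"
  shows "contr_tens n (\<sigma> \<circ> \<pi> \<circ> inv \<sigma>) (Uperm n \<sigma> F) =
    Uperm (n - 2 * npairs \<pi>) (rank_conj (rest n \<pi>) \<sigma>) (contr_tens n \<pi> F)"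
  using assms(3)
proof (induction rule: tpow_induct)
  case (tens h)
  let ?X = "rest n \<pi>" and ?t = "rank_conj (rest n \<pi>) \<sigma>" and ?m = "n - 2 * npairs \<pi>"
  note cp = conj_P12[OF s p]
  note inv = permutes_inverses[OF Sym_permutes[OF s]]
  note tinv = permutes_inverses[OF Sym_permutes[OF cp(5)]]
  have "(\<Prod>i | i < (\<sigma> \<circ> \<pi> \<circ> inv \<sigma>) i. (h \<circ> inv \<sigma>) i \<bullet> (h \<circ> inv \<sigma>) ((\<sigma> \<circ> \<pi> \<circ> inv \<sigma>) i))
      = (\<Prod>i | i < \<pi> i. h i \<bullet> h (\<pi> i))"
    using prod_pairs_conj[OF s p, of "\<lambda>i j. (h \<circ> inv \<sigma>) i \<bullet> (h \<circ> inv \<sigma>) j"]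
    by (simp add: inner_commute inv)
  moreover have "tab ?m (h \<circ> inv \<sigma> \<circ> enum (\<sigma> ` ?X)) = tab ?m (h \<circ> enum ?X \<circ> inv ?t)"
  proof (rule tab_cong)
    fix r assume "1 \<le> r" "r \<le> ?m"
    then have "inv ?t r \<le> ?m"
      using permutes_in_image[OF Sym_permutes0[OF Sym_inv[OF cp(5)]], of r] by simp
    then have lt: "inv ?t r < card ?X" by (simp add: rest_simps(3)[OF p])
    define y where "y = enum ?X (inv ?t r)"
    have y: "y \<in> ?X" unfolding y_def by (rule enum_in[OF rest_simps(1)[OF p] lt])
    have "r = ?t (rank ?X y)" unfolding y_def rank_enum[OF rest_simps(1)[OF p] lt] by (rule tinv(1)[symmetric])
    then have "r = rank (\<sigma> ` ?X) (\<sigma> y)" using rank_conj_rank[OF rest_simps(1)[OF p] y] by simp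
    then have "enum (\<sigma> ` ?X) r = \<sigma> y"
      using enum_rank[of "\<sigma> ` ?X" "\<sigma> y"] rest_simps(1)[OF p] y by simp
    then show "(h \<circ> inv \<sigma> \<circ> enum (\<sigma> ` ?X)) r = (h \<circ> enum ?X \<circ> inv ?t) r" by (simp add: inv y_def)
  qed
  ultimately show ?case
    unfolding Uperm_tab[OF s] contr_tens_tab[OF cp(1)] contr_tens_tab[OF p] cp(3,4)
      linear_scale[OF linear_Uperm[OF cp(5)]] Uperm_tab[OF cp(5)] by simp
qed (simp only: Uperm_lin[OF s] contr_tens_lin[OF conj_P12(1)[OF s p]] contr_tens_lin[OF p] Uperm_lin[OF conj_P12(5)[OF s p]])

lemma tens_scal:
  fixes hs :: "'h::real_vector list"
  shows "linear (tens_scal :: 'h tensor \<Rightarrow> real)" "tens_scal (tens hs) = (if hs = [] then 1 else 0)"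
proof -
  have "multilinear (\<lambda>hs :: 'h list. if hs = [] then 1 else (0::real))" by (simp add: multilinear_def)
  from tens_lift[OF this, folded tens_scal_def] show "linear (tens_scal :: 'h tensor \<Rightarrow> real)"
    "tens_scal (tens hs) = (if hs = [] then 1 else 0)" by auto
qed



section \<open>Linear maps on tensor-decorated permutations\<close>

lemma W_lin:
  assumes "\<alpha> \<in> Sym0 n" "F \<in> tpow n" "G \<in> tpow n"
  shows "W n (ga \<alpha>) (a *\<^sub>R F + b *\<^sub>R G) = of_real a *\<^sub>C W n (ga \<alpha>) F + of_real b *\<^sub>C W n (ga \<alpha>) G"
proof -
  have "tp_rel (Poly_Mapping.single (n, \<alpha>, a *\<^sub>R F + b *\<^sub>R G) 1)
     (fscale (of_real a) (Poly_Mapping.single (n, \<alpha>, F) 1) + fscale (of_real b) (Poly_Mapping.single (n, \<alpha>, G) 1))"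
    unfolding tp_rel_def diff_diff_eq[symmetric] tp_relators_def
    using assms by (intro free.span_base UnI1) blast
  then show ?thesis unfolding W_ga Wperm_def scaleC.abs_eq plus_tp.abs_eq tp.abs_eq_iff .
qed

lemma tp_induct [case_names gen add scale]:
  fixes X :: "'h::real_inner tp"
  assumes gen: "\<And>n \<alpha> h. \<alpha> \<in> Sym0 n \<Longrightarrow> P (W n (ga \<alpha>) (tens (tab n h)))"
    and add: "\<And>x y. P x \<Longrightarrow> P y \<Longrightarrow> P (x + y)"
    and scale: "\<And>c x. P x \<Longrightarrow> P (c *\<^sub>C x)"
  shows "P X"
proof -
  have "P (0 *\<^sub>C W 0 (ga id) (tens (tab 0 (\<lambda>_. 0))))"
    by (intro scale gen) (simp add: Sym0_def permutes_id)
  then have zero: "P 0" by simp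
  have W: "P (W n (ga \<alpha>) F)" if a: "\<alpha> \<in> Sym0 n" and "F \<in> tpow n" for n \<alpha> F
    using that(2)
  proof (induction rule: tpow_induct)
    case (lin a b F G)
    then show ?case using W_lin[OF a lin(1,2)] add scale by simp
  qed (rule gen[OF a])
  have Wp: "P (Wperm n \<alpha> F)" for n \<alpha> F
    using W[of \<alpha> n F] Wperm_illegal[of \<alpha> n F] zero by (cases "\<alpha> \<in> Sym0 n \<and> F \<in> tpow n") (auto simp: W_ga)
  have "P (\<Sum>s\<in>A. c s *\<^sub>C Wperm (fst s) (fst (snd s)) (snd (snd s)))" for A c
    by (induction A rule: infinite_finite_induct) (simp_all add: zero add scale Wp)
  then show ?thesis by (induction X rule: tp.abs_induct) (simp only: tp_expansion)
qed

lemma linear_tpI: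
  assumes "vector_space sc" "\<And>x y. f (x + y) = f x + f y" "\<And>c x. f (c *\<^sub>C x) = sc c (f x)"
  shows "Vector_Spaces.linear (*\<^sub>C) sc f"
  unfolding Vector_Spaces.linear_iff using assms tp.vector_space_axioms by blast

lemma linear_tpD:
  assumes "Vector_Spaces.linear (*\<^sub>C) sc f"
  shows "f (x + y) = f x + f y" "f (c *\<^sub>C x) = sc c (f x)"
  using assms unfolding Vector_Spaces.linear_iff by blast+

lemma linear_tp_sum:
  assumes "Vector_Spaces.linear (*\<^sub>C) sc f" shows "f (\<Sum>i\<in>A. g i) = (\<Sum>i\<in>A. f (g i))"
proof -
  interpret L: Vector_Spaces.linear "(*\<^sub>C)" sc f by (rule assms)
  show ?thesis by (rule L.sum)
qed

lemma linear_tp_0: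
  assumes "Vector_Spaces.linear (*\<^sub>C) sc f" shows "f 0 = 0"
  using linear_tp_sum[OF assms, of _ "{}"] by simp

lemma linear_tp_diff:
  assumes "Vector_Spaces.linear (*\<^sub>C) sc f" shows "f (x - y) = f x - f y"
proof -
  have "f (x - y + y) = f (x - y) + f y" by (rule linear_tpD(1)[OF assms])
  then show ?thesis by (simp add: algebra_simps)
qed

lemma linear_tp_eqI:
  assumes f: "Vector_Spaces.linear (*\<^sub>C) sc f" and g: "Vector_Spaces.linear (*\<^sub>C) sc g"
    and eq: "\<And>n \<alpha> F. \<alpha> \<in> Sym0 n \<Longrightarrow> F \<in> tpow n \<Longrightarrow> f (W n (ga \<alpha>) F) = g (W n (ga \<alpha>) F)"
  shows "f X = g X"
proof (induction X rule: tp_induct)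
  case (gen n \<alpha> h)
  then show ?case by (intro eq tens_tab_tpow)
next
  case (add x y)
  then show ?case by (simp only: linear_tpD(1)[OF f] linear_tpD(1)[OF g])
next
  case (scale c x)
  then show ?case by (simp only: linear_tpD(2)[OF f] linear_tpD(2)[OF g])
qed

lemma vector_space_mult: "vector_space ((*) :: complex \<Rightarrow> _)"
  and vector_space_cnj_mult: "vector_space (\<lambda>c z :: complex. cnj c * z)"
  and vector_space_cnj_scaleC: "vector_space (\<lambda>c (x :: 'h::real_inner tp). cnj c *\<^sub>C x)"
  by (unfold_locales; simp add: algebra_simps tp.scale_left_distrib tp.scale_right_distrib)+

text \<open>A map of two arguments can be prescribed on the generators, provided that the prescription is
  linear (or antilinear) in both tensors and invariant under conjugation in both arguments.\<close>

lemma tp_bilift: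
  fixes sc1 sc2 :: "complex \<Rightarrow> 'v \<Rightarrow> 'v::ab_group_add"
    and g :: "nat \<Rightarrow> (nat \<Rightarrow> nat) \<Rightarrow> 'h::real_inner tensor \<Rightarrow> nat \<Rightarrow> (nat \<Rightarrow> nat) \<Rightarrow> 'h tensor \<Rightarrow> 'v"
  assumes vs1: "vector_space sc1" and vs2: "vector_space sc2"
    and comm: "\<And>a b v. sc1 a (sc2 b v) = sc2 b (sc1 a v)"
    and lin1: "\<And>n \<alpha> F G k \<beta> H a b. \<alpha> \<in> Sym0 n \<Longrightarrow> F \<in> tpow n \<Longrightarrow> G \<in> tpow n \<Longrightarrow> \<beta> \<in> Sym0 k \<Longrightarrow>
      H \<in> tpow k \<Longrightarrow> g n \<alpha> (a *\<^sub>R F + b *\<^sub>R G) k \<beta> H = sc1 (of_real a) (g n \<alpha> F k \<beta> H) + sc1 (of_real b) (g n \<alpha> G k \<beta> H)"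
    and lin2: "\<And>n \<alpha> F G k \<beta> H a b. \<alpha> \<in> Sym0 n \<Longrightarrow> F \<in> tpow k \<Longrightarrow> G \<in> tpow k \<Longrightarrow> \<beta> \<in> Sym0 k \<Longrightarrow>
      H \<in> tpow n \<Longrightarrow> g n \<alpha> H k \<beta> (a *\<^sub>R F + b *\<^sub>R G) = sc2 (of_real a) (g n \<alpha> H k \<beta> F) + sc2 (of_real b) (g n \<alpha> H k \<beta> G)"
    and conj1: "\<And>n \<alpha> F k \<beta> H \<sigma>. \<alpha> \<in> Sym0 n \<Longrightarrow> F \<in> tpow n \<Longrightarrow> \<beta> \<in> Sym0 k \<Longrightarrow> H \<in> tpow k \<Longrightarrow>
      \<sigma> \<in> Sym n \<Longrightarrow> g n (\<sigma> \<circ> \<alpha> \<circ> inv \<sigma>) (Uperm n \<sigma> F) k \<beta> H = g n \<alpha> F k \<beta> H"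
    and conj2: "\<And>n \<alpha> F k \<beta> H \<sigma>. \<alpha> \<in> Sym0 n \<Longrightarrow> F \<in> tpow n \<Longrightarrow> \<beta> \<in> Sym0 k \<Longrightarrow> H \<in> tpow k \<Longrightarrow>
      \<sigma> \<in> Sym k \<Longrightarrow> g n \<alpha> F k (\<sigma> \<circ> \<beta> \<circ> inv \<sigma>) (Uperm k \<sigma> H) = g n \<alpha> F k \<beta> H"
  obtains B where "\<And>y. Vector_Spaces.linear (*\<^sub>C) sc1 (\<lambda>x. B x y)"
    "\<And>x. Vector_Spaces.linear (*\<^sub>C) sc2 (B x)"
    "\<And>n \<alpha> F k \<beta> H. \<alpha> \<in> Sym0 n \<Longrightarrow> F \<in> tpow n \<Longrightarrow> \<beta> \<in> Sym0 k \<Longrightarrow> H \<in> tpow k \<Longrightarrow>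
      B (W n (ga \<alpha>) F) (W k (ga \<beta>) H) = g n \<alpha> F k \<beta> H"
proof -
  interpret V1: vector_space sc1 by (rule vs1)
  interpret V2: vector_space sc2 by (rule vs2)
  define PL where "PL k \<beta> H L \<longleftrightarrow> Vector_Spaces.linear (*\<^sub>C) sc1 L \<and>
    (\<forall>n. \<forall>\<alpha>\<in>Sym0 n. \<forall>F\<in>tpow n. L (W n (ga \<alpha>) F) = g n \<alpha> F k \<beta> H)" for k \<beta> H L
  define L where "L k \<beta> H = (SOME L. PL k \<beta> H L)" for k \<beta> H
  have PL: "PL k \<beta> H (L k \<beta> H)" if "\<beta> \<in> Sym0 k" "H \<in> tpow k" for k \<beta> H
  proof -
    have "\<exists>!L. PL k \<beta> H L"
      unfolding PL_def
    proof (rule tp_lift_ex1[OF vs1])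
      fix n \<alpha> a b and F G :: "'h tensor" assume "\<alpha> \<in> Sym0 n" "F \<in> tpow n" "G \<in> tpow n"
      then show "g n \<alpha> (a *\<^sub>R F + b *\<^sub>R G) k \<beta> H =
          sc1 (of_real a) (g n \<alpha> F k \<beta> H) + sc1 (of_real b) (g n \<alpha> G k \<beta> H)"
        using that by (rule lin1)
    next
      fix n \<sigma> \<alpha> and F :: "'h tensor" assume s: "\<sigma> \<in> Sym n" and aF: "\<alpha> \<in> Sym0 n" "F \<in> tpow n"
      show "g n (\<sigma> \<circ> \<alpha> \<circ> inv \<sigma>) (Uperm n \<sigma> F) k \<beta> H = g n \<alpha> F k \<beta> H"
        using aF that s by (rule conj1)
    qed
    then have "\<exists>L. PL k \<beta> H L" by (rule ex1_implies_ex)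
    then show ?thesis unfolding L_def by (rule someI_ex)
  qed
  have L_lin: "Vector_Spaces.linear (*\<^sub>C) sc1 (L k \<beta> H)" if "\<beta> \<in> Sym0 k" "H \<in> tpow k" for k \<beta> H
    using PL[OF that] by (simp add: PL_def)
  have L_val: "L k \<beta> H (W n (ga \<alpha>) F) = g n \<alpha> F k \<beta> H"
    if "\<beta> \<in> Sym0 k" "H \<in> tpow k" "\<alpha> \<in> Sym0 n" "F \<in> tpow n" for k \<beta> H n \<alpha> F
    using PL[OF that(1,2)] that(3,4) by (simp add: PL_def)
  have L_lin2: "L k \<beta> (a *\<^sub>R F + b *\<^sub>R G) x = sc2 (of_real a) (L k \<beta> F x) + sc2 (of_real b) (L k \<beta> G x)"
    if b: "\<beta> \<in> Sym0 k" and F: "F \<in> tpow k" and G: "G \<in> tpow k" for k \<beta> F G a b x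
  proof (rule linear_tp_eqI[OF L_lin[OF b tpow_lin[OF F G]]])
    note lF = linear_tpD[OF L_lin[OF b F]] and lG = linear_tpD[OF L_lin[OF b G]]
    show "Vector_Spaces.linear (*\<^sub>C) sc1 (\<lambda>x. sc2 (of_real a) (L k \<beta> F x) + sc2 (of_real b) (L k \<beta> G x))"
    proof (rule linear_tpI[OF vs1])
      show "sc2 (of_real a) (L k \<beta> F (x + y)) + sc2 (of_real b) (L k \<beta> G (x + y)) =
        sc2 (of_real a) (L k \<beta> F x) + sc2 (of_real b) (L k \<beta> G x) + (sc2 (of_real a) (L k \<beta> F y) + sc2 (of_real b) (L k \<beta> G y))" for x y
        by (simp only: lF(1) lG(1) V2.scale_right_distrib add_ac)
      show "sc2 (of_real a) (L k \<beta> F (c *\<^sub>C x)) + sc2 (of_real b) (L k \<beta> G (c *\<^sub>C x)) =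
        sc1 c (sc2 (of_real a) (L k \<beta> F x) + sc2 (of_real b) (L k \<beta> G x))" for c x
        by (simp only: lF(2) lG(2) V1.scale_right_distrib comm)
    qed
    fix n \<alpha> and H :: "'h tensor" assume "\<alpha> \<in> Sym0 n" "H \<in> tpow n"
    then show "L k \<beta> (a *\<^sub>R F + b *\<^sub>R G) (W n (ga \<alpha>) H) =
        sc2 (of_real a) (L k \<beta> F (W n (ga \<alpha>) H)) + sc2 (of_real b) (L k \<beta> G (W n (ga \<alpha>) H))"
      using b F G lin2 by (simp only: L_val tpow_lin)
  qed
  have L_conj2: "L k (\<sigma> \<circ> \<beta> \<circ> inv \<sigma>) (Uperm k \<sigma> H) x = L k \<beta> H x"
    if b: "\<beta> \<in> Sym0 k" and H: "H \<in> tpow k" and s: "\<sigma> \<in> Sym k" for k \<beta> H \<sigma> x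
    by (rule linear_tp_eqI[OF L_lin[OF Sym0_conj[OF s b] Uperm_tpow[OF s H]] L_lin[OF b H]])
       (simp only: L_val[OF Sym0_conj[OF s b] Uperm_tpow[OF s H]] L_val[OF b H] conj2[OF _ _ b H s])
  define PB where "PB x M \<longleftrightarrow> Vector_Spaces.linear (*\<^sub>C) sc2 M \<and>
    (\<forall>k. \<forall>\<beta>\<in>Sym0 k. \<forall>H\<in>tpow k. M (W k (ga \<beta>) H) = L k \<beta> H x)" for x M
  define B where "B x = (SOME M. PB x M)" for x
  have PB: "PB x (B x)" for x
  proof -
    have "\<exists>!M. PB x M"
      unfolding PB_def by (rule tp_lift_ex1[OF vs2]; (rule L_lin2 L_conj2; assumption))
    then have "\<exists>M. PB x M" by (rule ex1_implies_ex)
    then show ?thesis unfolding B_def by (rule someI_ex)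
  qed
  have B_lin: "Vector_Spaces.linear (*\<^sub>C) sc2 (B x)" for x using PB by (simp add: PB_def)
  have B_val: "B x (W k (ga \<beta>) H) = L k \<beta> H x" if "\<beta> \<in> Sym0 k" "H \<in> tpow k" for x k \<beta> H
    using PB[of x] that by (simp add: PB_def)
  note l2 = linear_tpD[OF B_lin]
  have "(\<forall>x x'. B (x + x') y = B x y + B x' y) \<and> (\<forall>c x. B (c *\<^sub>C x) y = sc1 c (B x y))" for y
  proof (induction y rule: tp_induct)
    case (gen n \<alpha> h)
    show ?case by (simp only: B_val[OF gen tens_tab_tpow] linear_tpD[OF L_lin[OF gen tens_tab_tpow]]) simp
  next
    case (add y z)
    then show ?case by (simp add: l2 V1.scale_right_distrib add_ac)
  next
    case (scale c y)
    then show ?case by (simp add: l2 V2.scale_right_distrib comm)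
  qed
  then have l1: "B (x + x') y = B x y + B x' y" "B (c *\<^sub>C x) y = sc1 c (B x y)" for x x' y c by blast+
  show ?thesis
  proof (rule that[of B])
    show "Vector_Spaces.linear (*\<^sub>C) sc1 (\<lambda>x. B x y)" for y by (rule linear_tpI[OF vs1 l1])
    show "Vector_Spaces.linear (*\<^sub>C) sc2 (B x)" for x by (rule B_lin)
    fix n \<alpha> k \<beta> and F H :: "'h tensor"
    assume a: "\<alpha> \<in> Sym0 n" "F \<in> tpow n" and b: "\<beta> \<in> Sym0 k" "H \<in> tpow k"
    show "B (W n (ga \<alpha>) F) (W k (ga \<beta>) H) = g n \<alpha> F k \<beta> H"
      unfolding B_val[OF b] by (rule L_val[OF b a])
  qed
qed


section \<open>The transform from \<open>W\<close> to \<open>T\<close>\<close>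

definition contr_term :: "real \<Rightarrow> nat \<Rightarrow> (nat \<Rightarrow> nat) \<Rightarrow> 'h::real_inner tensor \<Rightarrow> (nat \<Rightarrow> nat) \<Rightarrow> 'h tp" where
  "contr_term q n \<alpha> F \<pi> =
     of_real (cweight q \<pi> \<alpha>) *\<^sub>C W (n - 2 * npairs \<pi>) (ga (red n \<pi> \<alpha>)) (contr_tens n \<pi> F)"

lemma T_expand: "\<alpha> \<in> Sym0 n \<Longrightarrow> T q n (ga \<alpha>) F = (\<Sum>\<pi>\<in>P12 n. contr_term q n \<alpha> F \<pi>)"
  unfolding T_def contr_term_def by (intro sum.cong refl W_contr)

lemma T_lin:
  assumes a: "\<alpha> \<in> Sym0 n" and F: "F \<in> tpow n" and G: "G \<in> tpow n"
  shows "T q n (ga \<alpha>) (a *\<^sub>R F + b *\<^sub>R G) = of_real a *\<^sub>C T q n (ga \<alpha>) F + of_real b *\<^sub>C T q n (ga \<alpha>) G"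
  unfolding T_expand[OF a] tp.scale_sum_right sum.distrib[symmetric]
proof (rule sum.cong[OF refl])
  fix \<pi> assume p: "\<pi> \<in> P12 n"
  show "contr_term q n \<alpha> (a *\<^sub>R F + b *\<^sub>R G) \<pi> =
      of_real a *\<^sub>C contr_term q n \<alpha> F \<pi> + of_real b *\<^sub>C contr_term q n \<alpha> G \<pi>"
    unfolding contr_term_def contr_tens_lin[OF p]
      W_lin[OF red_Sym0[OF p a] contr_tens_tpow[OF p F] contr_tens_tpow[OF p G]]
    by (simp only: tp.scale_right_distrib tp.scale_scale mult.commute)
qed

lemma contr_term_conj:
  assumes a: "\<alpha> \<in> Sym0 n" and F: "F \<in> tpow n" and s: "\<sigma> \<in> Sym n" and p: "\<pi> \<in> P12 n"
  shows "contr_term q n (\<sigma> \<circ> \<alpha> \<circ> inv \<sigma>) (Uperm n \<sigma> F) (\<sigma> \<circ> \<pi> \<circ> inv \<sigma>) = contr_term q n \<alpha> F \<pi>"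
  unfolding contr_term_def cweight_def conj_P12(3)[OF s p] conj_red[OF s p a] contr_tens_conj[OF s p F]
  by (simp only: W_conj[OF conj_P12(5)[OF s p] red_Sym0[OF p a] contr_tens_tpow[OF p F]])

lemma T_conj:
  assumes a: "\<alpha> \<in> Sym0 n" and F: "F \<in> tpow n" and s: "\<sigma> \<in> Sym n"
  shows "T q n (ga (\<sigma> \<circ> \<alpha> \<circ> inv \<sigma>)) (Uperm n \<sigma> F) = T q n (ga \<alpha>) F"
  unfolding T_expand[OF a] T_expand[OF Sym0_conj[OF s a]]
proof (rule sum.reindex_bij_witness[of _ "\<lambda>\<pi>. \<sigma> \<circ> \<pi> \<circ> inv \<sigma>" "\<lambda>\<pi>. inv \<sigma> \<circ> \<pi> \<circ> inv (inv \<sigma>)"])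
  note inv = permutes_inverses[OF Sym_permutes[OF s]]
  have ii: "inv (inv \<sigma>) = \<sigma>" by (rule permutes_inv_inv[OF Sym_permutes[OF s]])
  fix \<pi> assume p: "\<pi> \<in> P12 n"
  show e: "\<sigma> \<circ> (inv \<sigma> \<circ> \<pi> \<circ> inv (inv \<sigma>)) \<circ> inv \<sigma> = \<pi>" unfolding ii by (simp add: fun_eq_iff inv)
  show p': "inv \<sigma> \<circ> \<pi> \<circ> inv (inv \<sigma>) \<in> P12 n" by (rule conj_P12(1)[OF Sym_inv[OF s] p])
  show "contr_term q n \<alpha> F (inv \<sigma> \<circ> \<pi> \<circ> inv (inv \<sigma>)) = contr_term q n (\<sigma> \<circ> \<alpha> \<circ> inv \<sigma>) (Uperm n \<sigma> F) \<pi>"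
    using contr_term_conj[OF a F s p', of q] unfolding e by (rule sym)
  show "inv \<sigma> \<circ> (\<sigma> \<circ> \<pi> \<circ> inv \<sigma>) \<circ> inv (inv \<sigma>) = \<pi>" unfolding ii by (simp add: fun_eq_iff inv)
  show "\<sigma> \<circ> \<pi> \<circ> inv \<sigma> \<in> P12 n" by (rule conj_P12(1)[OF s p])
qed

definition TT :: "real \<Rightarrow> 'h::real_inner tp \<Rightarrow> 'h tp" where
  "TT q = (THE L. clinear L \<and> (\<forall>n. \<forall>\<alpha>\<in>Sym0 n. \<forall>F\<in>tpow n. L (W n (ga \<alpha>) F) = T q n (ga \<alpha>) F))"

lemma TT:
  shows linear_TT: "clinear (TT q :: 'h::real_inner tp \<Rightarrow> _)"
    and TT_W: "\<alpha> \<in> Sym0 n \<Longrightarrow> F \<in> tpow n \<Longrightarrow> TT q (W n (ga \<alpha>) F :: 'h tp) = T q n (ga \<alpha>) F"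
proof -
  have "\<exists>!L. clinear L \<and> (\<forall>n. \<forall>\<alpha>\<in>Sym0 n. \<forall>F :: 'h tensor\<in>tpow n. L (W n (ga \<alpha>) F) = T q n (ga \<alpha>) F)"
    by (rule tp_lift_ex1[OF tp.vector_space_axioms]; (rule T_lin T_conj; assumption))
  from theI'[OF this] show "clinear (TT q :: 'h tp \<Rightarrow> _)"
    "\<alpha> \<in> Sym0 n \<Longrightarrow> F \<in> tpow n \<Longrightarrow> TT q (W n (ga \<alpha>) F :: 'h tp) = T q n (ga \<alpha>) F"
    unfolding TT_def by blast+
qed

text \<open>The degree filtration; \<open>TT q\<close> is the identity up to terms of lower degree, which makes it
  bijective.\<close>

definition below :: "nat \<Rightarrow> 'h::real_inner tp set" where
  "below N = tp.span {W n (ga \<alpha>) F | n \<alpha> F. n < N \<and> \<alpha> \<in> Sym0 n \<and> F \<in> tpow n}"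

lemma W_below: "n < N \<Longrightarrow> \<alpha> \<in> Sym0 n \<Longrightarrow> F \<in> tpow n \<Longrightarrow> W n (ga \<alpha>) F \<in> below N"
  unfolding below_def by (rule tp.span_base) blast

lemma below_mono: "M \<le> N \<Longrightarrow> below M \<subseteq> below N"
  unfolding below_def by (rule tp.span_mono) force

lemma ex_below: "\<exists>N. x \<in> below N"
proof (induction x rule: tp_induct)
  case (gen n \<alpha> h)
  then show ?case using W_below[of n "Suc n", OF _ gen tens_tab_tpow] by blast
next
  case (add x y)
  then obtain M N where "x \<in> below M" "y \<in> below N" by blast
  then have "x \<in> below (max M N)" "y \<in> below (max M N)"
    using below_mono[of M "max M N"] below_mono[of N "max M N"] by auto
  then show ?case unfolding below_def using tp.span_add by blast
next
  case (scale c x)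
  then show ?case unfolding below_def using tp.span_scale by blast
qed

lemma TT_lowers:
  assumes "x \<in> below (Suc N)" shows "TT q x - x \<in> below N"
  using assms unfolding below_def[of "Suc N"]
proof (induction rule: tp.span_induct_alt)
  case base
  show ?case by (simp add: linear_tp_0[OF linear_TT] below_def tp.span_zero)
next
  case (step c x y)
  then obtain n \<alpha> F where x: "x = W n (ga \<alpha>) F" and n: "n < Suc N" and a: "\<alpha> \<in> Sym0 n" and F: "F \<in> tpow n"
    by blast
  let ?t = "contr_term q n \<alpha> F"
  have id: "?t id = W n (ga \<alpha>) F"
    by (simp only: contr_term_def cweight_def npairs_id psupp_id red_id[OF a] contr_tens_id[OF F])
       (simp add: cyc_in_def)
  have "TT q x = ?t id + (\<Sum>\<pi>\<in>P12 n - {id}. ?t \<pi>)"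
    unfolding x TT_W[OF a F] T_expand[OF a] by (rule sum.remove[OF finite_P12 id_P12])
  then have "TT q x - x = (\<Sum>\<pi>\<in>P12 n - {id}. ?t \<pi>)" unfolding id x by simp
  also have "\<dots> \<in> below N"
    unfolding below_def contr_term_def
  proof (intro tp.span_sum tp.span_scale, fold below_def)
    fix \<pi> assume "\<pi> \<in> P12 n - {id}"
    then have p: "\<pi> \<in> P12 n" "\<pi> \<noteq> id" by auto
    have "n - 2 * npairs \<pi> < N" using npairs_pos[OF p] rest_simps(4)[OF p(1)] n by linarith
    then show "W (n - 2 * npairs \<pi>) (ga (red n \<pi> \<alpha>)) (contr_tens n \<pi> F) \<in> below N"
      by (rule W_below[OF _ red_Sym0[OF p(1) a] contr_tens_tpow[OF p(1) F]])
  qed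
  finally have x': "TT q x - x \<in> below N" .
  have "TT q (c *\<^sub>C x + y) - (c *\<^sub>C x + y) = c *\<^sub>C (TT q x - x) + (TT q y - y)"
    by (simp add: linear_tpD[OF linear_TT] tp.scale_right_diff_distrib)
  also have "\<dots> \<in> below N"
    using x' step.IH unfolding below_def by (intro tp.span_add tp.span_scale)
  finally show ?case .
qed

lemma bij_TT: "bij (TT q :: 'h::real_inner tp \<Rightarrow> 'h tp)"
proof -
  note lin = linear_TT[of q, where 'h = 'h]
  have "x = 0" if "TT q x = 0" "x \<in> below N" for x :: "'h tp" and N
    using that(2)
  proof (induction N)
    case 0
    then show ?case by (simp add: below_def)
  next
    case (Suc N)
    have "TT q x - x \<in> below N" by (rule TT_lowers[OF Suc.prems])
    then have "- x \<in> below N" by (simp add: that(1))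
    then have "x \<in> below N" unfolding below_def using tp.span_neg by fastforce
    then show ?case by (rule Suc.IH)
  qed
  then have zero: "x = 0" if "TT q x = 0" for x :: "'h tp" using that ex_below[of x] by blast
  have "inj (TT q :: 'h tp \<Rightarrow> _)"
  proof (rule injI)
    fix x y :: "'h tp" assume "TT q x = TT q y"
    then have "TT q (x - y) = 0" by (simp add: linear_tp_diff[OF lin])
    then show "x = y" using zero[of "x - y"] by simp
  qed
  moreover have "x \<in> range (TT q)" if "x \<in> below N" for x :: "'h tp" and N
    using that
  proof (induction N arbitrary: x)
    case 0
    then have "x = TT q 0" by (simp add: below_def linear_tp_0[OF lin])
    then show ?case by blast
  next
    case (Suc N)
    have "TT q x - x \<in> below N" by (rule TT_lowers[OF Suc.prems])
    then obtain y where "TT q x - x = TT q y" using Suc.IH by blast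
    then have "x = TT q x - TT q y" by (simp add: algebra_simps)
    then have "x = TT q (x - y)" by (simp add: linear_tp_diff[OF lin])
    then show ?case by blast
  qed
  then have "surj (TT q :: 'h tp \<Rightarrow> _)" using ex_below by blast
  ultimately show ?thesis by (simp add: bij_def)
qed

lemma T_induct [case_names gen add scale]:
  fixes X :: "'h::real_inner tp"
  assumes gen: "\<And>n \<alpha> h. \<alpha> \<in> Sym0 n \<Longrightarrow> P (T q n (ga \<alpha>) (tens (tab n h)))"
    and add: "\<And>x y. P x \<Longrightarrow> P y \<Longrightarrow> P (x + y)"
    and scale: "\<And>c x. P x \<Longrightarrow> P (c *\<^sub>C x)"
  shows "P X"
proof -
  have "P (TT q y)" for y :: "'h tp"
  proof (induction y rule: tp_induct)
    case (gen n \<alpha> h)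
    show ?case unfolding TT_W[OF gen tens_tab_tpow] using gen by (rule assms(1))
  qed (simp_all add: linear_tpD[OF linear_TT] add scale)
  then show ?thesis using bij_is_surj[OF bij_TT, of q] by (metis surjD)
qed



section \<open>Product, involution and inner product on generators\<close>

lemma Sym_comp: "\<sigma> \<in> Sym n \<Longrightarrow> \<tau> \<in> Sym n \<Longrightarrow> \<sigma> \<circ> \<tau> \<in> Sym n"
  by (simp add: Sym_def permutes_compose)

lemma inv_comp_Sym: "\<sigma> \<in> Sym n \<Longrightarrow> \<tau> \<in> Sym n \<Longrightarrow> inv (\<sigma> \<circ> \<tau>) = inv \<tau> \<circ> inv \<sigma>"
  by (rule o_inv_distrib) (auto dest: Sym_permutes permutes_bij)

lemma Uperm_comp:
  assumes s: "\<sigma> \<in> Sym n" and t: "\<tau> \<in> Sym n" and "F \<in> tpow n"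
  shows "Uperm n \<sigma> (Uperm n \<tau> F) = Uperm n (\<sigma> \<circ> \<tau>) F"
  using assms(3)
proof (induction rule: tpow_induct)
  case (tens h)
  show ?case
    by (simp only: Uperm_tab[OF s] Uperm_tab[OF t] Uperm_tab[OF Sym_comp[OF s t]] inv_comp_Sym[OF s t] comp_assoc)
qed (simp only: Uperm_lin[OF s] Uperm_lin[OF t] Uperm_lin[OF Sym_comp[OF s t]])

lemma Uperm_id: "F \<in> tpow n \<Longrightarrow> Uperm n id F = F"
proof (induction rule: tpow_induct)
  case (tens h)
  show ?case by (subst Uperm_tab) (simp_all add: Sym_def permutes_id)
next
  case (lin a b F G)
  have "id \<in> Sym n" by (simp add: Sym_def permutes_id)
  then show ?case by (simp only: Uperm_lin lin)
qed

lemma tens_inner_Uperm: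
  assumes s: "\<sigma> \<in> Sym n" and F: "F \<in> tpow n" and G: "G \<in> tpow n"
  shows "tens_inner (Uperm n \<sigma> F) (Uperm n \<sigma> G) = tens_inner F G"
  using F
proof (induction rule: tpow_induct)
  case (tens h)
  show ?case using G
  proof (induction rule: tpow_induct)
    case (tens g)
    have "(\<Prod>i\<in>{1..n}. h i \<bullet> g i) = (\<Prod>i\<in>{1..n}. ((\<lambda>i. h i \<bullet> g i) \<circ> inv \<sigma>) i)"
      by (rule prod.permute[OF permutes_inv[OF Sym_permutes[OF s]]])
    then show ?case by (simp add: Uperm_tab[OF s] tens_inner_tab)
  qed (simp only: Uperm_lin[OF s] tens_inner_lin)
qed (simp only: Uperm_lin[OF s] tens_inner_lin)

lemma tens_inner_commute:
  assumes F: "F \<in> tpow n" and G: "G \<in> tpow n"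
  shows "tens_inner F G = tens_inner G F"
  using F
proof (induction rule: tpow_induct)
  case (tens h)
  show ?case using G
    by (induction rule: tpow_induct) (simp_all only: tens_inner_lin tens_inner_tab inner_commute)
qed (simp only: tens_inner_lin)

lemma tens_prod_Uperm_left:
  assumes s: "\<sigma> \<in> Sym k" and F: "F \<in> tpow k" and G: "G \<in> tpow n"
  shows "tens_prod (Uperm k \<sigma> F) G = Uperm (k + n) \<sigma> (tens_prod F G)"
  using F
proof (induction rule: tpow_induct)
  case (tens g)
  note s' = Sym_mono[OF s, of n]
  show ?case using G
  proof (induction rule: tpow_induct)
    case (tens h)
    have le: "inv \<sigma> i \<le> k \<longleftrightarrow> i \<le> k" for i
      using permutes_in_image[OF Sym_permutes0[OF Sym_inv[OF s]], of i] by simp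
    have out: "inv \<sigma> i = i" if "\<not> i \<le> k" for i
      using permutes_not_in[OF Sym_permutes0[OF Sym_inv[OF s]], of i] that by simp
    have "tab (k + n) (\<lambda>i. if i \<le> k then (g \<circ> inv \<sigma>) i else h (i - k)) =
      tab (k + n) ((\<lambda>i. if i \<le> k then g i else h (i - k)) \<circ> inv \<sigma>)"
      by (rule tab_cong) (simp add: le out)
    then show ?case by (simp only: Uperm_tab[OF s] Uperm_tab[OF s'] tens_prod_tab)
  qed (simp only: tens_prod_lin Uperm_lin[OF s'])
qed (simp only: tens_prod_lin Uperm_lin[OF s] Uperm_lin[OF Sym_mono[OF s]])

lemma tens_prod_Uperm_right:
  assumes t: "\<tau> \<in> Sym n" and F: "F \<in> tpow k" and G: "G \<in> tpow n"
  shows "tens_prod F (Uperm n \<tau> G) = Uperm (k + n) (shift k \<tau>) (tens_prod F G)"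
  using F
proof (induction rule: tpow_induct)
  case (tens g)
  note t' = shift_Sym[OF t, of k]
  show ?case using G
  proof (induction rule: tpow_induct)
    case (tens h)
    have "tab (k + n) (\<lambda>i. if i \<le> k then g i else (h \<circ> inv \<tau>) (i - k)) =
      tab (k + n) ((\<lambda>i. if i \<le> k then g i else h (i - k)) \<circ> inv (shift k \<tau>))"
    proof (rule tab_cong)
      fix i :: nat assume "1 \<le> i"
      show "(if i \<le> k then g i else (h \<circ> inv \<tau>) (i - k)) =
        ((\<lambda>i. if i \<le> k then g i else h (i - k)) \<circ> inv (shift k \<tau>)) i"
        unfolding inv_shift[OF Sym_permutes0[OF t]]
      proof (cases "i \<le> k")
        case False
        then have i: "i = emb k (i - k)" "i - k \<noteq> 0" by (auto simp: emb_def)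
        have "inv \<tau> (i - k) \<noteq> 0"
          using i(2) permutes_inverses[OF Sym_permutes[OF t]] Sym_0[OF t] by metis
        then have "shift k (inv \<tau>) i = k + inv \<tau> (i - k)" "inv \<tau> (i - k) \<noteq> 0"
          using shift_emb[of k "inv \<tau>" "i - k"] i(1) by (simp_all add: emb_def)
        then show "(if i \<le> k then g i else (h \<circ> inv \<tau>) (i - k)) =
          ((\<lambda>i. if i \<le> k then g i else h (i - k)) \<circ> shift k (inv \<tau>)) i" using False by simp
      qed (use \<open>1 \<le> i\<close> in \<open>simp add: shift_low\<close>)
    qed
    then show ?case by (simp only: Uperm_tab[OF t] Uperm_tab[OF t'] tens_prod_tab)
  qed (simp only: tens_prod_lin Uperm_lin[OF t'] Uperm_lin[OF t])
qed (simp only: tens_prod_lin Uperm_lin[OF shift_Sym[OF t]])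

lemma linear_inv_TT: "clinear (inv (TT q))"
proof (rule linear_tpI[OF tp.vector_space_axioms])
  note surj = surj_f_inv_f[OF bij_is_surj[OF bij_TT]] and inj = inv_f_f[OF bij_is_inj[OF bij_TT]]
  show "inv (TT q) (x + y) = inv (TT q) x + inv (TT q) y" for x y
  proof -
    have "TT q (inv (TT q) x + inv (TT q) y) = x + y" by (simp only: linear_tpD(1)[OF linear_TT] surj)
    then show ?thesis using inj by metis
  qed
  show "inv (TT q) (c *\<^sub>C x) = c *\<^sub>C inv (TT q) x" for c x
  proof -
    have "TT q (c *\<^sub>C inv (TT q) x) = c *\<^sub>C x" by (simp only: linear_tpD(2)[OF linear_TT] surj)
    then show ?thesis using inj by metis
  qed
qed

lemma inv_TT_T: "\<alpha> \<in> Sym0 n \<Longrightarrow> F \<in> tpow n \<Longrightarrow> inv (TT q) (T q n (ga \<alpha>) F) = W n (ga \<alpha>) F"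
  using inv_f_f[OF bij_is_inj[OF bij_TT]] TT_W by metis

text \<open>Juxtaposition of the generators \<open>W\<close>. The product of the algebra is its transport along
  \<open>TT q\<close>.\<close>

lemma juxtaposition_ex:
  obtains J :: "'h::real_inner tp \<Rightarrow> 'h tp \<Rightarrow> 'h tp" where "\<And>y. clinear (\<lambda>x. J x y)" "\<And>x. clinear (J x)"
    "\<And>n \<alpha> F k \<beta> H. \<alpha> \<in> Sym0 n \<Longrightarrow> F \<in> tpow n \<Longrightarrow> \<beta> \<in> Sym0 k \<Longrightarrow> H \<in> tpow k \<Longrightarrow>
      J (W n (ga \<alpha>) F) (W k (ga \<beta>) H) = W (n + k) (ga (cup n \<alpha> \<beta>)) (tens_prod F H)"
proof -
  define g where "g n \<alpha> F k \<beta> H = W (n + k) (ga (cup n \<alpha> \<beta>)) (tens_prod F H)"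
    for n \<alpha> and F :: "'h tensor" and k \<beta> H
  show ?thesis
  proof (rule tp_bilift[of "(*\<^sub>C)" "(*\<^sub>C)" g])
    show "vector_space ((*\<^sub>C) :: _ \<Rightarrow> 'h tp \<Rightarrow> _)" "vector_space ((*\<^sub>C) :: _ \<Rightarrow> 'h tp \<Rightarrow> _)"
      by (rule tp.vector_space_axioms)+
    show "a *\<^sub>C b *\<^sub>C v = b *\<^sub>C a *\<^sub>C v" for a b and v :: "'h tp" by (simp add: mult.commute)
  next
    fix n \<alpha> k \<beta> a b and F G H :: "'h tensor"
    assume *: "\<alpha> \<in> Sym0 n" "F \<in> tpow n" "G \<in> tpow n" "\<beta> \<in> Sym0 k" "H \<in> tpow k"
    show "g n \<alpha> (a *\<^sub>R F + b *\<^sub>R G) k \<beta> H = of_real a *\<^sub>C g n \<alpha> F k \<beta> H + of_real b *\<^sub>C g n \<alpha> G k \<beta> H"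
      unfolding g_def tens_prod_lin using * by (intro W_lin cup_Sym0 tens_prod_tpow)
  next
    fix n \<alpha> k \<beta> a b and F G H :: "'h tensor"
    assume *: "\<alpha> \<in> Sym0 n" "F \<in> tpow k" "G \<in> tpow k" "\<beta> \<in> Sym0 k" "H \<in> tpow n"
    show "g n \<alpha> H k \<beta> (a *\<^sub>R F + b *\<^sub>R G) = of_real a *\<^sub>C g n \<alpha> H k \<beta> F + of_real b *\<^sub>C g n \<alpha> H k \<beta> G"
      unfolding g_def tens_prod_lin using * by (intro W_lin cup_Sym0 tens_prod_tpow)
  next
    fix n \<alpha> k \<beta> \<sigma> and F H :: "'h tensor"
    assume a: "\<alpha> \<in> Sym0 n" "F \<in> tpow n" and b: "\<beta> \<in> Sym0 k" "H \<in> tpow k" and s: "\<sigma> \<in> Sym n"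
    show "g n (\<sigma> \<circ> \<alpha> \<circ> inv \<sigma>) (Uperm n \<sigma> F) k \<beta> H = g n \<alpha> F k \<beta> H"
      unfolding g_def cup_conj_left[OF s] tens_prod_Uperm_left[OF s a(2) b(2)]
      by (rule W_conj[OF Sym_mono[OF s] cup_Sym0[OF a(1) b(1)] tens_prod_tpow[OF a(2) b(2)]])
  next
    fix n \<alpha> k \<beta> \<sigma> and F H :: "'h tensor"
    assume a: "\<alpha> \<in> Sym0 n" "F \<in> tpow n" and b: "\<beta> \<in> Sym0 k" "H \<in> tpow k" and s: "\<sigma> \<in> Sym k"
    show "g n \<alpha> F k (\<sigma> \<circ> \<beta> \<circ> inv \<sigma>) (Uperm k \<sigma> H) = g n \<alpha> F k \<beta> H"
      unfolding g_def cup_conj_right[OF s a(1)] tens_prod_Uperm_right[OF s a(2) b(2)]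
      by (rule W_conj[OF shift_Sym[OF s] cup_Sym0[OF a(1) b(1)] tens_prod_tpow[OF a(2) b(2)]])
  qed (rule that, assumption, assumption, simp only: g_def)
qed

lemma bilinear_T_eqI:
  fixes m m' :: "'h::real_inner tp \<Rightarrow> 'h tp \<Rightarrow> 'v::ab_group_add"
  assumes m: "\<And>y. Vector_Spaces.linear (*\<^sub>C) sc (\<lambda>x. m x y)" "\<And>x. Vector_Spaces.linear (*\<^sub>C) sc (m x)"
    and m': "\<And>y. Vector_Spaces.linear (*\<^sub>C) sc (\<lambda>x. m' x y)" "\<And>x. Vector_Spaces.linear (*\<^sub>C) sc (m' x)"
    and eq: "\<And>n k \<alpha> \<beta> h g. \<alpha> \<in> Sym0 n \<Longrightarrow> \<beta> \<in> Sym0 k \<Longrightarrow>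
      m (T q n (ga \<alpha>) (tens (tab n h))) (T q k (ga \<beta>) (tens (tab k g))) =
      m' (T q n (ga \<alpha>) (tens (tab n h))) (T q k (ga \<beta>) (tens (tab k g)))"
  shows "m x y = m' x y"
proof (induction x rule: T_induct[where q = q])
  case (gen n \<alpha> h)
  show ?case
  proof (induction y rule: T_induct[where q = q])
    case (gen k \<beta> g)
    then show ?case using \<open>\<alpha> \<in> Sym0 n\<close> by (intro eq)
  next
    case (add x y)
    then show ?case by (simp only: linear_tpD(1)[OF m(2)] linear_tpD(1)[OF m'(2)])
  next
    case (scale c x)
    then show ?case by (simp only: linear_tpD(2)[OF m(2)] linear_tpD(2)[OF m'(2)])
  qed
next
  case (add x y)
  then show ?case by (simp only: linear_tpD(1)[OF m(1)] linear_tpD(1)[OF m'(1)])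
next
  case (scale c x)
  then show ?case by (simp only: linear_tpD(2)[OF m(1)] linear_tpD(2)[OF m'(1)])
qed

lemma tp_mult:
  shows linear_tp_mult_left: "clinear (\<lambda>x. tp_mult q x y :: 'h::real_inner tp)"
    and linear_tp_mult_right: "clinear (tp_mult q x :: 'h tp \<Rightarrow> 'h tp)"
    and tp_mult_T: "\<alpha> \<in> Sym0 n \<Longrightarrow> \<beta> \<in> Sym0 k \<Longrightarrow> F \<in> tpow n \<Longrightarrow> G \<in> tpow k \<Longrightarrow>
      tp_mult q (T q n (ga \<alpha>) F) (T q k (ga \<beta>) G :: 'h tp) = T q (n + k) (ga (cup n \<alpha> \<beta>)) (tens_prod F G)"
proof -
  define P where "P m \<longleftrightarrow> (\<forall>y. clinear (\<lambda>x. m x y)) \<and> (\<forall>x. clinear (m x)) \<and>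
     (\<forall>n k. \<forall>\<alpha>\<in>Sym0 n. \<forall>\<beta>\<in>Sym0 k. \<forall>F\<in>tpow n. \<forall>G\<in>tpow k.
        m (T q n (ga \<alpha>) F) (T q k (ga \<beta>) G) = T q (n + k) (ga (cup n \<alpha> \<beta>)) (tens_prod F G))"
    for m :: "'h tp \<Rightarrow> 'h tp \<Rightarrow> 'h tp"
  obtain J :: "'h tp \<Rightarrow> 'h tp \<Rightarrow> 'h tp" where J: "\<And>y. clinear (\<lambda>x. J x y)" "\<And>x. clinear (J x)"
    "\<And>n \<alpha> F k \<beta> H. \<alpha> \<in> Sym0 n \<Longrightarrow> F \<in> tpow n \<Longrightarrow> \<beta> \<in> Sym0 k \<Longrightarrow> H \<in> tpow k \<Longrightarrow>
      J (W n (ga \<alpha>) F) (W k (ga \<beta>) H) = W (n + k) (ga (cup n \<alpha> \<beta>)) (tens_prod F H)"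
    by (rule juxtaposition_ex) blast
  have PJ: "P (\<lambda>x y. TT q (J (inv (TT q) x) (inv (TT q) y)))"
    unfolding P_def
  proof (intro conjI allI ballI)
    fix y show "clinear (\<lambda>x. TT q (J (inv (TT q) x) (inv (TT q) y)))"
      by (rule linear_tpI[OF tp.vector_space_axioms])
         (simp_all only: linear_tpD[OF linear_inv_TT] linear_tpD[OF J(1)] linear_tpD[OF linear_TT])
  next
    fix x show "clinear (\<lambda>y. TT q (J (inv (TT q) x) (inv (TT q) y)))"
      by (rule linear_tpI[OF tp.vector_space_axioms])
         (simp_all only: linear_tpD[OF linear_inv_TT] linear_tpD[OF J(2)] linear_tpD[OF linear_TT])
  next
    fix n k \<alpha> \<beta> and F G :: "'h tensor"
    assume a: "\<alpha> \<in> Sym0 n" and b: "\<beta> \<in> Sym0 k" and F: "F \<in> tpow n" and G: "G \<in> tpow k"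
    show "TT q (J (inv (TT q) (T q n (ga \<alpha>) F)) (inv (TT q) (T q k (ga \<beta>) G))) =
      T q (n + k) (ga (cup n \<alpha> \<beta>)) (tens_prod F G)"
      unfolding inv_TT_T[OF a F] inv_TT_T[OF b G] J(3)[OF a F b G]
      by (rule TT_W[OF cup_Sym0[OF a b] tens_prod_tpow[OF F G]])
  qed
  have PD: "\<forall>y. clinear (\<lambda>x. m x y)" "\<forall>x. clinear (m x)" if "P m" for m
    using conjunct1[OF that[unfolded P_def]] conjunct1[OF conjunct2[OF that[unfolded P_def]]] .
  have "m = m'" if m: "P m" "P m'" for m m'
  proof (rule ext, rule ext, rule bilinear_T_eqI[where m = m and m' = m' and q = q and sc = "(*\<^sub>C)"])
    show "clinear (\<lambda>x. m x y)" "clinear (\<lambda>x. m' x y)" for y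
      by (rule spec[OF PD(1)[OF m(1)]], rule spec[OF PD(1)[OF m(2)]])
    show "clinear (m x)" "clinear (m' x)" for x
      by (rule spec[OF PD(2)[OF m(1)]], rule spec[OF PD(2)[OF m(2)]])
    fix n k \<alpha> \<beta> and h g :: "nat \<Rightarrow> 'h" assume "\<alpha> \<in> Sym0 n" "\<beta> \<in> Sym0 k"
    then have "m (T q n (ga \<alpha>) (tens (tab n h))) (T q k (ga \<beta>) (tens (tab k g))) =
        T q (n + k) (ga (cup n \<alpha> \<beta>)) (tens_prod (tens (tab n h)) (tens (tab k g)))"
      if "P m" for m using that tens_tab_tpow[of n h] tens_tab_tpow[of k g] by (simp only: P_def)
    from this[OF m(1)] this[OF m(2)]
    show "m (T q n (ga \<alpha>) (tens (tab n h))) (T q k (ga \<beta>) (tens (tab k g))) =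
      m' (T q n (ga \<alpha>) (tens (tab n h))) (T q k (ga \<beta>) (tens (tab k g)))" by (simp only:)
  qed
  note uniq = this
  have "P (THE m. P m)"
  proof (rule theI[of P])
    show "P (\<lambda>x y. TT q (J (inv (TT q) x) (inv (TT q) y)))" by (rule PJ)
    show "m = (\<lambda>x y. TT q (J (inv (TT q) x) (inv (TT q) y)))" if "P m" for m
      by (rule uniq[OF that PJ])
  qed
  moreover have "(THE m. P m) = tp_mult q" unfolding tp_mult_def P_def ..
  ultimately have "P (tp_mult q)" by simp
  then show "clinear (\<lambda>x. tp_mult q x y)" "clinear (tp_mult q x)"
    "\<alpha> \<in> Sym0 n \<Longrightarrow> \<beta> \<in> Sym0 k \<Longrightarrow> F \<in> tpow n \<Longrightarrow> G \<in> tpow k \<Longrightarrow>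
      tp_mult q (T q n (ga \<alpha>) F) (T q k (ga \<beta>) G) = T q (n + k) (ga (cup n \<alpha> \<beta>)) (tens_prod F G)"
    unfolding P_def by blast+
qed

lemma inv_conj_Sym:
  assumes s: "\<sigma> \<in> Sym n" and a: "\<alpha> \<in> Sym0 n"
  shows "inv (\<sigma> \<circ> \<alpha> \<circ> inv \<sigma>) = \<sigma> \<circ> inv \<alpha> \<circ> inv \<sigma>"
  by (rule inv_unique_comp)
     (simp_all add: fun_eq_iff permutes_inverses[OF Sym_permutes[OF s]] permutes_inverses[OF Sym0_permutes[OF a]])

text \<open>Inverting a permutation commutes with contraction, so the involution inverts permutations in
  the generators \<open>W\<close> just as in the generators \<open>T\<close>.\<close>

lemma tp_star:
  shows tp_star_add: "tp_star q (x + y) = tp_star q x + (tp_star q y :: 'h::real_inner tp)"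
    and tp_star_scale: "tp_star q (c *\<^sub>C x) = cnj c *\<^sub>C (tp_star q x :: 'h tp)"
    and tp_star_W: "\<alpha> \<in> Sym0 n \<Longrightarrow> F \<in> tpow n \<Longrightarrow> tp_star q (W n (ga \<alpha>) F :: 'h tp) = W n (ga (inv \<alpha>)) F"
    and tp_star_T: "\<alpha> \<in> Sym0 n \<Longrightarrow> F \<in> tpow n \<Longrightarrow> tp_star q (T q n (ga \<alpha>) F :: 'h tp) = T q n (ga (inv \<alpha>)) F"
proof -
  define P where "P s \<longleftrightarrow> cantilinear s \<and>
     (\<forall>n. \<forall>\<alpha>\<in>Sym0 n. \<forall>F\<in>tpow n. s (T q n (ga \<alpha>) F) = T q n (ga (inv \<alpha>)) F)" for s :: "'h tp \<Rightarrow> 'h tp"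
  have "\<exists>!S. Vector_Spaces.linear (*\<^sub>C) (\<lambda>c (x :: 'h tp). cnj c *\<^sub>C x) S \<and>
    (\<forall>n. \<forall>\<alpha>\<in>Sym0 n. \<forall>F :: 'h tensor\<in>tpow n. S (W n (ga \<alpha>) F) = W n (ga (inv \<alpha>)) F)"
  proof (rule tp_lift_ex1[OF vector_space_cnj_scaleC])
    fix n \<alpha> a b and F G :: "'h tensor" assume "\<alpha> \<in> Sym0 n" "F \<in> tpow n" "G \<in> tpow n"
    then show "W n (ga (inv \<alpha>)) (a *\<^sub>R F + b *\<^sub>R G) =
      cnj (of_real a) *\<^sub>C W n (ga (inv \<alpha>)) F + cnj (of_real b) *\<^sub>C W n (ga (inv \<alpha>)) G"
      by (simp only: W_lin Sym0_inv complex_cnj_complex_of_real)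
  next
    fix n \<sigma> \<alpha> and F :: "'h tensor" assume s: "\<sigma> \<in> Sym n" and a: "\<alpha> \<in> Sym0 n" and F: "F \<in> tpow n"
    show "W n (ga (inv (\<sigma> \<circ> \<alpha> \<circ> inv \<sigma>))) (Uperm n \<sigma> F) = W n (ga (inv \<alpha>)) F"
      unfolding inv_conj_Sym[OF s a] by (rule W_conj[OF s Sym0_inv[OF a] F])
  qed
  then obtain S where lin: "Vector_Spaces.linear (*\<^sub>C) (\<lambda>c (x :: 'h tp). cnj c *\<^sub>C x) S"
    and val: "\<And>n \<alpha> F. \<alpha> \<in> Sym0 n \<Longrightarrow> F \<in> tpow n \<Longrightarrow> S (W n (ga \<alpha>) F) = W n (ga (inv \<alpha>)) F"
    by (auto dest: ex1_implies_ex)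
  have ST: "S (T q n (ga \<alpha>) F) = T q n (ga (inv \<alpha>)) F" if a: "\<alpha> \<in> Sym0 n" and F: "F \<in> tpow n" for n \<alpha> F
    unfolding T_expand[OF a] T_expand[OF Sym0_inv[OF a]] linear_tp_sum[OF lin]
  proof (rule sum.cong[OF refl])
    fix \<pi> assume p: "\<pi> \<in> P12 n"
    show "S (contr_term q n \<alpha> F \<pi>) = contr_term q n (inv \<alpha>) F \<pi>"
      unfolding contr_term_def cweight_def linear_tpD(2)[OF lin] val[OF red_Sym0[OF p a] contr_tens_tpow[OF p F]]
        red_inv[OF p a] complex_cnj_complex_of_real ..
  qed
  have PS: "P S" using ST linear_tpD[OF lin] by (simp add: P_def cantilinear_def)
  moreover have "s = S" if "P s" for s
  proof
    fix x :: "'h tp"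
    have s: "s (x + y) = s x + s y" "s (c *\<^sub>C x) = cnj c *\<^sub>C s x" for x y c
      using that by (simp_all add: P_def cantilinear_def)
    show "s x = S x"
    proof (induction x rule: T_induct[where q = q])
      case (gen n \<alpha> h)
      then show ?case using that PS tens_tab_tpow unfolding P_def by metis
    qed (simp_all only: s linear_tpD[OF lin])
  qed
  ultimately have "(THE s. P s) = S" by (rule the_equality)
  moreover have "(THE s. P s) = tp_star q" unfolding tp_star_def P_def ..
  ultimately have eq: "tp_star q = S" by simp
  show "tp_star q (x + y) = tp_star q x + tp_star q y" "tp_star q (c *\<^sub>C x) = cnj c *\<^sub>C tp_star q x"
    "\<alpha> \<in> Sym0 n \<Longrightarrow> F \<in> tpow n \<Longrightarrow> tp_star q (W n (ga \<alpha>) F) = W n (ga (inv \<alpha>)) F"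
    "\<alpha> \<in> Sym0 n \<Longrightarrow> F \<in> tpow n \<Longrightarrow> tp_star q (T q n (ga \<alpha>) F) = T q n (ga (inv \<alpha>)) F"
    unfolding eq by (rule linear_tpD[OF lin] val ST; assumption?)+
qed

lemma tp_star_star: "tp_star q (tp_star q x) = (x :: 'h::real_inner tp)"
proof (induction x rule: tp_induct)
  case (gen n \<alpha> h)
  have "inv (inv \<alpha>) = \<alpha>" by (rule permutes_inv_inv[OF Sym0_permutes[OF gen]])
  then show ?case by (simp only: tp_star_W[OF gen tens_tab_tpow] tp_star_W[OF Sym0_inv[OF gen] tens_tab_tpow])
next
  case (scale c x)
  then show ?case by (simp only: tp_star_scale complex_cnj_cnj)
qed (simp only: tp_star_add)

lemma chi_conj:
  assumes "\<gamma> \<in> Sym0 n" "\<sigma> \<in> Sym0 n" shows "chi q n (\<sigma> \<circ> \<gamma> \<circ> inv \<sigma>) = chi q n \<gamma>"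
  unfolding chi_def perm_len_def by (simp only: cyc0_conj Sym0_permutes[OF assms(1)] Sym0_permutes[OF assms(2)] finite_atLeastAtMost atLeastAtMost_iff le0 simp_thms)

definition qsum :: "real \<Rightarrow> nat \<Rightarrow> (nat \<Rightarrow> nat) \<Rightarrow> 'h::real_inner tensor \<Rightarrow> (nat \<Rightarrow> nat) \<Rightarrow> 'h tensor \<Rightarrow> real" where
  "qsum q n \<alpha> F \<beta> G = (\<Sum>\<sigma>\<in>Sym n. chi q n (\<alpha> \<circ> \<sigma> \<circ> inv \<beta> \<circ> inv \<sigma>) * tens_inner F (Uperm n \<sigma> G))"

lemma Sym_in_Sym0: "\<sigma> \<in> Sym n \<Longrightarrow> \<sigma> \<in> Sym0 n"
  by (simp add: Sym0_def Sym_permutes0)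

lemma Sym0_comp: "\<alpha> \<in> Sym0 n \<Longrightarrow> \<beta> \<in> Sym0 n \<Longrightarrow> \<alpha> \<circ> \<beta> \<in> Sym0 n"
  by (simp add: Sym0_def permutes_compose)

lemma qsum_conj_left:
  assumes a: "\<alpha> \<in> Sym0 n" and F: "F \<in> tpow n" and b: "\<beta> \<in> Sym0 n" and G: "G \<in> tpow n" and t: "\<tau> \<in> Sym n"
  shows "qsum q n (\<tau> \<circ> \<alpha> \<circ> inv \<tau>) (Uperm n \<tau> F) \<beta> G = qsum q n \<alpha> F \<beta> G"
proof -
  note inv = permutes_inverses[OF Sym_permutes[OF t]]
  let ?f = "\<lambda>\<sigma>. chi q n (\<tau> \<circ> \<alpha> \<circ> inv \<tau> \<circ> \<sigma> \<circ> inv \<beta> \<circ> inv \<sigma>) * tens_inner (Uperm n \<tau> F) (Uperm n \<sigma> G)"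
  have "qsum q n (\<tau> \<circ> \<alpha> \<circ> inv \<tau>) (Uperm n \<tau> F) \<beta> G = (\<Sum>\<sigma>\<in>Sym n. ?f (\<tau> \<circ> \<sigma>))"
    unfolding qsum_def Sym_def by (rule setum_permutations_compose_left[OF Sym_permutes[OF t]])
  also have "\<dots> = qsum q n \<alpha> F \<beta> G"
    unfolding qsum_def
  proof (rule sum.cong[OF refl])
    fix \<sigma> assume s: "\<sigma> \<in> Sym n"
    have "\<tau> \<circ> \<alpha> \<circ> inv \<tau> \<circ> (\<tau> \<circ> \<sigma>) \<circ> inv \<beta> \<circ> inv (\<tau> \<circ> \<sigma>) = \<tau> \<circ> (\<alpha> \<circ> \<sigma> \<circ> inv \<beta> \<circ> inv \<sigma>) \<circ> inv \<tau>"
      unfolding inv_comp_Sym[OF t s] by (simp add: fun_eq_iff inv)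
    moreover have "\<alpha> \<circ> \<sigma> \<circ> inv \<beta> \<circ> inv \<sigma> \<in> Sym0 n"
      by (intro Sym0_comp Sym0_inv Sym_in_Sym0 a b s)
    ultimately have "chi q n (\<tau> \<circ> \<alpha> \<circ> inv \<tau> \<circ> (\<tau> \<circ> \<sigma>) \<circ> inv \<beta> \<circ> inv (\<tau> \<circ> \<sigma>)) = chi q n (\<alpha> \<circ> \<sigma> \<circ> inv \<beta> \<circ> inv \<sigma>)"
      by (simp only: chi_conj Sym_in_Sym0[OF t])
    moreover have "tens_inner (Uperm n \<tau> F) (Uperm n (\<tau> \<circ> \<sigma>) G) = tens_inner F (Uperm n \<sigma> G)"
      unfolding Uperm_comp[OF t s G, symmetric] by (rule tens_inner_Uperm[OF t F Uperm_tpow[OF s G]])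
    ultimately show "?f (\<tau> \<circ> \<sigma>) = chi q n (\<alpha> \<circ> \<sigma> \<circ> inv \<beta> \<circ> inv \<sigma>) * tens_inner F (Uperm n \<sigma> G)" by (simp only:)
  qed
  finally show ?thesis .
qed

text \<open>Replace \<open>\<sigma>\<close> by \<open>\<sigma>\<^sup>-\<^sup>1\<close>, and use that \<open>\<chi>\<^sub>q\<close> is a class function on all of \<open>Sym0 n\<close> and that \<open>U\<^sub>\<sigma>\<close> is
  orthogonal.\<close>

lemma qsum_swap:
  assumes a: "\<alpha> \<in> Sym0 n" and F: "F \<in> tpow n" and b: "\<beta> \<in> Sym0 n" and G: "G \<in> tpow n"
  shows "qsum q n \<alpha> F (inv \<beta>) G = qsum q n \<beta> G (inv \<alpha>) F"
proof -
  have ii: "inv (inv \<alpha>) = \<alpha>" "inv (inv \<beta>) = \<beta>"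
    by (rule permutes_inv_inv[OF Sym0_permutes[OF a]], rule permutes_inv_inv[OF Sym0_permutes[OF b]])
  have "qsum q n \<alpha> F (inv \<beta>) G = (\<Sum>\<sigma>\<in>Sym n. chi q n (\<alpha> \<circ> inv \<sigma> \<circ> \<beta> \<circ> inv (inv \<sigma>)) * tens_inner F (Uperm n (inv \<sigma>) G))"
    unfolding qsum_def Sym_def ii by (rule sum_permutations_inverse)
  also have "\<dots> = qsum q n \<beta> G (inv \<alpha>) F"
    unfolding qsum_def ii
  proof (rule sum.cong[OF refl])
    fix \<sigma> assume s: "\<sigma> \<in> Sym n"
    note inv = permutes_inverses[OF Sym_permutes[OF s]]
    have si: "inv (inv \<sigma>) = \<sigma>" by (rule permutes_inv_inv[OF Sym_permutes[OF s]])
    define \<mu> where "\<mu> = \<beta> \<circ> \<sigma>"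
    have \<mu>: "\<mu> \<in> Sym0 n" unfolding \<mu>_def by (intro Sym0_comp b Sym_in_Sym0 s)
    have "\<beta> \<circ> \<sigma> \<circ> \<alpha> \<circ> inv \<sigma> = \<mu> \<circ> (\<alpha> \<circ> inv \<sigma> \<circ> \<beta> \<circ> \<sigma>) \<circ> inv \<mu>"
      using permutes_inverses[OF Sym0_permutes[OF \<mu>]] by (simp add: fun_eq_iff \<mu>_def)
    moreover have "\<alpha> \<circ> inv \<sigma> \<circ> \<beta> \<circ> \<sigma> \<in> Sym0 n" by (intro Sym0_comp Sym_in_Sym0 Sym_inv a b s)
    ultimately have "chi q n (\<beta> \<circ> \<sigma> \<circ> \<alpha> \<circ> inv \<sigma>) = chi q n (\<alpha> \<circ> inv \<sigma> \<circ> \<beta> \<circ> \<sigma>)"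
      by (simp only: chi_conj[OF _ \<mu>])
    moreover have "tens_inner F (Uperm n (inv \<sigma>) G) = tens_inner G (Uperm n \<sigma> F)"
    proof -
      have "tens_inner F (Uperm n (inv \<sigma>) G) = tens_inner (Uperm n \<sigma> F) (Uperm n \<sigma> (Uperm n (inv \<sigma>) G))"
        by (rule tens_inner_Uperm[OF s F Uperm_tpow[OF Sym_inv[OF s] G], symmetric])
      also have "Uperm n \<sigma> (Uperm n (inv \<sigma>) G) = G"
        unfolding Uperm_comp[OF s Sym_inv[OF s] G] permutes_inv_o(1)[OF Sym_permutes[OF s]] by (rule Uperm_id[OF G])
      also have "tens_inner (Uperm n \<sigma> F) G = tens_inner G (Uperm n \<sigma> F)"
        by (rule tens_inner_commute[OF Uperm_tpow[OF s F] G])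
      finally show ?thesis .
    qed
    ultimately show "chi q n (\<alpha> \<circ> inv \<sigma> \<circ> \<beta> \<circ> inv (inv \<sigma>)) * tens_inner F (Uperm n (inv \<sigma>) G) =
      chi q n (\<beta> \<circ> \<sigma> \<circ> \<alpha> \<circ> inv \<sigma>) * tens_inner G (Uperm n \<sigma> F)" by (simp only: si)
  qed
  finally show ?thesis .
qed

lemma qsum_conj_right:
  assumes a: "\<alpha> \<in> Sym0 n" and F: "F \<in> tpow n" and b: "\<beta> \<in> Sym0 n" and G: "G \<in> tpow n" and t: "\<tau> \<in> Sym n"
  shows "qsum q n \<alpha> F (\<tau> \<circ> \<beta> \<circ> inv \<tau>) (Uperm n \<tau> G) = qsum q n \<alpha> F \<beta> G"
proof -
  have swap: "qsum q n \<alpha> F \<gamma> H = qsum q n (inv \<gamma>) H (inv \<alpha>) F" if "\<gamma> \<in> Sym0 n" "H \<in> tpow n" for \<gamma> H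
    using qsum_swap[OF a F Sym0_inv[OF that(1)] that(2)] permutes_inv_inv[OF Sym0_permutes[OF that(1)]] by simp
  show ?thesis
    unfolding swap[OF Sym0_conj[OF t b] Uperm_tpow[OF t G]] swap[OF b G] inv_conj_Sym[OF t b]
    by (rule qsum_conj_left[OF Sym0_inv[OF b] G Sym0_inv[OF a] F t])
qed

lemma qsum_lin:
  "qsum q n \<alpha> (a *\<^sub>R F + b *\<^sub>R F') \<beta> G = a * qsum q n \<alpha> F \<beta> G + b * qsum q n \<alpha> F' \<beta> G"
  "qsum q n \<alpha> F \<beta> (a *\<^sub>R G + b *\<^sub>R G') = a * qsum q n \<alpha> F \<beta> G + b * qsum q n \<alpha> F \<beta> G'"
proof -
  show "qsum q n \<alpha> (a *\<^sub>R F + b *\<^sub>R F') \<beta> G = a * qsum q n \<alpha> F \<beta> G + b * qsum q n \<alpha> F' \<beta> G"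
    unfolding qsum_def tens_inner_lin by (simp add: sum.distrib sum_distrib_left algebra_simps)
  have "(\<Sum>\<sigma>\<in>Sym n. chi q n (\<alpha> \<circ> \<sigma> \<circ> inv \<beta> \<circ> inv \<sigma>) * tens_inner F (Uperm n \<sigma> (a *\<^sub>R G + b *\<^sub>R G'))) =
    (\<Sum>\<sigma>\<in>Sym n. a * (chi q n (\<alpha> \<circ> \<sigma> \<circ> inv \<beta> \<circ> inv \<sigma>) * tens_inner F (Uperm n \<sigma> G)) +
      b * (chi q n (\<alpha> \<circ> \<sigma> \<circ> inv \<beta> \<circ> inv \<sigma>) * tens_inner F (Uperm n \<sigma> G')))"
    by (rule sum.cong[OF refl]) (simp add: Uperm_lin tens_inner_lin algebra_simps)
  then show "qsum q n \<alpha> F \<beta> (a *\<^sub>R G + b *\<^sub>R G') = a * qsum q n \<alpha> F \<beta> G + b * qsum q n \<alpha> F \<beta> G'"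
    unfolding qsum_def sum.distrib sum_distrib_left .
qed

lemma qform:
  shows linear_qform: "clinear_functional (\<lambda>x :: 'h tp. qform q x y)"
    and antilinear_qform: "Vector_Spaces.linear (*\<^sub>C) (\<lambda>c z. cnj c * z) (qform q (x :: 'h tp))"
    and qform_W: "\<alpha> \<in> Sym0 n \<Longrightarrow> \<beta> \<in> Sym0 k \<Longrightarrow> F \<in> tpow n \<Longrightarrow> G \<in> tpow k \<Longrightarrow>
      qform q (W n (ga \<alpha>) F) (W k (ga \<beta>) G :: 'h::real_inner tp) = (if n = k then of_real (qsum q n \<alpha> F \<beta> G) else 0)"
proof -
  define P where "P B \<longleftrightarrow> sesquilinear B \<and>
     (\<forall>n k. \<forall>\<alpha>\<in>Sym0 n. \<forall>\<beta>\<in>Sym0 k. \<forall>F\<in>tpow n. \<forall>G\<in>tpow k.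
        B (W n (ga \<alpha>) F) (W k (ga \<beta>) G) = (if n = k then of_real (qsum q n \<alpha> F \<beta> G) else 0))"
    for B :: "'h tp \<Rightarrow> 'h tp \<Rightarrow> complex"
  define g where "g n \<alpha> F k \<beta> G = (if n = k then complex_of_real (qsum q n \<alpha> F \<beta> G) else 0)"
    for n :: nat and \<alpha> and F :: "'h tensor" and k :: nat and \<beta> and G :: "'h tensor"
  obtain B where B: "\<And>y. clinear_functional (\<lambda>x. B x y)"
    "\<And>x. Vector_Spaces.linear (*\<^sub>C) (\<lambda>c z. cnj c * z) (B x)"
    "\<And>n \<alpha> F k \<beta> H. \<alpha> \<in> Sym0 n \<Longrightarrow> F \<in> tpow n \<Longrightarrow> \<beta> \<in> Sym0 k \<Longrightarrow> H \<in> tpow k \<Longrightarrow>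
      B (W n (ga \<alpha>) F) (W k (ga \<beta>) H) = g n \<alpha> F k \<beta> H"
  proof (rule tp_bilift[OF vector_space_mult vector_space_cnj_mult, of g])
    show "a * (cnj b * v) = cnj b * (a * v)" for a b v :: complex by simp
    show "g n \<alpha> (a *\<^sub>R F + b *\<^sub>R G) k \<beta> H = of_real a * g n \<alpha> F k \<beta> H + of_real b * g n \<alpha> G k \<beta> H"
      for n \<alpha> a b F G k \<beta> H by (simp add: g_def qsum_lin)
    show "g n \<alpha> H k \<beta> (a *\<^sub>R F + b *\<^sub>R G) = cnj (of_real a) * g n \<alpha> H k \<beta> F + cnj (of_real b) * g n \<alpha> H k \<beta> G"
      for n \<alpha> a b F G k \<beta> H by (simp add: g_def qsum_lin)
  next
    fix n \<alpha> k \<beta> \<sigma> and F H :: "'h tensor"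
    assume *: "\<alpha> \<in> Sym0 n" "F \<in> tpow n" "\<beta> \<in> Sym0 k" "H \<in> tpow k" "\<sigma> \<in> Sym n"
    show "g n (\<sigma> \<circ> \<alpha> \<circ> inv \<sigma>) (Uperm n \<sigma> F) k \<beta> H = g n \<alpha> F k \<beta> H"
      unfolding g_def using * qsum_conj_left[of \<alpha> n F \<beta> H \<sigma> q] by (cases "n = k") (simp_all only: if_True if_False simp_thms)
  next
    fix n \<alpha> k \<beta> \<sigma> and F H :: "'h tensor"
    assume *: "\<alpha> \<in> Sym0 n" "F \<in> tpow n" "\<beta> \<in> Sym0 k" "H \<in> tpow k" "\<sigma> \<in> Sym k"
    show "g n \<alpha> F k (\<sigma> \<circ> \<beta> \<circ> inv \<sigma>) (Uperm k \<sigma> H) = g n \<alpha> F k \<beta> H"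
      unfolding g_def using * qsum_conj_right[of \<alpha> n F \<beta> H \<sigma> q] by (cases "n = k") (simp_all only: if_True if_False simp_thms)
  qed (rule that, assumption+)
  have "sesquilinear B"
    unfolding sesquilinear_def
  proof (intro conjI allI)
    show "clinear_functional (\<lambda>x. B x y)" for y by (rule B(1))
    show "clinear_functional (\<lambda>y. cnj (B x y))" for x
      by (rule linear_tpI[OF vector_space_mult]) (simp_all add: linear_tpD[OF B(2)])
  qed
  then have PB: "P B" using B(3) by (simp add: P_def g_def)
  have anti: "Vector_Spaces.linear (*\<^sub>C) (\<lambda>c z. cnj c * z) (C x)" if "sesquilinear C"
    for C :: "'h tp \<Rightarrow> 'h tp \<Rightarrow> complex" and x
  proof (rule linear_tpI[OF vector_space_cnj_mult])
    have l: "clinear_functional (\<lambda>y. cnj (C x y))" using that by (simp add: sesquilinear_def)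
    show "C x (y + z) = C x y + C x z" for y z
      using arg_cong[OF linear_tpD(1)[OF l], of cnj y z] by simp
    show "C x (c *\<^sub>C y) = cnj c * C x y" for c y
      using arg_cong[OF linear_tpD(2)[OF l], of cnj c y] by simp
  qed
  have "C = B" if C: "P C" for C
  proof (intro ext)
    fix x y
    have C1: "clinear_functional (\<lambda>x. C x y)" for y using C by (simp add: P_def sesquilinear_def)
    have C2: "Vector_Spaces.linear (*\<^sub>C) (\<lambda>c z. cnj c * z) (C x)" for x
      using C anti by (simp add: P_def)
    show "C x y = B x y"
    proof (rule linear_tp_eqI[OF C1 B(1)], rule linear_tp_eqI[OF C2 B(2)])
      fix n \<alpha> k \<beta> and F G :: "'h tensor"
      assume "\<alpha> \<in> Sym0 n" "F \<in> tpow n" "\<beta> \<in> Sym0 k" "G \<in> tpow k"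
      then show "C (W n (ga \<alpha>) F) (W k (ga \<beta>) G) = B (W n (ga \<alpha>) F) (W k (ga \<beta>) G)"
        using C PB unfolding P_def by metis
    qed
  qed
  then have "(THE B. P B) = B" using PB by (intro the_equality) 
  moreover have "(THE B. P B) = qform q" unfolding qform_def P_def qsum_def ..
  ultimately have eq: "qform q = B" by simp
  show "clinear_functional (\<lambda>x. qform q x y)" "Vector_Spaces.linear (*\<^sub>C) (\<lambda>c z. cnj c * z) (qform q x)"
    unfolding eq by (rule B)+
  show "\<alpha> \<in> Sym0 n \<Longrightarrow> \<beta> \<in> Sym0 k \<Longrightarrow> F \<in> tpow n \<Longrightarrow> G \<in> tpow k \<Longrightarrow>
      qform q (W n (ga \<alpha>) F) (W k (ga \<beta>) G) = (if n = k then of_real (qsum q n \<alpha> F \<beta> G) else 0)"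
    unfolding eq using B(3) by (simp add: g_def)
qed



section \<open>The vacuum functional\<close>

lemma P2_iff:
  assumes p: "\<pi> \<in> P12 n" shows "\<pi> \<in> P2 n \<longleftrightarrow> 2 * npairs \<pi> = n" and "\<pi> \<in> P2 n \<longleftrightarrow> psupp \<pi> = {1..n}"
proof -
  have 1: "\<pi> \<in> P2 n \<longleftrightarrow> psupp \<pi> = {1..n}"
    using p P12D(4)[OF p] by (auto simp: P2_def psupp_def)
  show "\<pi> \<in> P2 n \<longleftrightarrow> psupp \<pi> = {1..n}" by (rule 1)
  have "psupp \<pi> = {1..n} \<longleftrightarrow> card (psupp \<pi>) = n"
    using card_subset_eq[OF _ P12D(4)[OF p]] by auto
  then show "\<pi> \<in> P2 n \<longleftrightarrow> 2 * npairs \<pi> = n" unfolding 1 card_psupp[OF p] .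
qed

lemma P2_P12: "\<pi> \<in> P2 n \<Longrightarrow> \<pi> \<in> P12 n"
  by (simp add: P2_def)

text \<open>For a pair partition only the point \<open>0\<close> survives the contraction, so all cycles are lost.\<close>

lemma cyc_in_P2:
  assumes p: "\<pi> \<in> P2 n" and a: "\<alpha> \<in> Sym0 n"
  shows "cyc_in (psupp \<pi>) (\<pi> \<circ> \<alpha>) = cyc0 {0..n} (\<pi> \<circ> \<alpha>)"
proof -
  note p' = P2_P12[OF p]
  note P = P12_comp_permutes[OF p' a]
  have supp: "psupp \<pi> = {1..n}" using p P2_iff(2)[OF p'] by simp
  let ?\<delta> = "erase (psupp \<pi>) (\<pi> \<circ> \<alpha>)"
  have "0 \<in> orbit ?\<delta> 0" by (rule permutation_self_in_orbit[OF permutation_erase[OF P(2)]])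
  then have "{c \<in> orbit ?\<delta> ` {0}. 0 \<notin> c} = {}" by (simp only: image_insert image_empty) auto
  then have "cyc0 {0} ?\<delta> = 0" unfolding cyc0_def by (simp only: card.empty)
  moreover have "{0..n} - psupp \<pi> = {0}" unfolding supp by auto
  moreover have "cyc0 {0..n} (\<pi> \<circ> \<alpha>) = cyc0 ({0..n} - psupp \<pi>) ?\<delta> + cyc_in (psupp \<pi>) (\<pi> \<circ> \<alpha>)"
    using P12D(6)[OF p'] by (intro cyc0_erase P) (auto simp: supp)
  ultimately show ?thesis by simp
qed

lemma qform_sum:
  "qform q (\<Sum>a\<in>A. c a *\<^sub>C x a) (\<Sum>b\<in>B. d b *\<^sub>C y b) = (\<Sum>a\<in>A. \<Sum>b\<in>B. c a * cnj (d b) * qform q (x a) (y b))"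
proof -
  have "qform q (\<Sum>a\<in>A. c a *\<^sub>C x a) (\<Sum>b\<in>B. d b *\<^sub>C y b) = (\<Sum>a\<in>A. qform q (c a *\<^sub>C x a) (\<Sum>b\<in>B. d b *\<^sub>C y b))"
    by (rule linear_tp_sum[OF linear_qform])
  also have "\<dots> = (\<Sum>a\<in>A. \<Sum>b\<in>B. qform q (c a *\<^sub>C x a) (d b *\<^sub>C y b))"
    by (rule sum.cong[OF refl]) (rule linear_tp_sum[OF antilinear_qform])
  also have "\<dots> = (\<Sum>a\<in>A. \<Sum>b\<in>B. c a * cnj (d b) * qform q (x a) (y b))"
    by (intro sum.cong refl) (simp only: linear_tpD(2)[OF linear_qform] linear_tpD(2)[OF antilinear_qform] mult_ac)
  finally show ?thesis .
qed

locale vacuum =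
  fixes q :: real and \<phi> :: "'h::real_inner tp \<Rightarrow> complex"
  assumes q: "q \<noteq> 0" and lin: "clinear_functional \<phi>"
    and unital: "\<phi> (W 0 (ga id) (tens [])) = 1"
    and vanish: "\<And>n \<eta> F. n \<ge> 1 \<Longrightarrow> \<eta> \<in> CSym0 n \<Longrightarrow> F \<in> tpow n \<Longrightarrow> \<phi> (W n \<eta> F) = 0"
begin

lemma phi_W:
  assumes a: "\<alpha> \<in> Sym0 n" and F: "F \<in> tpow n"
  shows "\<phi> (W n (ga \<alpha>) F) = (if n = 0 then of_real (tens_scal F) else 0)"
proof (cases "n = 0")
  case False
  then show ?thesis using a F by (simp add: vanish CSym0_def)
next
  case True
  have id: "\<alpha> = id" using a by (simp add: True Sym0_def)
  note phi_lin = lin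
  have "\<phi> (W 0 (ga id) F) = of_real (tens_scal F)" using F unfolding True
  proof (induction rule: tpow_induct)
    case (tens h)
    show ?case unfolding tab_0 tens_scal(2) using unital by (simp only: if_True of_real_1 simp_thms)
  next
    case (lin a b F G)
    have "id \<in> Sym0 0" by (simp add: Sym0_def permutes_id)
    then show ?case
      unfolding W_lin[OF _ lin(1,2)] linear_tpD[OF phi_lin] lin(3,4) linear_add[OF tens_scal(1)] linear_scale[OF tens_scal(1)]
      by (simp only: W_lin[OF _ lin(1,2)] linear_tpD[OF phi_lin] lin(3,4) of_real_add of_real_mult real_scaleR_def)
  qed
  then show ?thesis by (simp only: True id if_True simp_thms)
qed

lemma phi_T:
  assumes a: "\<alpha> \<in> Sym0 n" and F: "F \<in> tpow n"
  shows "\<phi> (T q n (ga \<alpha>) F) =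
    of_real (\<Sum>\<pi>\<in>P2 n. q powi (int (npairs \<pi>) - int (cyc0 {0..n} (\<pi> \<circ> \<alpha>))) * tens_scal (contr_tens n \<pi> F))"
proof -
  have "\<phi> (T q n (ga \<alpha>) F) =
      (\<Sum>\<pi>\<in>P12 n. if \<pi> \<in> P2 n then of_real (cweight q \<pi> \<alpha> * tens_scal (contr_tens n \<pi> F)) else 0)"
    unfolding T_expand[OF a] linear_tp_sum[OF lin]
  proof (rule sum.cong[OF refl])
    fix \<pi> assume p: "\<pi> \<in> P12 n"
    have "n - 2 * npairs \<pi> = 0 \<longleftrightarrow> \<pi> \<in> P2 n" using P2_iff(1)[OF p] rest_simps(4)[OF p] by auto
    then have "\<phi> (W (n - 2 * npairs \<pi>) (ga (red n \<pi> \<alpha>)) (contr_tens n \<pi> F)) =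
        (if \<pi> \<in> P2 n then of_real (tens_scal (contr_tens n \<pi> F)) else 0)"
      by (simp only: phi_W[OF red_Sym0[OF p a] contr_tens_tpow[OF p F]])
    then show "\<phi> (contr_term q n \<alpha> F \<pi>) =
        (if \<pi> \<in> P2 n then of_real (cweight q \<pi> \<alpha> * tens_scal (contr_tens n \<pi> F)) else 0)"
      unfolding contr_term_def linear_tpD(2)[OF lin] by simp
  qed
  also have "\<dots> = (\<Sum>\<pi>\<in>P2 n. of_real (cweight q \<pi> \<alpha> * tens_scal (contr_tens n \<pi> F)))"
    using P2_P12 by (intro sum.mono_neutral_cong_right finite_P12) auto
  finally show ?thesis by (simp only: of_real_sum cweight_def cyc_in_P2[OF _ a] cong: sum.cong)
qed

text \<open>The product of two transforms \<open>T\<close> is the transform of the juxtaposition, so its expectation is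
  a sum over pair partitions of the union. Sorting these by their pairs within either side
  gives the inner products of the contracted factors.\<close>

lemma phi_mult: "\<phi> (tp_mult q x y) = qform q y (tp_star q x)"
proof (rule bilinear_T_eqI[where m = "\<lambda>x y. \<phi> (tp_mult q x y)" and m' = "\<lambda>x y. qform q y (tp_star q x)"
      and q = q and sc = "(*)"])
  show "clinear_functional (\<lambda>x. \<phi> (tp_mult q x y))" for y
    by (rule linear_tpI[OF vector_space_mult])
       (simp_all only: linear_tpD[OF linear_tp_mult_left] linear_tpD[OF lin])
  show "clinear_functional (\<lambda>y. \<phi> (tp_mult q x y))" for x
    by (rule linear_tpI[OF vector_space_mult])
       (simp_all only: linear_tpD[OF linear_tp_mult_right] linear_tpD[OF lin])
  show "clinear_functional (\<lambda>x. qform q y (tp_star q x))" for y :: "'h tp"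
    by (rule linear_tpI[OF vector_space_mult])
       (simp_all only: tp_star_add tp_star_scale linear_tpD[OF antilinear_qform] complex_cnj_cnj)
  show "clinear_functional (\<lambda>y. qform q y (tp_star q x))" for x :: "'h tp" by (rule linear_qform)
next
  fix k n \<beta> \<alpha> and g h :: "nat \<Rightarrow> 'h"
  assume b: "\<beta> \<in> Sym0 k" and a: "\<alpha> \<in> Sym0 n"
  let ?G = "tens (tab k g)" and ?F = "tens (tab n h)"
  define w where "w i = (if i \<le> k then g i else h (i - k))" for i
  then have w: "w = (\<lambda>i. if i \<le> k then g i else h (i - k))" by blast
  define e1 where "e1 \<pi> = cweight q \<pi> \<beta>" for \<pi>
  define e2 where "e2 \<pi> = cweight q \<pi> \<alpha>" for \<pi>
  define c1 where "c1 \<pi> = (\<Prod>i | i < \<pi> i. g i \<bullet> g (\<pi> i))" for \<pi>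
  define c2 where "c2 \<pi> = (\<Prod>i | i < \<pi> i. h i \<bullet> h (\<pi> i))" for \<pi>
  define t where "t m \<pi>1 \<pi>2 \<sigma> = chi q m (red n \<pi>2 \<alpha> \<circ> \<sigma> \<circ> red k \<pi>1 \<beta> \<circ> inv \<sigma>) *
    (\<Prod>r\<in>{1..m}. h (enum (rest n \<pi>2) r) \<bullet> g (enum (rest k \<pi>1) (inv \<sigma> r)))" for m \<pi>1 \<pi>2 \<sigma>
  define R where "R = (\<Sum>\<pi>1\<in>P12 k. \<Sum>\<pi>2\<in>P12 n. if k - 2 * npairs \<pi>1 = n - 2 * npairs \<pi>2
    then \<Sum>\<sigma>\<in>Sym (k - 2 * npairs \<pi>1). e1 \<pi>1 * e2 \<pi>2 * c1 \<pi>1 * c2 \<pi>2 * t (k - 2 * npairs \<pi>1) \<pi>1 \<pi>2 \<sigma> else 0)"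
  have "\<phi> (tp_mult q (T q k (ga \<beta>) ?G) (T q n (ga \<alpha>) ?F)) = \<phi> (T q (k + n) (ga (cup k \<beta> \<alpha>)) (tens (tab (k + n) w)))"
    by (simp only: tp_mult_T[OF b a tens_tab_tpow tens_tab_tpow] tens_prod_tab w)
  also have "\<dots> = of_real (\<Sum>\<rho>\<in>P2 (k + n). q powi (int (npairs \<rho>) - int (cyc0 {0..k + n} (\<rho> \<circ> cup k \<beta> \<alpha>)))
      * tens_scal (contr_tens (k + n) \<rho> (tens (tab (k + n) w))))"
    by (rule phi_T[OF cup_Sym0[OF b a] tens_tab_tpow])
  also have "\<dots> = of_real R"
    unfolding sum_P2_glue R_def
  proof (intro arg_cong[where f = of_real] sum.cong refl if_cong)
    fix \<pi>1 \<pi>2 \<sigma>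
    assume p1: "\<pi>1 \<in> P12 k" and p2: "\<pi>2 \<in> P12 n" and eq: "k - 2 * npairs \<pi>1 = n - 2 * npairs \<pi>2"
      and s: "\<sigma> \<in> Sym (k - 2 * npairs \<pi>1)"
    define m where "m = k - 2 * npairs \<pi>1"
    interpret G: gluing k n m \<pi>1 \<pi>2 \<sigma> by unfold_locales (use p1 p2 s eq in \<open>simp_all add: m_def\<close>)
    let ?\<rho> = "glue k n \<pi>1 \<pi>2 \<sigma>"
    note P2 = G.glue_P2 and P12 = P2_P12[OF G.glue_P2]
    have "2 * npairs ?\<rho> = k + n" using P2 P2_iff(1)[OF P12] by simp
    moreover have "k = 2 * npairs \<pi>1 + m" "n = 2 * npairs \<pi>2 + m"
      using rest_simps(4)[OF p1] rest_simps(4)[OF p2] eq by (simp_all add: m_def)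
    ultimately have np: "npairs ?\<rho> = npairs \<pi>1 + npairs \<pi>2 + m" and zero: "k + n - 2 * npairs ?\<rho> = 0" by simp_all
    have "red n \<pi>2 \<alpha> \<in> Sym0 m" using red_Sym0[OF p2 a] unfolding m_def eq .
    moreover have "red k \<pi>1 \<beta> \<in> Sym0 m" using red_Sym0[OF p1 b] unfolding m_def .
    ultimately have perm: "red n \<pi>2 \<alpha> \<circ> \<sigma> \<circ> red k \<pi>1 \<beta> \<circ> inv \<sigma> \<in> Sym0 m" (is "?\<gamma> \<in> _")
      by (intro Sym0_comp Sym_in_Sym0[OF G.s] Sym_in_Sym0[OF Sym_inv[OF G.s]])
    have chi: "chi q m ?\<gamma> = q powi (int m - int (cyc0 {0..m} ?\<gamma>))"
      using cyc0_le[OF Sym0_permutation[OF perm], of m] by (simp add: chi_def perm_len_def power_int_def nat_diff_distrib)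
    have "int (npairs ?\<rho>) - int (cyc0 {0..k + n} (?\<rho> \<circ> cup k \<beta> \<alpha>)) =
        (int (npairs \<pi>1) - int (cyc_in (psupp \<pi>1) (\<pi>1 \<circ> \<beta>))) +
        (int (npairs \<pi>2) - int (cyc_in (psupp \<pi>2) (\<pi>2 \<circ> \<alpha>))) + (int m - int (cyc0 {0..m} ?\<gamma>))"
      unfolding np G.cyc0_glue[OF b a] by simp
    then have 1: "q powi (int (npairs ?\<rho>) - int (cyc0 {0..k + n} (?\<rho> \<circ> cup k \<beta> \<alpha>))) = e1 \<pi>1 * e2 \<pi>2 * chi q m ?\<gamma>"
      unfolding e1_def e2_def cweight_def chi using q by (simp only: power_int_add simp_thms)
    have "tens_scal (contr_tens (k + n) ?\<rho> (tens (tab (k + n) w))) = (\<Prod>i | i < ?\<rho> i. w i \<bullet> w (?\<rho> i))"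
      unfolding contr_tens_tab[OF P12] zero by (simp add: linear_scale[OF tens_scal(1)] tens_scal(2))
    also have "\<dots> = (\<Prod>i | i < \<pi>1 i. w i \<bullet> w (\<pi>1 i)) * (\<Prod>j | j < \<pi>2 j. w (emb k j) \<bullet> w (emb k (\<pi>2 j)))
      * (\<Prod>r\<in>{1..m}. w (enum (rest k \<pi>1) (inv \<sigma> r)) \<bullet> w (emb k (enum (rest n \<pi>2) r)))"
      by (rule G.prod_glue)
    also have "(\<Prod>i | i < \<pi>1 i. w i \<bullet> w (\<pi>1 i)) = c1 \<pi>1"
      unfolding c1_def
    proof (rule prod.cong[OF refl])
      fix i assume "i \<in> {i. i < \<pi>1 i}"
      then show "w i \<bullet> w (\<pi>1 i) = g i \<bullet> g (\<pi>1 i)" using G.p1_range[of i] by (simp add: w_def)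
    qed
    also have "(\<Prod>j | j < \<pi>2 j. w (emb k j) \<bullet> w (emb k (\<pi>2 j))) = c2 \<pi>2"
      unfolding c2_def
    proof (rule prod.cong[OF refl])
      fix j assume "j \<in> {j. j < \<pi>2 j}"
      then show "w (emb k j) \<bullet> w (emb k (\<pi>2 j)) = h j \<bullet> h (\<pi>2 j)" using G.p2_range[of j] by (simp add: w_def emb_def)
    qed
    also have "(\<Prod>r\<in>{1..m}. w (enum (rest k \<pi>1) (inv \<sigma> r)) \<bullet> w (emb k (enum (rest n \<pi>2) r))) =
      (\<Prod>r\<in>{1..m}. h (enum (rest n \<pi>2) r) \<bullet> g (enum (rest k \<pi>1) (inv \<sigma> r)))"
    proof (rule prod.cong[OF refl])
      fix r assume r: "r \<in> {1..m}"
      have "enum (rest k \<pi>1) (inv \<sigma> r) \<in> rest k \<pi>1"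
        using r by (intro enum_in G.X1(1)) (simp add: G.X1(3) G.s_le less_Suc_eq_le)
      moreover have "r < card (rest n \<pi>2)" using r by (simp add: G.X2(3))
      then have "enum (rest n \<pi>2) r \<noteq> 0" using rank_enum[OF G.X2(1), of r] r by (metis atLeastAtMost_iff not_one_le_zero rank_0)
      ultimately show "w (enum (rest k \<pi>1) (inv \<sigma> r)) \<bullet> w (emb k (enum (rest n \<pi>2) r)) =
        h (enum (rest n \<pi>2) r) \<bullet> g (enum (rest k \<pi>1) (inv \<sigma> r))"
        by (simp add: w_def emb_def G.X1_iff inner_commute)
    qed
    finally show "q powi (int (npairs ?\<rho>) - int (cyc0 {0..k + n} (?\<rho> \<circ> cup k \<beta> \<alpha>))) *
        tens_scal (contr_tens (k + n) ?\<rho> (tens (tab (k + n) w))) =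
      e1 \<pi>1 * e2 \<pi>2 * c1 \<pi>1 * c2 \<pi>2 * t (k - 2 * npairs \<pi>1) \<pi>1 \<pi>2 \<sigma>"
      unfolding 1 t_def m_def[symmetric] by (simp only: mult_ac)
  qed
  also have "of_real R = qform q (T q n (ga \<alpha>) ?F) (tp_star q (T q k (ga \<beta>) ?G))"
  proof -
    have "qform q (T q n (ga \<alpha>) ?F) (tp_star q (T q k (ga \<beta>) ?G)) =
      (\<Sum>\<pi>2\<in>P12 n. \<Sum>\<pi>1\<in>P12 k. of_real (e2 \<pi>2) * cnj (of_real (e1 \<pi>1)) *
        qform q (W (n - 2 * npairs \<pi>2) (ga (red n \<pi>2 \<alpha>)) (contr_tens n \<pi>2 ?F))
          (W (k - 2 * npairs \<pi>1) (ga (red k \<pi>1 (inv \<beta>))) (contr_tens k \<pi>1 ?G)))"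
    proof -
      have "T q k (ga (inv \<beta>)) ?G = (\<Sum>\<pi>\<in>P12 k. of_real (e1 \<pi>) *\<^sub>C
          W (k - 2 * npairs \<pi>) (ga (red k \<pi> (inv \<beta>))) (contr_tens k \<pi> ?G))"
        unfolding T_expand[OF Sym0_inv[OF b]] contr_term_def e1_def cweight_def
        by (rule sum.cong[OF refl]) (simp only: red_inv(2)[OF _ b])
      moreover have "T q n (ga \<alpha>) ?F = (\<Sum>\<pi>\<in>P12 n. of_real (e2 \<pi>) *\<^sub>C
          W (n - 2 * npairs \<pi>) (ga (red n \<pi> \<alpha>)) (contr_tens n \<pi> ?F))"
        unfolding T_expand[OF a] contr_term_def e2_def ..
      ultimately show ?thesis unfolding tp_star_T[OF b tens_tab_tpow] by (simp only: qform_sum)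
    qed
    also have "\<dots> = (\<Sum>\<pi>2\<in>P12 n. \<Sum>\<pi>1\<in>P12 k. of_real (if k - 2 * npairs \<pi>1 = n - 2 * npairs \<pi>2
      then \<Sum>\<sigma>\<in>Sym (k - 2 * npairs \<pi>1). e1 \<pi>1 * e2 \<pi>2 * c1 \<pi>1 * c2 \<pi>2 * t (k - 2 * npairs \<pi>1) \<pi>1 \<pi>2 \<sigma> else 0))"
    proof (intro sum.cong refl)
      fix \<pi>2 \<pi>1 assume p2: "\<pi>2 \<in> P12 n" and p1: "\<pi>1 \<in> P12 k"
      let ?m = "k - 2 * npairs \<pi>1"
      have G: "contr_tens k \<pi>1 ?G \<in> tpow ?m" by (rule contr_tens_tpow[OF p1 tens_tab_tpow])
      have F: "contr_tens n \<pi>2 ?F \<in> tpow (n - 2 * npairs \<pi>2)" by (rule contr_tens_tpow[OF p2 tens_tab_tpow])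
      have B: "red k \<pi>1 (inv \<beta>) \<in> Sym0 ?m" by (rule red_Sym0[OF p1 Sym0_inv[OF b]])
      note Q = qform_W[OF red_Sym0[OF p2 a] B F G, of q]
      show "of_real (e2 \<pi>2) * cnj (of_real (e1 \<pi>1)) *
        qform q (W (n - 2 * npairs \<pi>2) (ga (red n \<pi>2 \<alpha>)) (contr_tens n \<pi>2 ?F))
          (W ?m (ga (red k \<pi>1 (inv \<beta>))) (contr_tens k \<pi>1 ?G)) =
        of_real (if ?m = n - 2 * npairs \<pi>2
          then \<Sum>\<sigma>\<in>Sym ?m. e1 \<pi>1 * e2 \<pi>2 * c1 \<pi>1 * c2 \<pi>2 * t ?m \<pi>1 \<pi>2 \<sigma> else 0)"
      proof (cases "?m = n - 2 * npairs \<pi>2")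
        case True
        have ri: "inv (red k \<pi>1 (inv \<beta>)) = red k \<pi>1 \<beta>"
          unfolding red_inv(1)[OF p1 b] by (rule permutes_inv_inv[OF Sym0_permutes[OF red_Sym0[OF p1 b]]])
        have "qsum q ?m (red n \<pi>2 \<alpha>) (contr_tens n \<pi>2 ?F) (red k \<pi>1 (inv \<beta>)) (contr_tens k \<pi>1 ?G) =
          (\<Sum>\<sigma>\<in>Sym ?m. c1 \<pi>1 * c2 \<pi>2 * t ?m \<pi>1 \<pi>2 \<sigma>)"
          unfolding qsum_def ri
        proof (rule sum.cong[OF refl])
          fix \<sigma> assume s: "\<sigma> \<in> Sym ?m"
          have "tens_inner (contr_tens n \<pi>2 ?F) (Uperm ?m \<sigma> (contr_tens k \<pi>1 ?G)) =
            tens_inner (c2 \<pi>2 *\<^sub>R tens (tab ?m (h \<circ> enum (rest n \<pi>2))))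
              (c1 \<pi>1 *\<^sub>R tens (tab ?m (g \<circ> enum (rest k \<pi>1) \<circ> inv \<sigma>)))"
            unfolding contr_tens_tab[OF p1] contr_tens_tab[OF p2] True[symmetric] c1_def c2_def
            by (simp only: linear_scale[OF linear_Uperm[OF s]] Uperm_tab[OF s])
          also have "\<dots> = c2 \<pi>2 * (c1 \<pi>1 * (\<Prod>r\<in>{1..?m}. h (enum (rest n \<pi>2) r) \<bullet> g (enum (rest k \<pi>1) (inv \<sigma> r))))"
            by (simp add: linear_scale[OF tens_inner(1)] linear_scale[OF tens_inner(2)] tens_inner_tab)
          finally show "chi q ?m (red n \<pi>2 \<alpha> \<circ> \<sigma> \<circ> red k \<pi>1 \<beta> \<circ> inv \<sigma>) *
              tens_inner (contr_tens n \<pi>2 ?F) (Uperm ?m \<sigma> (contr_tens k \<pi>1 ?G)) = c1 \<pi>1 * c2 \<pi>2 * t ?m \<pi>1 \<pi>2 \<sigma>"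
            unfolding t_def by (simp only: mult_ac)
        qed
        then have "e2 \<pi>2 * e1 \<pi>1 * qsum q ?m (red n \<pi>2 \<alpha>) (contr_tens n \<pi>2 ?F) (red k \<pi>1 (inv \<beta>)) (contr_tens k \<pi>1 ?G) =
          (\<Sum>\<sigma>\<in>Sym ?m. e1 \<pi>1 * e2 \<pi>2 * c1 \<pi>1 * c2 \<pi>2 * t ?m \<pi>1 \<pi>2 \<sigma>)"
          by (simp only: sum_distrib_left mult_ac)
        then show ?thesis unfolding Q unfolding True[symmetric] by (simp flip: of_real_mult of_real_sum)
      next
        case False
        then show ?thesis unfolding Q by simp
      qed
    qed
    also have "\<dots> = of_real R" unfolding R_def of_real_sum by (rule sum.swap)
    finally show ?thesis ..
  qed
  finally show "\<phi> (tp_mult q (T q k (ga \<beta>) ?G) (T q n (ga \<alpha>) ?F)) =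
    qform q (T q n (ga \<alpha>) ?F) (tp_star q (T q k (ga \<beta>) ?G))" .
qed

lemma phi_star_mult: "\<phi> (tp_mult q (tp_star q y) x) = qform q x y"
  by (simp only: phi_mult tp_star_star)

lemma phi_trace: "\<phi> (tp_mult q x y) = \<phi> (tp_mult q y x)"
proof -
  have gen: "qform q (W k (ga \<beta>) G) (tp_star q (W n (ga \<alpha>) F)) = qform q (W n (ga \<alpha>) F) (tp_star q (W k (ga \<beta>) G))"
    if a: "\<alpha> \<in> Sym0 n" and F: "F \<in> tpow n" and b: "\<beta> \<in> Sym0 k" and G: "G \<in> tpow k" for n \<alpha> F k \<beta> and G :: "'h tensor"
    unfolding tp_star_W[OF a F] tp_star_W[OF b G] qform_W[OF a Sym0_inv[OF b] F G] qform_W[OF b Sym0_inv[OF a] G F]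
    using qsum_swap[of \<alpha> n F \<beta> G q] a F b G by (cases "n = k") simp_all
  have "qform q y (tp_star q x) = qform q x (tp_star q y)"
  proof (rule linear_tp_eqI[where f = "\<lambda>x. qform q y (tp_star q x)" and g = "\<lambda>x. qform q x (tp_star q y)" and sc = "(*)"])
    have l: "clinear_functional (\<lambda>x. qform q y (tp_star q x))" for y :: "'h tp"
      by (rule linear_tpI[OF vector_space_mult])
         (simp_all only: tp_star_add tp_star_scale linear_tpD[OF antilinear_qform] complex_cnj_cnj)
    show "clinear_functional (\<lambda>x. qform q y (tp_star q x))" by (rule l)
    show "clinear_functional (\<lambda>x. qform q x (tp_star q y))" by (rule linear_qform)
    fix n \<alpha> and F :: "'h tensor" assume aF: "\<alpha> \<in> Sym0 n" "F \<in> tpow n"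
    show "qform q y (tp_star q (W n (ga \<alpha>) F)) = qform q (W n (ga \<alpha>) F) (tp_star q y)"
      by (rule linear_tp_eqI[where f = "\<lambda>y. qform q y (tp_star q (W n (ga \<alpha>) F))"
            and g = "\<lambda>y. qform q (W n (ga \<alpha>) F) (tp_star q y)" and sc = "(*)"])
         (rule linear_qform, rule l, rule gen[OF aF])
  qed
  then show ?thesis unfolding phi_mult .
qed

lemma phi_eq_qform: "\<phi> x = qform q x (W 0 (ga id) (tens []))"
proof (rule linear_tp_eqI[OF lin, where g = "\<lambda>x. qform q x (W 0 (ga id) (tens []))"])
  show "clinear_functional (\<lambda>x. qform q x (W 0 (ga id) (tens [])))" by (rule linear_qform)
  fix n \<alpha> and F :: "'h tensor" assume a: "\<alpha> \<in> Sym0 n" and F: "F \<in> tpow n"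
  have id: "id \<in> Sym0 0" by (simp add: Sym0_def permutes_id)
  have t: "tens [] \<in> (tpow 0 :: 'h tensor set)" using tens_tab_tpow[of 0] by simp
  have S: "Sym 0 = {id}" by (simp add: Sym_def)
  have "qsum q 0 \<alpha> F id (tens []) = tens_scal F" if "n = 0"
  proof -
    have \<alpha>: "\<alpha> = id" using a that by (simp add: Sym0_def)
    have "qsum q 0 \<alpha> F id (tens []) = tens_inner F (tens [])"
      unfolding qsum_def S \<alpha> using Uperm_id[OF t] by (simp add: chi_def perm_len_def)
    also have "\<dots> = tens_scal F" using F unfolding that
    proof (induction rule: tpow_induct)
      case (tens h)
      show ?case by (simp add: tens_inner(3) tens_scal(2))
    next
      case (lin a b F G)
      then show ?case
        by (simp add: tens_inner_lin linear_add[OF tens_scal(1)] linear_scale[OF tens_scal(1)])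
    qed
    finally show ?thesis .
  qed
  then show "\<phi> (W n (ga \<alpha>) F) = qform q (W n (ga \<alpha>) F) (W 0 (ga id) (tens []))"
    unfolding phi_W[OF a F] qform_W[OF a id F t] by simp
qed

end



section \<open>Positivity\<close>

text \<open>Positive semi-definiteness of a real matrix, tested with complex coefficients.\<close>

definition psd :: "'i set \<Rightarrow> ('i \<Rightarrow> 'i \<Rightarrow> real) \<Rightarrow> bool" where
  "psd I K \<longleftrightarrow> (\<forall>c :: 'i \<Rightarrow> complex. (\<Sum>i\<in>I. \<Sum>j\<in>I. c i * cnj (c j) * of_real (K i j)) \<in> \<real>\<^sub>\<ge>\<^sub>0)"

lemma psdI: "(\<And>c. (\<Sum>i\<in>I. \<Sum>j\<in>I. c i * cnj (c j) * of_real (K i j)) \<in> \<real>\<^sub>\<ge>\<^sub>0) \<Longrightarrow> psd I K"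
  by (simp add: psd_def)

lemma psdD: "psd I K \<Longrightarrow> (\<Sum>i\<in>I. \<Sum>j\<in>I. c i * cnj (c j) * of_real (K i j)) \<in> \<real>\<^sub>\<ge>\<^sub>0"
  by (simp add: psd_def)

lemma psd_cong:
  assumes "psd I K" "\<And>i j. i \<in> I \<Longrightarrow> j \<in> I \<Longrightarrow> K i j = L i j" shows "psd I L"
proof (rule psdI)
  fix c :: "'a \<Rightarrow> complex"
  have "(\<Sum>i\<in>I. \<Sum>j\<in>I. c i * cnj (c j) * of_real (L i j)) = (\<Sum>i\<in>I. \<Sum>j\<in>I. c i * cnj (c j) * of_real (K i j))"
    by (intro sum.cong refl) (simp only: assms(2))
  then show "(\<Sum>i\<in>I. \<Sum>j\<in>I. c i * cnj (c j) * of_real (L i j)) \<in> \<real>\<^sub>\<ge>\<^sub>0" using psdD[OF assms(1)] by (simp only:)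
qed

lemma psd_one: "psd I (\<lambda>_ _. 1)"
proof (rule psdI)
  fix c :: "'a \<Rightarrow> complex"
  have "(\<Sum>i\<in>I. \<Sum>j\<in>I. c i * cnj (c j) * of_real 1) = (\<Sum>i\<in>I. c i) * cnj (\<Sum>i\<in>I. c i)"
    by (simp add: sum_product)
  also have "\<dots> = of_real ((cmod (\<Sum>i\<in>I. c i))\<^sup>2)" by (rule complex_norm_square[symmetric])
  finally show "(\<Sum>i\<in>I. \<Sum>j\<in>I. c i * cnj (c j) * of_real 1) \<in> \<real>\<^sub>\<ge>\<^sub>0" by (simp only: nonneg_Reals_of_real_iff zero_le_power2)
qed

lemma psd_rank_one_mult:
  assumes "psd I K" shows "psd I (\<lambda>i j. u i * u j * K i j)"
proof (rule psdI)
  fix c :: "'a \<Rightarrow> complex"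
  have "(\<Sum>i\<in>I. \<Sum>j\<in>I. c i * cnj (c j) * of_real (u i * u j * K i j)) =
    (\<Sum>i\<in>I. \<Sum>j\<in>I. (c i * of_real (u i)) * cnj (c j * of_real (u j)) * of_real (K i j))"
    by (intro sum.cong refl) (simp add: mult_ac)
  then show "(\<Sum>i\<in>I. \<Sum>j\<in>I. c i * cnj (c j) * of_real (u i * u j * K i j)) \<in> \<real>\<^sub>\<ge>\<^sub>0"
    using psdD[OF assms, of "\<lambda>i. c i * of_real (u i)"] by (simp only:)
qed

lemma psd_sum:
  assumes "\<And>a. a \<in> A \<Longrightarrow> psd I (K a)" shows "psd I (\<lambda>i j. \<Sum>a\<in>A. K a i j)"
proof (rule psdI)
  fix c :: "'b \<Rightarrow> complex"
  have "(\<Sum>i\<in>I. \<Sum>j\<in>I. c i * cnj (c j) * of_real (\<Sum>a\<in>A. K a i j)) =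
    (\<Sum>a\<in>A. \<Sum>i\<in>I. \<Sum>j\<in>I. c i * cnj (c j) * of_real (K a i j))"
    by (simp add: sum_distrib_left sum.swap[of _ A])
  also have "\<dots> \<in> \<real>\<^sub>\<ge>\<^sub>0"
    using assms
  proof (induction A rule: infinite_finite_induct)
    case (insert a A)
    then show ?case
      by (simp only: sum.insert insert_iff simp_thms) (intro nonneg_Reals_add_I psdD, auto)
  qed simp_all
  finally show "(\<Sum>i\<in>I. \<Sum>j\<in>I. c i * cnj (c j) * of_real (\<Sum>a\<in>A. K a i j)) \<in> \<real>\<^sub>\<ge>\<^sub>0" .
qed

lemma psd_scale:
  assumes "psd I K" "0 \<le> r" shows "psd I (\<lambda>i j. r * K i j)"
  using psd_rank_one_mult[OF assms(1), of "\<lambda>_. sqrt r"] assms(2) by simp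

lemma sum_same_value:
  assumes "finite I" "i \<in> I"
  shows "(\<Sum>a\<in>f ` I. of_bool (f i = a) * of_bool (f j = a) * (K a :: real)) = (if f i = f j then K (f i) else 0)"
proof -
  have "(\<Sum>a\<in>f ` I. of_bool (f i = a) * of_bool (f j = a) * K a) =
      (\<Sum>a\<in>f ` I. if a = f i then of_bool (f i = f j) * K (f i) else 0)"
    by (intro sum.cong refl) auto
  also have "\<dots> = (if f i = f j then K (f i) else 0)" using assms by (simp add: sum.delta)
  finally show ?thesis .
qed

lemma psd_same_value:
  assumes "\<And>a. a \<in> f ` I \<Longrightarrow> psd I (K a)" and I: "finite I"
  shows "psd I (\<lambda>i j. if f i = f j then K (f i) i j else 0)"
proof -
  have "psd I (\<lambda>i j. \<Sum>a\<in>f ` I. of_bool (f i = a) * of_bool (f j = a) * K a i j)"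
    by (intro psd_sum psd_rank_one_mult assms(1))
  then show ?thesis by (rule psd_cong) (rule sum_same_value[OF I])
qed

text \<open>The block sums of a positive semi-definite matrix: use coefficients that are constant on the
  blocks.\<close>

lemma psd_average:
  assumes "psd (I \<times> S) K" shows "psd I (\<lambda>i j. \<Sum>s\<in>S. \<Sum>t\<in>S. K (i, s) (j, t))"
proof (rule psdI)
  fix c :: "'a \<Rightarrow> complex"
  have "(\<Sum>i\<in>I. \<Sum>j\<in>I. c i * cnj (c j) * of_real (\<Sum>s\<in>S. \<Sum>t\<in>S. K (i, s) (j, t))) =
    (\<Sum>i\<in>I. \<Sum>s\<in>S. \<Sum>j\<in>I. \<Sum>t\<in>S. c i * cnj (c j) * of_real (K (i, s) (j, t)))"
    by (simp add: sum_distrib_left sum.swap[of _ S I])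
  also have "\<dots> = (\<Sum>i\<in>I. \<Sum>s\<in>S. \<Sum>r\<in>I \<times> S. c i * cnj (c (fst r)) * of_real (K (i, s) r))"
    by (intro sum.cong refl) (simp add: sum.cartesian_product case_prod_beta)
  also have "\<dots> = (\<Sum>p\<in>I \<times> S. \<Sum>r\<in>I \<times> S. c (fst p) * cnj (c (fst r)) * of_real (K p r))"
    unfolding sum.cartesian_product[where A = I and B = S] by (simp add: case_prod_beta)
  finally show "(\<Sum>i\<in>I. \<Sum>j\<in>I. c i * cnj (c j) * of_real (\<Sum>s\<in>S. \<Sum>t\<in>S. K (i, s) (j, t))) \<in> \<real>\<^sub>\<ge>\<^sub>0"
    using psdD[OF assms, of "\<lambda>p. c (fst p)"] by (simp only:)
qed

text \<open>By Gram-Schmidt, finitely many vectors have coordinates with respect to a finite orthonormal set,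
  which makes their Gram matrix a finite sum of rank one matrices.\<close>

lemma finite_parseval:
  fixes S :: "'h::real_inner set"
  assumes "finite S"
  shows "\<exists>B. finite B \<and> (\<forall>b\<in>B. \<forall>b'\<in>B. b \<bullet> b' = of_bool (b = b')) \<and>
    (\<forall>u\<in>S. u = (\<Sum>b\<in>B. (u \<bullet> b) *\<^sub>R b))"
  using assms
proof (induction S rule: finite_induct)
  case empty
  show ?case by (intro exI[of _ "{}"]) simp
next
  case (insert v S)
  then obtain B where B: "finite B" "\<And>b b'. b \<in> B \<Longrightarrow> b' \<in> B \<Longrightarrow> b \<bullet> b' = of_bool (b = b')"
    "\<And>u. u \<in> S \<Longrightarrow> u = (\<Sum>b\<in>B. (u \<bullet> b) *\<^sub>R b)" by blast
  define w where "w = v - (\<Sum>b\<in>B. (v \<bullet> b) *\<^sub>R b)"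
  have proj: "(\<Sum>b\<in>B. (u \<bullet> b) *\<^sub>R b) \<bullet> b' = u \<bullet> b'" if "b' \<in> B" for u b'
  proof -
    have "(\<Sum>b\<in>B. (u \<bullet> b) *\<^sub>R b) \<bullet> b' = (\<Sum>b\<in>B. if b = b' then u \<bullet> b' else 0)"
      unfolding inner_sum_left by (intro sum.cong refl) (simp add: B(2) that)
    then show ?thesis using that B(1) by (simp add: sum.delta)
  qed
  have wb: "w \<bullet> b = 0" if "b \<in> B" for b using proj[OF that] by (simp add: w_def inner_diff_left)
  show ?case
  proof (cases "w = 0")
    case True
    then have "v = (\<Sum>b\<in>B. (v \<bullet> b) *\<^sub>R b)" by (simp add: w_def)
    then show ?thesis using B by (intro exI[of _ B]) auto
  next
    case False
    define e where "e = (1 / norm w) *\<^sub>R w"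
    have eb: "e \<bullet> b = 0" "b \<bullet> e = 0" if "b \<in> B" for b using wb[OF that] by (simp_all add: e_def inner_commute)
    have ee: "e \<bullet> e = 1" using False by (simp add: e_def dot_square_norm power2_eq_square)
    have "e \<notin> B" using eb ee by force
    have uB: "u \<bullet> e = 0" if "u \<in> S" for u
    proof -
      have "u \<bullet> e = (\<Sum>b\<in>B. (u \<bullet> b) *\<^sub>R b) \<bullet> e" using B(3)[OF that] by simp
      also have "\<dots> = 0" unfolding inner_sum_left using eb by (simp add: sum.neutral)
      finally show ?thesis .
    qed
    have "v = w + (\<Sum>b\<in>B. (v \<bullet> b) *\<^sub>R b)" by (simp add: w_def)
    moreover have "v \<bullet> e = norm w"
    proof -
      have "w \<bullet> w = v \<bullet> w - (\<Sum>b\<in>B. (v \<bullet> b) *\<^sub>R b) \<bullet> w" by (simp add: w_def inner_diff_left)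
      also have "(\<Sum>b\<in>B. (v \<bullet> b) *\<^sub>R b) \<bullet> w = 0"
        unfolding inner_sum_left using wb by (simp add: sum.neutral inner_commute)
      finally have "v \<bullet> w = (norm w)\<^sup>2" by (simp add: dot_square_norm)
      then show ?thesis using False by (simp add: e_def power2_eq_square)
    qed
    then have "(v \<bullet> e) *\<^sub>R e = w" using False by (simp add: e_def)
    ultimately have v: "v = (\<Sum>b\<in>insert e B. (v \<bullet> b) *\<^sub>R b)" using B(1) \<open>e \<notin> B\<close> by simp
    have u: "u = (\<Sum>b\<in>insert e B. (u \<bullet> b) *\<^sub>R b)" if "u \<in> S" for u
      using B(1) \<open>e \<notin> B\<close> uB[OF that] B(3)[OF that] by simp
    show ?thesis
    proof (intro exI[of _ "insert e B"] conjI ballI)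
      show "finite (insert e B)" using B(1) by simp
      show "b \<bullet> b' = of_bool (b = b')" if "b \<in> insert e B" "b' \<in> insert e B" for b b'
        using that B(2) eb ee \<open>e \<notin> B\<close> by auto
      show "u = (\<Sum>b\<in>insert e B. (u \<bullet> b) *\<^sub>R b)" if "u \<in> insert v S" for u
        using that u v by auto
    qed
  qed
qed

lemma psd_inner_mult:
  fixes v :: "'i \<Rightarrow> 'h::real_inner"
  assumes K: "psd I K" and I: "finite I" shows "psd I (\<lambda>i j. (v i \<bullet> v j) * K i j)"
proof -
  obtain B where B: "\<forall>u\<in>v ` I. u = (\<Sum>b\<in>B. (u \<bullet> b) *\<^sub>R b)"
    using finite_parseval[OF finite_imageI[OF I, of v]] by blast
  have "psd I (\<lambda>i j. \<Sum>b\<in>B. (v i \<bullet> b) * (v j \<bullet> b) * K i j)"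
    by (intro psd_sum psd_rank_one_mult K)
  then show ?thesis
  proof (rule psd_cong)
    fix i j assume "i \<in> I" "j \<in> I"
    have "v i \<bullet> v j = (\<Sum>b\<in>B. (v i \<bullet> b) *\<^sub>R b) \<bullet> v j" using B \<open>i \<in> I\<close> by (metis imageI)
    also have "\<dots> = (\<Sum>b\<in>B. (v i \<bullet> b) * (v j \<bullet> b))"
      unfolding inner_sum_left inner_scaleR_left by (simp only: inner_commute[of _ "v j"])
    finally show "(\<Sum>b\<in>B. (v i \<bullet> b) * (v j \<bullet> b) * K i j) = (v i \<bullet> v j) * K i j" by (simp only: sum_distrib_right)
  qed
qed

lemma psd_prod_inner_mult:
  fixes v :: "'r \<Rightarrow> 'i \<Rightarrow> 'h::real_inner"
  assumes K: "psd I K" and I: "finite I" shows "psd I (\<lambda>i j. (\<Prod>r\<in>R. v r i \<bullet> v r j) * K i j)"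
proof (induction R rule: infinite_finite_induct)
  case (insert r R)
  then show ?case using psd_inner_mult[OF insert.IH I, of "v r"] by (simp add: mult_ac)
qed (use K in simp_all)

text \<open>Colourings of \<open>X\<close> with \<open>N\<close> colours that are constant on the cycles of \<open>\<gamma>\<close>: their number is the
  trace of \<open>\<gamma>\<close> on the tensor power of an \<open>N\<close>-dimensional space, which is why \<open>\<chi>\<^sub>q\<close> with
  \<open>q = 1 / N\<close> is positive semi-definite. For \<open>q = - 1 / N\<close> there is an additional factor \<open>sign \<gamma>\<close>.\<close>

lemma card_invariant_colourings:
  fixes \<gamma> :: "nat \<Rightarrow> nat"
  assumes g: "\<gamma> permutes X" and X: "finite X"
  shows "card {f \<in> X \<rightarrow>\<^sub>E {..<N::nat}. \<forall>x\<in>X. f (\<gamma> x) = f x} = N ^ card (orbit \<gamma> ` X)"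
proof -
  note perm = permutes_permutation[OF g X]
  note self = permutation_self_in_orbit[OF perm]
  let ?O = "orbit \<gamma> ` X"
  define h where "h F = (\<lambda>x\<in>X. F (orbit \<gamma> x))" for F :: "nat set \<Rightarrow> nat"
  have inj: "inj_on h (?O \<rightarrow>\<^sub>E {..<N})"
  proof (rule inj_onI)
    fix F F' assume F: "F \<in> ?O \<rightarrow>\<^sub>E {..<N}" "F' \<in> ?O \<rightarrow>\<^sub>E {..<N}" and eq: "h F = h F'"
    show "F = F'"
    proof (rule PiE_ext[OF F])
      fix c assume "c \<in> ?O"
      then obtain x where x: "c = orbit \<gamma> x" "x \<in> X" by (elim imageE)
      show "F c = F' c" using fun_cong[OF eq, of x] x(2) unfolding x(1) h_def by simp
    qed
  qed
  have img: "h ` (?O \<rightarrow>\<^sub>E {..<N}) = {f \<in> X \<rightarrow>\<^sub>E {..<N}. \<forall>x\<in>X. f (\<gamma> x) = f x}"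
  proof (intro equalityI subsetI)
    fix f assume "f \<in> h ` (?O \<rightarrow>\<^sub>E {..<N})"
    then obtain F where F: "F \<in> ?O \<rightarrow>\<^sub>E {..<N}" "f = h F" by blast
    have "F (orbit \<gamma> x) \<in> {..<N}" if "x \<in> X" for x using that by (intro PiE_mem[OF F(1)] imageI)
    then have "f \<in> X \<rightarrow>\<^sub>E {..<N}" unfolding F(2) h_def by auto
    moreover have "f (\<gamma> x) = f x" if "x \<in> X" for x
    proof -
      have "\<gamma> x \<in> X" using that by (simp add: permutes_in_image[OF g])
      moreover have "orbit \<gamma> (\<gamma> x) = orbit \<gamma> x" by (rule permutation_orbit_step[OF perm])
      ultimately show ?thesis using that by (simp only: F(2) h_def restrict_apply')
    qed
    ultimately show "f \<in> {f \<in> X \<rightarrow>\<^sub>E {..<N}. \<forall>x\<in>X. f (\<gamma> x) = f x}" by blast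
  next
    fix f assume "f \<in> {f \<in> X \<rightarrow>\<^sub>E {..<N}. \<forall>x\<in>X. f (\<gamma> x) = f x}"
    then have f: "f \<in> X \<rightarrow>\<^sub>E {..<N}" and inv: "\<And>x. x \<in> X \<Longrightarrow> f (\<gamma> x) = f x" by auto
    have const: "f y = f x" if "x \<in> X" "y \<in> orbit \<gamma> x" for x y
      using that(2)
    proof induction
      case base
      show ?case by (rule inv[OF that(1)])
    next
      case (step y)
      then have "y \<in> X" using permutes_orbit_subset[OF g that(1)] by blast
      then show ?case using step.IH inv by simp
    qed
    define r where "r c = (SOME x. x \<in> X \<and> c = orbit \<gamma> x)" for c
    have r: "r c \<in> X \<and> c = orbit \<gamma> (r c)" if "c \<in> ?O" for c
      unfolding r_def by (rule someI_ex) (use that in \<open>elim imageE, blast\<close>)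
    define F where "F = (\<lambda>c\<in>?O. f (r c))"
    have "F \<in> ?O \<rightarrow>\<^sub>E {..<N}" unfolding F_def using r PiE_mem[OF f] by auto
    moreover have "h F = f"
    proof
      fix x show "h F x = f x"
      proof (cases "x \<in> X")
        case True
        then have o: "orbit \<gamma> x \<in> ?O" by (rule imageI)
        have "r (orbit \<gamma> x) \<in> orbit \<gamma> x" using r[OF o] self by metis
        then have "f (r (orbit \<gamma> x)) = f x" by (rule const[OF True])
        then show ?thesis using True o by (simp only: h_def F_def restrict_apply')
      next
        case False
        then show ?thesis using PiE_arb[OF f False] by (simp add: h_def)
      qed
    qed
    ultimately show "f \<in> h ` (?O \<rightarrow>\<^sub>E {..<N})" by blast
  qed
  have "card {f \<in> X \<rightarrow>\<^sub>E {..<N}. \<forall>x\<in>X. f (\<gamma> x) = f x} = card (?O \<rightarrow>\<^sub>E {..<N})"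
    unfolding img[symmetric] by (rule card_image[OF inj])
  also have "\<dots> = N ^ card ?O" using X by (simp add: card_PiE)
  finally show ?thesis .
qed

lemma chi_inverse_nat:
  assumes a: "\<gamma> \<in> Sym0 n" and N: "N \<ge> 1"
  shows "chi (1 / real N) n \<gamma> =
    (1 / real N) ^ Suc n * real (card {f \<in> {0..n} \<rightarrow>\<^sub>E {..<N}. \<forall>x\<in>{0..n}. f (\<gamma> x) = f x})"
proof -
  let ?c = "cyc0 {0..n} \<gamma>"
  have le: "?c \<le> n" by (rule cyc0_le[OF Sym0_permutation[OF a]])
  have "card {f \<in> {0..n} \<rightarrow>\<^sub>E {..<N}. \<forall>x\<in>{0..n}. f (\<gamma> x) = f x} = N ^ Suc ?c"
    using card_invariant_colourings[OF Sym0_permutes[OF a], of N] card_orbits[OF Sym0_permutation[OF a], of "{0..n}"]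
    by (simp only: finite_atLeastAtMost atLeastAtMost_iff le0 simp_thms)
  moreover have "(1 / real N) ^ Suc n = (1 / real N) ^ (n - ?c) * (1 / real N) ^ Suc ?c"
    using le by (simp flip: power_add)
  moreover have "(1 / real N) ^ Suc ?c * real (N ^ Suc ?c) = 1"
    using N by (simp add: power_one_over)
  ultimately show ?thesis by (simp only: chi_def perm_len_def mult.assoc mult_1_right)
qed

text \<open>Erasing the largest point \<open>d\<close> multiplies the permutation by the transposition of \<open>d\<close> and \<open>\<gamma> d\<close>, and
  loses a cycle only if \<open>d\<close> is fixed.\<close>

lemma sign_eq_cyc0: "\<gamma> \<in> Sym0 n \<Longrightarrow> (-1) ^ (n - cyc0 {0..n} \<gamma>) = real_of_int (sign \<gamma>)"
proof (induction n arbitrary: \<gamma>)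
  case 0
  then have "\<gamma> = id" by (simp add: Sym0_def)
  then show ?case by simp
next
  case (Suc n)
  let ?d = "Suc n"
  note perm = Sym0_permutation[OF Suc.prems]
  define \<delta> where "\<delta> = erase {?d} \<gamma>"
  have "{0..Suc n} - {?d} = {0..n}" by auto
  then have d: "\<delta> \<in> Sym0 n" and c: "cyc0 {0..Suc n} \<gamma> = cyc0 {0..n} \<delta> + cyc_in {?d} \<gamma>"
    using erase_permutes[OF Sym0_permutes[OF Suc.prems], of "{?d}"]
      cyc0_erase[OF Sym0_permutes[OF Suc.prems], of "{?d}"] by (simp_all add: Sym0_def \<delta>_def)
  have le: "cyc0 {0..n} \<delta> \<le> n" by (rule cyc0_le[OF Sym0_permutation[OF d]])
  show ?case
  proof (cases "\<gamma> ?d = ?d")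
    case True
    then have "orbit \<gamma> ?d = {?d}" by (simp only: orbit_eq_singleton_iff)
    then have "{c \<in> orbit \<gamma> ` {?d}. c \<subseteq> {?d}} = {{?d}}" by (simp only: image_insert image_empty) auto
    then have "cyc_in {?d} \<gamma> = 1" unfolding cyc_in_def by (simp only:) simp
    moreover have "\<delta> = \<gamma>" unfolding \<delta>_def using True by (intro erase_fixed perm) simp
    ultimately show ?thesis using Suc.IH[OF d] c by simp
  next
    case False
    have "\<gamma> ?d \<in> orbit \<gamma> ?d" by (rule orbit.base)
    then have "\<not> orbit \<gamma> ?d \<subseteq> {?d}" using False by blast
    then have "{c \<in> orbit \<gamma> ` {?d}. c \<subseteq> {?d}} = {}" by (simp only: image_insert image_empty) auto
    then have "cyc_in {?d} \<gamma> = 0" unfolding cyc_in_def by (simp only: card.empty)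
    moreover have "\<delta> = Transposition.transpose ?d (\<gamma> ?d) \<circ> \<gamma>"
    proof
      fix x
      have "\<gamma> x = \<gamma> ?d \<longleftrightarrow> x = ?d" using perm by (metis bij_is_inj inj_eq permutation)
      then show "\<delta> x = (Transposition.transpose ?d (\<gamma> ?d) \<circ> \<gamma>) x"
        using False by (auto simp: \<delta>_def erase_singleton[OF perm] Transposition.transpose_def)
    qed
    then have "sign \<delta> = - sign \<gamma>"
      using perm False by (simp add: sign_compose permutation_swap_id sign_swap_id)
    moreover have "Suc n - cyc0 {0..n} \<delta> = Suc (n - cyc0 {0..n} \<delta>)" using le by simp
    ultimately show ?thesis using Suc.IH[OF d] c by simp
  qed
qed

text \<open>A colouring is preserved by \<open>\<alpha> \<beta>\<^sup>-\<^sup>1\<close> if and only if its composites with \<open>\<alpha>\<close> and \<open>\<beta>\<close> coincide. So for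
  each colouring one gets the matrix that records equality of labels, which is positive semi-definite.\<close>

lemma psd_chi_mult:
  assumes q: "q \<in> Zset - {0}" and K: "psd I K" and I: "finite I" and a: "\<And>i. i \<in> I \<Longrightarrow> a i \<in> Sym0 n"
  shows "psd I (\<lambda>i j. chi q n (a i \<circ> inv (a j)) * K i j)"
proof -
  obtain N where N: "N \<ge> 1" "q = 1 / real N \<or> q = - (1 / real N)" using q by (auto simp: Zset_def)
  define u where "u i = (if q = 1 / real N then 1 else real_of_int (sign (a i)))" for i
  let ?C = "{0..n} \<rightarrow>\<^sub>E {..<N}"
  define \<Phi> where "\<Phi> f i = (\<lambda>x\<in>{0..n}. (f (a i x) :: nat))" for f i
  have "psd I (\<lambda>i j. (1 / real N) ^ Suc n * (\<Sum>f\<in>?C. if \<Phi> f i = \<Phi> f j then u i * u j * K i j else 0))"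
    by (intro psd_scale psd_sum psd_same_value[where K = "\<lambda>_ i j. u i * u j * K i j"] psd_rank_one_mult K I) simp
  then show ?thesis
  proof (rule psd_cong)
    fix i j assume ij: "i \<in> I" "j \<in> I"
    define \<gamma> where "\<gamma> = a i \<circ> inv (a j)"
    note inv = permutes_inverses[OF Sym0_permutes[OF a[OF ij(2)]]]
    have g: "\<gamma> \<in> Sym0 n" unfolding \<gamma>_def by (intro Sym0_comp Sym0_inv a ij)
    have "(\<forall>x\<in>{0..n}. f (\<gamma> x) = f x) \<longleftrightarrow> \<Phi> f i = \<Phi> f j" for f
    proof -
      have "\<Phi> f i = \<Phi> f j \<longleftrightarrow> (\<forall>x\<in>{0..n}. f (a i x) = f (a j x))"
        by (auto simp: \<Phi>_def fun_eq_iff restrict_def)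
      also have "\<dots> \<longleftrightarrow> (\<forall>y\<in>a j ` {0..n}. f (\<gamma> y) = f y)" by (simp add: \<gamma>_def inv)
      finally show ?thesis by (simp only: permutes_image[OF Sym0_permutes[OF a[OF ij(2)]]])
    qed
    then have set: "{f \<in> ?C. \<forall>x\<in>{0..n}. f (\<gamma> x) = f x} = {f \<in> ?C. \<Phi> f i = \<Phi> f j}" by blast
    have fin: "finite ?C" by (intro finite_PiE) simp_all
    have "(\<Sum>f\<in>?C. if \<Phi> f i = \<Phi> f j then u i * u j * K i j else 0) = (\<Sum>f\<in>{f \<in> ?C. \<Phi> f i = \<Phi> f j}. u i * u j * K i j)"
      by (rule sum.inter_filter[OF fin, symmetric])
    then have "(1 / real N) ^ Suc n * (\<Sum>f\<in>?C. if \<Phi> f i = \<Phi> f j then u i * u j * K i j else 0) =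
      chi (1 / real N) n \<gamma> * (u i * u j) * K i j"
      unfolding chi_inverse_nat[OF g N(1)] set by simp
    also have "chi (1 / real N) n \<gamma> * (u i * u j) = chi q n \<gamma>"
    proof (cases "q = 1 / real N")
      case False
      then have qN: "q = - 1 * (1 / real N)" using N(2) by simp
      have "u i * u j = real_of_int (sign \<gamma>)"
        using False Sym0_permutation[OF a[OF ij(1)]] Sym0_permutation[OF a[OF ij(2)]]
        by (simp add: u_def \<gamma>_def sign_compose sign_inverse permutation_inverse)
      moreover have "chi q n \<gamma> = (-1) ^ (n - cyc0 {0..n} \<gamma>) * chi (1 / real N) n \<gamma>"
        unfolding chi_def perm_len_def qN by (rule power_mult_distrib)
      ultimately show ?thesis using sign_eq_cyc0[OF g] by simp
    qed (simp add: u_def)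
    finally show "(1 / real N) ^ Suc n * (\<Sum>f\<in>?C. if \<Phi> f i = \<Phi> f j then u i * u j * K i j else 0) =
      chi q n (a i \<circ> inv (a j)) * K i j" unfolding \<gamma>_def .
  qed
qed

text \<open>Conjugation invariance allows one to symmetrize the form in its first argument as well, which
  brings it to the shape \<open>K (i, \<tau>) (j, \<sigma>)\<close> of a block sum.\<close>

lemma qsum_average:
  assumes a: "\<alpha> \<in> Sym0 n" and F: "F \<in> tpow n" and b: "\<beta> \<in> Sym0 n" and G: "G \<in> tpow n"
  shows "qsum q n \<alpha> F \<beta> G = 1 / fact n * (\<Sum>\<tau>\<in>Sym n. \<Sum>\<sigma>\<in>Sym n.
    chi q n ((\<tau> \<circ> \<alpha> \<circ> inv \<tau>) \<circ> inv (\<sigma> \<circ> \<beta> \<circ> inv \<sigma>)) * tens_inner (Uperm n \<tau> F) (Uperm n \<sigma> G))"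
proof -
  have "(\<Sum>\<tau>\<in>Sym n. \<Sum>\<sigma>\<in>Sym n.
    chi q n ((\<tau> \<circ> \<alpha> \<circ> inv \<tau>) \<circ> inv (\<sigma> \<circ> \<beta> \<circ> inv \<sigma>)) * tens_inner (Uperm n \<tau> F) (Uperm n \<sigma> G)) =
    (\<Sum>\<tau>\<in>Sym n. qsum q n (\<tau> \<circ> \<alpha> \<circ> inv \<tau>) (Uperm n \<tau> F) \<beta> G)"
    unfolding qsum_def
  proof (rule sum.cong[OF refl], rule sum.cong[OF refl])
    fix \<tau> \<sigma> assume s: "\<sigma> \<in> Sym n"
    have "(\<tau> \<circ> \<alpha> \<circ> inv \<tau>) \<circ> inv (\<sigma> \<circ> \<beta> \<circ> inv \<sigma>) = \<tau> \<circ> \<alpha> \<circ> inv \<tau> \<circ> \<sigma> \<circ> inv \<beta> \<circ> inv \<sigma>"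
      unfolding inv_conj_Sym[OF s b] by (simp only: comp_assoc)
    then show "chi q n ((\<tau> \<circ> \<alpha> \<circ> inv \<tau>) \<circ> inv (\<sigma> \<circ> \<beta> \<circ> inv \<sigma>)) * tens_inner (Uperm n \<tau> F) (Uperm n \<sigma> G) =
      chi q n (\<tau> \<circ> \<alpha> \<circ> inv \<tau> \<circ> \<sigma> \<circ> inv \<beta> \<circ> inv \<sigma>) * tens_inner (Uperm n \<tau> F) (Uperm n \<sigma> G)"
      by (simp only:)
  qed
  also have "\<dots> = (\<Sum>\<tau>\<in>Sym n. qsum q n \<alpha> F \<beta> G)"
    by (intro sum.cong refl) (rule qsum_conj_left[OF a F b G])
  also have "\<dots> = fact n * qsum q n \<alpha> F \<beta> G"
    using card_permutations[of "{1..n}" n] by (simp add: Sym_def)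
  finally show ?thesis by simp
qed

lemma psd_qsum:
  assumes q: "q \<in> Zset - {0}" and I: "finite I" and a: "\<And>i. i \<in> I \<Longrightarrow> a i \<in> Sym0 n"
  shows "psd I (\<lambda>i j. qsum q n (a i) (tens (tab n (h i))) (a j) (tens (tab n (h j :: nat \<Rightarrow> 'h::real_inner))))"
proof -
  define A where "A p = snd p \<circ> a (fst p) \<circ> inv (snd p)" for p :: "_ \<times> (nat \<Rightarrow> nat)"
  define v where "v r p = h (fst p) (inv (snd p) r)" for r :: nat and p :: "_ \<times> (nat \<Rightarrow> nat)"
  have A: "A p \<in> Sym0 n" if "p \<in> I \<times> Sym n" for p
    unfolding A_def using that a by (intro Sym0_conj) auto
  have base: "psd (I \<times> Sym n) (\<lambda>p r. chi q n (A p \<circ> inv (A r)) * ((\<Prod>x\<in>{1..n}. v x p \<bullet> v x r) * 1))"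
    by (intro psd_chi_mult psd_prod_inner_mult psd_one q A finite_cartesian_product I finite_Sym)
  have "psd I (\<lambda>i j. 1 / fact n * (\<Sum>\<tau>\<in>Sym n. \<Sum>\<sigma>\<in>Sym n.
      chi q n (A (i, \<tau>) \<circ> inv (A (j, \<sigma>))) * ((\<Prod>x\<in>{1..n}. v x (i, \<tau>) \<bullet> v x (j, \<sigma>)) * 1)))"
    by (rule psd_scale[OF psd_average[OF base]]) simp
  then show ?thesis
  proof (rule psd_cong)
    fix i j assume ij: "i \<in> I" "j \<in> I"
    show "1 / fact n * (\<Sum>\<tau>\<in>Sym n. \<Sum>\<sigma>\<in>Sym n.
        chi q n (A (i, \<tau>) \<circ> inv (A (j, \<sigma>))) * ((\<Prod>x\<in>{1..n}. v x (i, \<tau>) \<bullet> v x (j, \<sigma>)) * 1)) =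
      qsum q n (a i) (tens (tab n (h i))) (a j) (tens (tab n (h j)))"
      unfolding qsum_average[OF a[OF ij(1)] tens_tab_tpow a[OF ij(2)] tens_tab_tpow]
      by (intro arg_cong2[where f = "(*)"] refl sum.cong)
         (simp_all only: A_def v_def fst_conv snd_conv Uperm_tab tens_inner_tab comp_apply mult_1_right)
  qed
qed

text \<open>Every element is a finite combination of generators, so positivity reduces to that of a
  matrix.\<close>

lemma tp_as_sum:
  fixes X :: "'h::real_inner tp"
  shows "\<exists>M c n \<alpha> h. (\<forall>i<M::nat. \<alpha> i \<in> Sym0 (n i)) \<and> X = (\<Sum>i<M. c i *\<^sub>C W (n i) (ga (\<alpha> i)) (tens (tab (n i) (h i))))"
proof -
  define w where "w = (\<lambda>(c, n, \<alpha>, h :: nat \<Rightarrow> 'h). c *\<^sub>C W n (ga \<alpha>) (tens (tab n h)))"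
  have "\<exists>L. (\<forall>(c, n, \<alpha>, h)\<in>set L. \<alpha> \<in> Sym0 n) \<and> X = sum_list (map w L)"
  proof (induction X rule: tp_induct)
    case (gen n \<alpha> h)
    then show ?case by (intro exI[of _ "[(1, n, \<alpha>, h)]"]) (simp add: w_def)
  next
    case (add x y)
    then obtain L M where "(\<forall>(c, n, \<alpha>, h)\<in>set L. \<alpha> \<in> Sym0 n)" "x = sum_list (map w L)"
      "(\<forall>(c, n, \<alpha>, h)\<in>set M. \<alpha> \<in> Sym0 n)" "y = sum_list (map w M)" by blast
    then show ?case by (intro exI[of _ "L @ M"]) auto
  next
    case (scale c x)
    then obtain L where L: "\<forall>(c, n, \<alpha>, h)\<in>set L. \<alpha> \<in> Sym0 n" "x = sum_list (map w L)" by blast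
    define s where "s = (\<lambda>(d, r). (c * d, r :: nat \<times> (nat \<Rightarrow> nat) \<times> (nat \<Rightarrow> 'h)))"
    have "c *\<^sub>C sum_list (map w L) = sum_list (map w (map s L))"
      by (induction L) (simp_all add: w_def s_def case_prod_beta tp.scale_right_distrib)
    then show ?case using L by (intro exI[of _ "map s L"]) (auto simp: s_def)
  qed
  then obtain L where L: "\<forall>(c, n, \<alpha>, h)\<in>set L. \<alpha> \<in> Sym0 n" "X = sum_list (map w L)" by blast
  show ?thesis
  proof (intro exI conjI allI impI)
    show "fst (snd (snd (L ! i))) \<in> Sym0 (fst (snd (L ! i)))" if "i < length L" for i
      using bspec[OF L(1) nth_mem[OF that]] by (simp add: case_prod_beta)
    show "X = (\<Sum>i<length L. fst (L ! i) *\<^sub>C W (fst (snd (L ! i))) (ga (fst (snd (snd (L ! i)))))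
        (tens (tab (fst (snd (L ! i))) (snd (snd (snd (L ! i)))))))"
      unfolding L(2) sum_list_sum_nth by (simp add: w_def case_prod_beta atLeast0LessThan)
  qed
qed



lemma qform_nonneg:
  assumes q: "q \<in> Zset - {0}" shows "qform q X X \<in> \<real>\<^sub>\<ge>\<^sub>0"
proof -
  obtain M :: nat and c n \<alpha> h where a: "\<forall>i<M. \<alpha> i \<in> Sym0 (n i)"
    and X: "X = (\<Sum>i<M. c i *\<^sub>C W (n i) (ga (\<alpha> i)) (tens (tab (n i) (h i))))"
    using tp_as_sum[of X] by blast
  (* in degree m the indices of other degrees are padded with the identity *)
  define b where "b m i = (if n i = m then \<alpha> i else id)" for m i
  define K where "K m i j = qsum q m (b m i) (tens (tab m (h i))) (b m j) (tens (tab m (h j)))" for m i j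
  have psd: "psd {..<M} (\<lambda>i j. if n i = n j then K (n i) i j else 0)"
    unfolding K_def
    by (intro psd_same_value[where K = K, unfolded K_def] psd_qsum q finite_lessThan)
       (use a in \<open>auto simp: b_def Sym0_def permutes_id\<close>)
  have "qform q X X = (\<Sum>i<M. \<Sum>j<M. c i * cnj (c j) * of_real (if n i = n j then K (n i) i j else 0))"
    unfolding X qform_sum
  proof (intro sum.cong refl arg_cong2[where f = "(*)"])
    fix i j assume "i \<in> {..<M}" "j \<in> {..<M}"
    then show "qform q (W (n i) (ga (\<alpha> i)) (tens (tab (n i) (h i)))) (W (n j) (ga (\<alpha> j)) (tens (tab (n j) (h j)))) =
      of_real (if n i = n j then K (n i) i j else 0)"
      using a by (subst qform_W) (auto intro: tens_tab_tpow simp: K_def b_def)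
  qed
  then show ?thesis using psdD[OF psd] by (simp only:)
qed

section \<open>The kernel of the form and the quotient\<close>

lemma nonneg_line:
  fixes c z :: complex
  assumes "\<And>s :: real. c + of_real s * z \<in> \<real>\<^sub>\<ge>\<^sub>0" shows "z = 0"
proof -
  have re: "0 \<le> Re c + s * Re z" and im: "Im c + s * Im z = 0" for s
    using assms[of s] by (simp_all add: complex_nonneg_Reals_iff)
  have "Im z = 0" using im[of 0] im[of 1] by simp
  moreover have "Re z = 0"
  proof (rule ccontr)
    assume "Re z \<noteq> 0"
    then have "Re c + (- (Re c + 1) / Re z) * Re z = - 1" by simp
    then show False using re[of "- (Re c + 1) / Re z"] by linarith
  qed
  ultimately show ?thesis by (simp add: complex_eq_iff)
qed

text \<open>A null vector of a positive semi-definite form is orthogonal to everything, since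
  \<open>\<langle>y + t x, y + t x\<rangle>\<close> is non-negative and depends affinely on \<open>t\<close> along every real line through \<open>0\<close>.\<close>

lemma Nvs_orthogonal:
  assumes q: "q \<in> Zset - {0}" and x: "x \<in> Nvs q"
  shows "qform q x y = 0"
proof -
  let ?A = "qform q x y" and ?B = "qform q y x"
  have xx: "qform q x x = 0" using x by (simp add: Nvs_def)
  have expand: "qform q (y + t *\<^sub>C x) (y + t *\<^sub>C x) = qform q y y + (t * ?A + cnj t * ?B)" for t
    by (simp add: linear_tpD[OF linear_qform] linear_tpD[OF antilinear_qform] xx algebra_simps)
  have line: "t * ?A + cnj t * ?B = 0" for t
  proof (rule nonneg_line)
    fix s :: real
    have "qform q y y + of_real s * (t * ?A + cnj t * ?B) =
      qform q (y + (of_real s * t) *\<^sub>C x) (y + (of_real s * t) *\<^sub>C x)"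
      unfolding expand by (simp add: algebra_simps)
    then show "qform q y y + of_real s * (t * ?A + cnj t * ?B) \<in> \<real>\<^sub>\<ge>\<^sub>0"
      using qform_nonneg[OF q] by (simp only:)
  qed
  have "?A + ?B = 0" "\<i> * ?A - \<i> * ?B = 0" using line[of 1] line[of \<i>] by simp_all
  then have "?A = - ?B" "?A = ?B" by (simp_all add: eq_neg_iff_add_eq_0)
  then show ?thesis by simp
qed

lemma Nvs_iff:
  assumes "q \<in> Zset - {0}" shows "x \<in> Nvs q \<longleftrightarrow> (\<forall>y. qform q x y = 0)"
  using Nvs_orthogonal[OF assms] by (auto simp: Nvs_def)

lemma subspace_Nvs:
  assumes "q \<in> Zset - {0}" shows "tp.subspace (Nvs q)"
  by (rule tp.subspaceI)
     (simp_all add: Nvs_iff[OF assms] linear_tpD[OF linear_qform] linear_tp_0[OF linear_qform])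

lemma tp_star_diff: "tp_star q (x - y) = tp_star q x - tp_star q y"
proof -
  have "tp_star q (x - y + y) = tp_star q (x - y) + tp_star q y" by (rule tp_star_add)
  then show ?thesis by (simp add: algebra_simps)
qed

context vacuum
begin

lemma tp_star_Nvs: "tp_star q x \<in> Nvs q \<longleftrightarrow> (x :: 'h tp) \<in> Nvs q"
proof -
  have "qform q (tp_star q x) (tp_star q x) = \<phi> (tp_mult q x (tp_star q x))"
    by (simp only: phi_mult)
  also have "\<dots> = \<phi> (tp_mult q (tp_star q x) x)" by (rule phi_trace)
  also have "\<dots> = qform q x x" by (rule phi_star_mult)
  finally show ?thesis by (simp add: Nvs_def)
qed

lemma phi_respects:
  assumes "q \<in> Zset - {0}" shows "\<phi> respects nrel q"
proof (rule congruentI)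
  fix x y :: "'h tp" assume "(x, y) \<in> nrel q"
  then have "qform q (x - y) (W 0 (ga id) (tens [])) = 0"
    using Nvs_orthogonal[OF assms, of "x - y"] by (simp only: nrel_def mem_Collect_eq prod.case)
  then have "\<phi> (x - y) = 0" unfolding phi_eq_qform .
  then show "\<phi> x = \<phi> y" by (simp add: linear_tp_diff[OF lin])
qed

text \<open>By \<open>phi_mult\<close>, changing representatives of the factors of \<open>x\<^sup>* x\<close> by null vectors changes \<open>\<phi> (x\<^sup>* x)\<close> by
  inner products with null vectors, which vanish.\<close>

lemma quotient_faithful:
  assumes q: "q \<in> Zset - {0}" and X: "X \<in> TPq q"
    and zero: "tpq_induced \<phi> (tpq_mult q (tpq_star q X) X) = 0"
  shows "X = tpq_zero q"
proof -
  note sub = subspace_Nvs[OF q]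
  obtain A where A: "X = nrel q `` {A}" using X by (auto simp: TPq_def elim: quotientE)
  have mem: "B \<in> nrel q `` {C} \<longleftrightarrow> C - B \<in> Nvs q" for B C :: "'h tp" by (simp add: nrel_def)
  have refl: "C - C \<in> Nvs q" for C :: "'h tp" using tp.subspace_0[OF sub] by simp
  have const: "\<phi> C = qform q A A" if CX: "C \<in> tpq_mult q (tpq_star q X) X" for C
  proof -
    obtain B D E where B: "A - D \<in> Nvs q" "tp_star q D - B \<in> Nvs q" and E: "A - E \<in> Nvs q" and C: "tp_mult q B E - C \<in> Nvs q"
      using CX unfolding tpq_mult_def tpq_star_def A by (auto simp: nrel_def)
    have "tp_star q (tp_star q D - B) \<in> Nvs q" unfolding tp_star_Nvs by (rule B(2))
    then have "D - tp_star q B \<in> Nvs q" by (simp only: tp_star_diff tp_star_star)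
    then have "(A - D) + (D - tp_star q B) \<in> Nvs q" by (rule tp.subspace_add[OF sub B(1)])
    then have N: "A - tp_star q B \<in> Nvs q" by simp
    have "(tp_mult q B E, C) \<in> nrel q" using C by (simp add: nrel_def)
    then have "\<phi> C = \<phi> (tp_mult q B E)" using congruentD[OF phi_respects[OF q]] by metis
    also have "\<dots> = qform q E (tp_star q B)" by (rule phi_mult)
    also have "\<dots> = qform q A (tp_star q B)"
      using Nvs_orthogonal[OF q E, of "tp_star q B"] by (simp add: linear_tp_diff[OF linear_qform])
    also have "\<dots> = qform q A A"
    proof -
      have "qform q A (A - tp_star q B) = \<phi> (tp_mult q (tp_star q (A - tp_star q B)) A)"
        by (rule phi_star_mult[symmetric])
      also have "\<dots> = \<phi> (tp_mult q A (tp_star q (A - tp_star q B)))" by (rule phi_trace)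
      also have "\<dots> = qform q (tp_star q (A - tp_star q B)) (tp_star q A)" by (rule phi_mult)
      also have "\<dots> = 0" using N by (intro Nvs_orthogonal[OF q]) (simp only: tp_star_Nvs)
      finally show ?thesis by (simp add: linear_tp_diff[OF antilinear_qform])
    qed
    finally show ?thesis .
  qed
  have AX: "A \<in> X" unfolding A mem by (rule refl)
  have SX: "tp_star q A \<in> tpq_star q X"
    unfolding tpq_star_def by (rule UN_I[OF AX], unfold mem, rule refl)
  have "tp_mult q (tp_star q A) A \<in> tpq_mult q (tpq_star q X) X"
    unfolding tpq_mult_def by (rule UN_I[OF SX], rule UN_I[OF AX], unfold mem, rule refl)
  then have "\<phi> ` tpq_mult q (tpq_star q X) X = {qform q A A}" using const by (auto intro: rev_image_eqI)
  then have "qform q A A = 0" using zero by (simp add: tpq_induced_def)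
  then have AN: "A \<in> Nvs q" by (simp add: Nvs_def)
  have "A - B \<in> Nvs q \<longleftrightarrow> 0 - B \<in> Nvs q" for B
  proof
    assume "A - B \<in> Nvs q"
    from tp.subspace_diff[OF sub this AN] show "0 - B \<in> Nvs q" by simp
  next
    assume "0 - B \<in> Nvs q"
    from tp.subspace_add[OF sub this AN] show "A - B \<in> Nvs q" by simp
  qed
  then show ?thesis unfolding A tpq_zero_def by (intro set_eqI) (simp only: mem)
qed

lemma phi_T_even:
  assumes a: "\<alpha> \<in> Sym0 (2 * n)" and F: "F \<in> tpow (2 * n)"
  shows "\<phi> (T q (2 * n) (ga \<alpha>) F) = of_real (\<Sum>\<pi>\<in>P2 (2 * n).
      q powi (int n - int (cyc0 {0..2 * n} (\<pi> \<circ> \<alpha>))) * tens_scal (contr_tens (2 * n) \<pi> F))"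
    and "\<phi> (T q (2 * n) (ga \<alpha>) F) = of_real (\<Sum>\<pi>\<in>P2 (2 * n).
      q powi (int (perm_len (2 * n) (\<pi> \<circ> \<alpha>)) - int n) * tens_scal (contr_tens (2 * n) \<pi> F))"
proof -
  have np: "npairs \<pi> = n" if "\<pi> \<in> P2 (2 * n)" for \<pi>
    using P2_iff(1)[OF P2_P12[OF that]] that by simp
  show first: "\<phi> (T q (2 * n) (ga \<alpha>) F) = of_real (\<Sum>\<pi>\<in>P2 (2 * n).
      q powi (int n - int (cyc0 {0..2 * n} (\<pi> \<circ> \<alpha>))) * tens_scal (contr_tens (2 * n) \<pi> F))"
    unfolding phi_T[OF a F] by (intro arg_cong[where f = of_real] sum.cong refl) (simp only: np)
  have "int (perm_len (2 * n) (\<pi> \<circ> \<alpha>)) - int n = int n - int (cyc0 {0..2 * n} (\<pi> \<circ> \<alpha>))"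
    if "\<pi> \<in> P2 (2 * n)" for \<pi>
    using cyc0_le[OF P12_comp_permutes(2)[OF P2_P12[OF that] a], of "2 * n"] by (simp add: perm_len_def of_nat_diff)
  then show "\<phi> (T q (2 * n) (ga \<alpha>) F) = of_real (\<Sum>\<pi>\<in>P2 (2 * n).
      q powi (int (perm_len (2 * n) (\<pi> \<circ> \<alpha>)) - int n) * tens_scal (contr_tens (2 * n) \<pi> F))"
    unfolding first by (intro arg_cong[where f = of_real] sum.cong refl) (simp only:)
qed

lemma phi_T_odd:
  assumes "\<alpha> \<in> Sym0 (2 * n + 1)" "F \<in> tpow (2 * n + 1)"
  shows "\<phi> (T q (2 * n + 1) (ga \<alpha>) F) = 0"
proof -
  have "\<pi> \<notin> P2 (2 * n + 1)" for \<pi>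
  proof
    assume p: "\<pi> \<in> P2 (2 * n + 1)"
    then have "2 * npairs \<pi> = 2 * n + 1" using P2_iff(1)[OF P2_P12[OF p]] by simp
    then show False by presburger
  qed
  then have "P2 (2 * n + 1) = {}" by blast
  then show ?thesis unfolding phi_T[OF assms] by (simp only: sum.empty of_real_0)
qed

end

theorem theoremV15:
  fixes q :: real
    and \<phi> :: "'h::{real_inner, complete_space} tp \<Rightarrow> complex"
  assumes q: "q \<noteq> 0"
    and lin: "clinear_functional \<phi>"
    and unital: "\<phi> (W 0 (ga id) (tens [])) = 1"
    and vanish: "\<And>n \<eta> F. n \<ge> 1 \<Longrightarrow> \<eta> \<in> CSym0 n \<Longrightarrow> F \<in> tpow n \<Longrightarrow> \<phi> (W n \<eta> F) = 0"
  shows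
    "(\<forall>n k. \<forall>\<alpha>\<in>Sym0 n. \<forall>\<beta>\<in>Sym0 k. \<forall>F\<in>tpow n. \<forall>G\<in>tpow k.
        \<phi> (tp_mult q (tp_star q (W k (ga \<beta>) G)) (W n (ga \<alpha>) F))
          = qform q (W n (ga \<alpha>) F) (W k (ga \<beta>) G))
     \<and> (q \<in> Zset - {0} \<longrightarrow> \<phi> respects nrel q)
     \<and> (\<forall>A B. \<phi> (tp_mult q A B) = \<phi> (tp_mult q B A))
     \<and> (q \<in> Zset - {0} \<longrightarrow> (\<forall>A. \<phi> (tp_mult q (tp_star q A) A) \<in> \<real>\<^sub>\<ge>\<^sub>0))
     \<and> (q \<in> Zset - {0} \<longrightarrow>
          {A. \<phi> (tp_mult q (tp_star q A) A) = 0} = tp.span (Nvs q) \<and>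
          (\<forall>X\<in>TPq q. tpq_induced \<phi> (tpq_mult q (tpq_star q X) X) = 0 \<longrightarrow> X = tpq_zero q))
     \<and> (\<forall>n. \<forall>\<alpha>\<in>Sym0 (2 * n). \<forall>F\<in>tpow (2 * n).
          \<phi> (T q (2 * n) (ga \<alpha>) F) =
            of_real (\<Sum>\<pi>\<in>P2 (2 * n). q powi (int n - int (cyc0 {0..2 * n} (\<pi> \<circ> \<alpha>)))
                       * tens_scal (contr_tens (2 * n) \<pi> F))
          \<and> \<phi> (T q (2 * n) (ga \<alpha>) F) =
            of_real (\<Sum>\<pi>\<in>P2 (2 * n). q powi (int (perm_len (2 * n) (\<pi> \<circ> \<alpha>)) - int n)
                       * tens_scal (contr_tens (2 * n) \<pi> F)))
     \<and> (\<forall>n. \<forall>\<alpha>\<in>Sym0 (2 * n + 1). \<forall>F\<in>tpow (2 * n + 1).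
          \<phi> (T q (2 * n + 1) (ga \<alpha>) F) = 0)"
proof -
  interpret vacuum q \<phi> by (rule vacuum.intro[OF q lin unital vanish])
  show ?thesis
  proof (intro conjI allI ballI impI)
    fix A B show "\<phi> (tp_mult q A B) = \<phi> (tp_mult q B A)" by (rule phi_trace)
  next
    assume z: "q \<in> Zset - {0}"
    show "\<phi> respects nrel q" by (rule phi_respects[OF z])
    show "\<phi> (tp_mult q (tp_star q A) A) \<in> \<real>\<^sub>\<ge>\<^sub>0" for A
      unfolding phi_star_mult by (rule qform_nonneg[OF z])
    have "tp.span (Nvs q) = (Nvs q :: 'h tp set)"
      using subspace_Nvs[OF z] by (simp only: tp.span_eq_iff)
    then show "{A. \<phi> (tp_mult q (tp_star q A) A) = 0} = tp.span (Nvs q)"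
      by (simp only: phi_star_mult Nvs_def)
    show "X = tpq_zero q" if "X \<in> TPq q" "tpq_induced \<phi> (tpq_mult q (tpq_star q X) X) = 0" for X
      by (rule quotient_faithful[OF z that])
  qed (rule phi_star_mult phi_T_even phi_T_odd; assumption?)+
qed


end
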